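(* $\mathrm{PAI}^{\circ}+\alpha$ is not a retract of $\mathrm{CT}$.
   Context: $\mathcal{L}_{\mathrm{A}}=\{+,\cdot,\mathrm{S},<,0\}$. $\mathrm{CT}$ is $\mathrm{PA}$ with induction for all $\mathcal{L}_{\mathrm{A}}\cup\{T\}$-formulae plus a single sentence stating that $T$ satisfies Tarski's inductive clauses for a truth predicate for all (codes of) arithmetical sentences. $\mathrm{PAI}^{\circ}$ is the $\mathcal{L}_{\mathrm{A}}\cup\{I\}$-theory with axioms: (1) $\mathrm{PA}$ with induction for all $\mathcal{L}_{\mathrm{A}}\cup\{I\}$-formulae; (2) "$I$ is unbounded"; (3) for each $\mathcal{L}_{\mathrm{A}}$-formula $\varphi(v_1,\dots,v_n)$: for all $x_1<\dots<x_n$ and $y_1<\dots<y_n$ in $I$ with $\ulcorner\varphi\urcorner<x_1$ and $\ulcorner\varphi\urcorner<y_1$, $\varphi(\bar x)\leftrightarrow\varphi(\bar y)$. The sentence $\alpha$: for the recursive transformation of an $\mathcal{L}_{\mathrm{A}}$-formula $\varphi(\bar x)$ (built with $\neg,\vee,\exists$) into a $\Delta_0$-formula $\varphi^*(\bar x,z_1,\dots,z_k)$ given by $\varphi^*=\varphi$ for atomic $\varphi$, $(\neg\varphi)^*=\neg\varphi^*$, $(\varphi_1\vee\varphi_2)^*=\varphi_1^*\vee\varphi_2^*$, $(\exists y\,\varphi)^*=\exists y<z_1\,\widetilde{\varphi^*}$ (where $\varphi^*=\varphi^*(\bar x,y,z_1,\dots,z_k)$ and $\widetilde{\varphi^*}$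 replaces each $z_i$ by $z_{i+1}$), let $\sigma(x)$ express: $x=\langle\varphi,\bar a\rangle$ and, with $j$ the least element of $I$ exceeding $\ulcorner\varphi\urcorner$ and all $a_s$ and $i_1<\dots<i_k$ the next $k$ elements of $I$ above $j$, $\varphi^*(\bar a,i_1,\dots,i_k)$ holds according to the canonical $\Sigma_1$ satisfaction predicate for $\Delta_0$-formulae. $\alpha$ says "the set defined by $\sigma$ satisfies Tarski's satisfaction clauses for all $\mathcal{L}_{\mathrm{A}}$-formulae of the model". An interpretation $\mathcal{I}$ of $U$ in $V$ is given by a domain formula and translations of $U$-predicates into $V$-formulae such that $V$ proves the translations of all axioms of $U$; it yields uniformly a model $\mathcal{I}(\mathcal{M})\models U$ for each $\mathcal{M}\models V$. $U$ is a retract of $V$ if there are interpretations $\mathcal{I}$ of $U$ in $V$ and $\mathcal{J}$ of $V$ in $U$ and a formula $F$ of $U$'s language such that, in every $\mathcal{M}\models U$ (provably in $U$), $F$ defines an isomorphism from $\mathcal{M}$ onto $\mathcal{I}(\mathcal{J}(\mathcal{M}))$. *)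

theory Defs
  imports Main
begin

section \<open>First-order logic over the language of arithmetic with extra unary predicates\<close>

text \<open>
  Variables are de Bruijn indices.  The type parameter is the set of the unary
  predicate symbols that are added to the language \<open>+, \<cdot>, S, <, 0\<close>; formulae without
  \<open>Pr\<close> are the formulae of the pure language of arithmetic.
\<close>

datatype trm = V nat | Zero | Succ trm | Add trm trm | Mul trm trm

datatype 'p fm =
    Eq trm trm
  | Less trm trm
  | Pr 'p trm
  | Neg "'p fm"
  | Disj "'p fm" "'p fm"
  | Exi "'p fm"

definition Conj :: "'p fm \<Rightarrow> 'p fm \<Rightarrow> 'p fm" where
  "Conj a b = Neg (Disj (Neg a) (Neg b))"

definition Imp :: "'p fm \<Rightarrow> 'p fm \<Rightarrow> 'p fm" where
  "Imp a b = Disj (Neg a) b"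

definition Iff :: "'p fm \<Rightarrow> 'p fm \<Rightarrow> 'p fm" where
  "Iff a b = Conj (Imp a b) (Imp b a)"

definition All :: "'p fm \<Rightarrow> 'p fm" where
  "All a = Neg (Exi (Neg a))"

definition conjs :: "'p fm list \<Rightarrow> 'p fm" where
  "conjs as = foldr Conj as (Eq Zero Zero)"

definition disjs :: "'p fm list \<Rightarrow> 'p fm" where
  "disjs as = foldr Disj as (Neg (Eq Zero Zero))"

abbreviation Exs :: "nat \<Rightarrow> 'p fm \<Rightarrow> 'p fm" where
  "Exs n \<equiv> Exi ^^ n"

abbreviation Alls :: "nat \<Rightarrow> 'p fm \<Rightarrow> 'p fm" where
  "Alls n \<equiv> All ^^ n"

primrec subt :: "(nat \<Rightarrow> trm) \<Rightarrow> trm \<Rightarrow> trm" where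
  "subt s (V i) = s i"
| "subt s Zero = Zero"
| "subt s (Succ a) = Succ (subt s a)"
| "subt s (Add a b) = Add (subt s a) (subt s b)"
| "subt s (Mul a b) = Mul (subt s a) (subt s b)"

definition lift :: "trm \<Rightarrow> trm" where
  "lift = subt (\<lambda>i. V (Suc i))"

definition under :: "(nat \<Rightarrow> trm) \<Rightarrow> nat \<Rightarrow> trm" where
  "under s i = (case i of 0 \<Rightarrow> V 0 | Suc j \<Rightarrow> lift (s j))"

primrec subf :: "(nat \<Rightarrow> trm) \<Rightarrow> 'p fm \<Rightarrow> 'p fm" where
  "subf s (Eq a b) = Eq (subt s a) (subt s b)"
| "subf s (Less a b) = Less (subt s a) (subt s b)"
| "subf s (Pr p a) = Pr p (subt s a)"
| "subf s (Neg a) = Neg (subf s a)"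
| "subf s (Disj a b) = Disj (subf s a) (subf s b)"
| "subf s (Exi a) = Exi (subf (under s) a)"

definition liftf :: "'p fm \<Rightarrow> 'p fm" where
  "liftf = subf (\<lambda>i. V (Suc i))"

definition sub0 :: "trm \<Rightarrow> 'p fm \<Rightarrow> 'p fm" where
  "sub0 t = subf (\<lambda>i. case i of 0 \<Rightarrow> t | Suc j \<Rightarrow> V j)"

text \<open>
  \<open>\<phi> \<bullet> [t\<^sub>0, \<dots>, t\<^sub>n]\<close> is the simultaneous capture-free substitution
  of \<open>t\<^sub>i\<close> for the variable \<open>i\<close>; it is used only for formulae all of whose free
  variables are \<open>\<le> n\<close>.
\<close>

definition inst :: "'p fm \<Rightarrow> trm list \<Rightarrow> 'p fm" (infixl "\<bullet>" 95) where
  "\<phi> \<bullet> ts = subf (\<lambda>i. if i < length ts then ts ! i else V i) \<phi>"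

primrec trm_below :: "nat \<Rightarrow> trm \<Rightarrow> bool" where
  "trm_below n (V i) \<longleftrightarrow> i < n"
| "trm_below n Zero \<longleftrightarrow> True"
| "trm_below n (Succ a) \<longleftrightarrow> trm_below n a"
| "trm_below n (Add a b) \<longleftrightarrow> trm_below n a \<and> trm_below n b"
| "trm_below n (Mul a b) \<longleftrightarrow> trm_below n a \<and> trm_below n b"

text \<open>\<open>fm_below n \<phi>\<close>: all free variables of \<open>\<phi>\<close> are among \<open>0, \<dots>, n - 1\<close>.\<close>

primrec fm_below :: "nat \<Rightarrow> 'p fm \<Rightarrow> bool" where
  "fm_below n (Eq a b) \<longleftrightarrow> trm_below n a \<and> trm_below n b"
| "fm_below n (Less a b) \<longleftrightarrow> trm_below n a \<and> trm_below n b"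
| "fm_below n (Pr p a) \<longleftrightarrow> trm_below n a"
| "fm_below n (Neg a) \<longleftrightarrow> fm_below n a"
| "fm_below n (Disj a b) \<longleftrightarrow> fm_below n a \<and> fm_below n b"
| "fm_below n (Exi a) \<longleftrightarrow> fm_below (Suc n) a"

primrec arithmetical :: "'p fm \<Rightarrow> bool" where
  "arithmetical (Eq a b) \<longleftrightarrow> True"
| "arithmetical (Less a b) \<longleftrightarrow> True"
| "arithmetical (Pr p a) \<longleftrightarrow> False"
| "arithmetical (Neg a) \<longleftrightarrow> arithmetical a"
| "arithmetical (Disj a b) \<longleftrightarrow> arithmetical a \<and> arithmetical b"
| "arithmetical (Exi a) \<longleftrightarrow> arithmetical a"

text \<open>Natural deduction for classical first-order logic with equality.\<close>

inductive proves :: "'p fm set \<Rightarrow> 'p fm \<Rightarrow> bool" (infix "\<turnstile>" 50) where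
  Assm: "a \<in> G \<Longrightarrow> G \<turnstile> a"
| NegI: "insert a G \<turnstile> b \<Longrightarrow> insert a G \<turnstile> Neg b \<Longrightarrow> G \<turnstile> Neg a"
| NegE: "insert (Neg a) G \<turnstile> b \<Longrightarrow> insert (Neg a) G \<turnstile> Neg b \<Longrightarrow> G \<turnstile> a"
| DisjI1: "G \<turnstile> a \<Longrightarrow> G \<turnstile> Disj a b"
| DisjI2: "G \<turnstile> b \<Longrightarrow> G \<turnstile> Disj a b"
| DisjE: "G \<turnstile> Disj a b \<Longrightarrow> insert a G \<turnstile> c \<Longrightarrow> insert b G \<turnstile> c \<Longrightarrow> G \<turnstile> c"
| ExiI: "G \<turnstile> sub0 t a \<Longrightarrow> G \<turnstile> Exi a"
| ExiE: "G \<turnstile> Exi a \<Longrightarrow> insert a (liftf ` G) \<turnstile> liftf c \<Longrightarrow> G \<turnstile> c"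
| EqI: "G \<turnstile> Eq t t"
| EqE: "G \<turnstile> Eq s t \<Longrightarrow> G \<turnstile> sub0 s a \<Longrightarrow> G \<turnstile> sub0 t a"


section \<open>Peano arithmetic with induction for the whole language\<close>

definition basic_axioms :: "'p fm set" where
  "basic_axioms = {
     All (Neg (Eq (Succ (V 0)) Zero)),
     All (All (Imp (Eq (Succ (V 0)) (Succ (V 1))) (Eq (V 0) (V 1)))),
     All (Eq (Add (V 0) Zero) (V 0)),
     All (All (Eq (Add (V 0) (Succ (V 1))) (Succ (Add (V 0) (V 1))))),
     All (Eq (Mul (V 0) Zero) Zero),
     All (All (Eq (Mul (V 0) (Succ (V 1))) (Add (Mul (V 0) (V 1)) (V 0)))),
     All (Neg (Less (V 0) Zero)),
     All (All (Iff (Less (V 0) (Succ (V 1))) (Disj (Less (V 0) (V 1)) (Eq (V 0) (V 1)))))}"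

definition induction_for :: "'p fm \<Rightarrow> 'p fm" where
  "induction_for \<phi> =
     Imp (sub0 Zero \<phi>)
       (Imp (All (Imp \<phi> (subf (\<lambda>i. case i of 0 \<Rightarrow> Succ (V 0) | Suc j \<Rightarrow> V (Suc j)) \<phi>)))
         (All \<phi>))"

definition PA :: "'p fm set" where
  "PA = basic_axioms \<union> {Alls n (induction_for \<phi>) | n \<phi>. fm_below (Suc n) \<phi>}"


section \<open>Goedel numbering\<close>

text \<open>
  The pairing \<open>\<langle>x,y\<rangle> = (x + y)\<^sup>2 + x\<close> is injective (not surjective), is bounded below by
  both components, and is given by a term.  Functions whose name starts with \<open>q\<close>
  take a term denoting the code of an expression to a term denoting the code of the compound one.
\<close>

definition npair :: "nat \<Rightarrow> nat \<Rightarrow> nat" where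
  "npair x y = (x + y) * (x + y) + x"

definition pr :: "trm \<Rightarrow> trm \<Rightarrow> trm" where
  "pr s t = Add (Mul (Add s t) (Add s t)) s"

definition num :: "nat \<Rightarrow> trm" where
  "num n = (Succ ^^ n) Zero"

primrec codet :: "trm \<Rightarrow> nat" where
  "codet (V i) = npair 1 i"
| "codet Zero = npair 2 0"
| "codet (Succ a) = npair 3 (codet a)"
| "codet (Add a b) = npair 4 (npair (codet a) (codet b))"
| "codet (Mul a b) = npair 5 (npair (codet a) (codet b))"

text \<open>Only arithmetical formulae are coded; the value at \<open>Pr\<close> is irrelevant.\<close>

primrec code :: "'p fm \<Rightarrow> nat" where
  "code (Eq a b) = npair 6 (npair (codet a) (codet b))"
| "code (Less a b) = npair 7 (npair (codet a) (codet b))"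
| "code (Pr p a) = 0"
| "code (Neg a) = npair 8 (code a)"
| "code (Disj a b) = npair 9 (npair (code a) (code b))"
| "code (Exi a) = npair 10 (code a)"

definition qVar :: "trm \<Rightarrow> trm" where "qVar i = pr (num 1) i"
definition qZero :: trm where "qZero = pr (num 2) Zero"
definition qSucc :: "trm \<Rightarrow> trm" where "qSucc a = pr (num 3) a"
definition qAdd :: "trm \<Rightarrow> trm \<Rightarrow> trm" where "qAdd a b = pr (num 4) (pr a b)"
definition qMul :: "trm \<Rightarrow> trm \<Rightarrow> trm" where "qMul a b = pr (num 5) (pr a b)"
definition qEq :: "trm \<Rightarrow> trm \<Rightarrow> trm" where "qEq a b = pr (num 6) (pr a b)"
definition qLess :: "trm \<Rightarrow> trm \<Rightarrow> trm" where "qLess a b = pr (num 7) (pr a b)"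
definition qNeg :: "trm \<Rightarrow> trm" where "qNeg a = pr (num 8) a"
definition qDisj :: "trm \<Rightarrow> trm \<Rightarrow> trm" where "qDisj a b = pr (num 9) (pr a b)"
definition qExi :: "trm \<Rightarrow> trm" where "qExi a = pr (num 10) a"
definition qConj :: "trm \<Rightarrow> trm \<Rightarrow> trm" where "qConj a b = qNeg (qDisj (qNeg a) (qNeg b))"


section \<open>Arithmetized syntax and semantics\<close>

text \<open>
  \<open>memF\<close>, with free variables \<open>x = V 0\<close> and \<open>w = V 1\<close>, says that \<open>x\<close> is an entry of the finite
  sequence coded by \<open>w = \<langle>c,\<langle>d,l\<rangle>\<rangle>\<close> by means of Goedel's beta function: for some \<open>i < l\<close>,
  \<open>x\<close> is the remainder of \<open>c\<close> modulo \<open>1 + (i + 1)d\<close>.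
\<close>

definition memF :: "'p fm" where
  "memF = (let c = V 4; d = V 3; l = V 2; i = V 1; q = V 0; x = V 5; w = V 6;
               m = Succ (Mul (Succ i) d) in
     Exs 5 (conjs [Eq w (pr c (pr d l)), Less i l, Eq c (Add (Mul q m) x), Less x m]))"

definition mem :: "trm \<Rightarrow> trm \<Rightarrow> 'p fm" where
  "mem x w = memF \<bullet> [x, w]"

text \<open>
  A primitive recursive relation is arithmetized through its finite derivations.  A rule
  formula \<open>R\<close> with free variables \<open>y = V 0\<close> and \<open>w = V 1\<close> says that \<open>y\<close> follows by one rule from
  elements of the finite set \<open>w\<close>; \<open>derivable R x\<close> says that \<open>x\<close> belongs to some finite
  set all of whose elements follow in one step from elements of the same set.  In all uses below the
  premises of a rule are simpler than its conclusion, so that no circular derivations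
  arise.  Tuples are coded as \<open>\<langle>a,\<langle>b,\<langle>\<dots>\<rangle>\<rangle>\<rangle>\<close>.
\<close>

definition derivable :: "'p fm \<Rightarrow> trm \<Rightarrow> 'p fm" where
  "derivable R x = Exi (Conj (mem (V 1) (V 0)) (All (Imp (mem (V 0) (V 1)) R))) \<bullet> [x]"

text \<open>\<open>\<langle>t,n\<rangle>\<close>: \<open>t\<close> is (the code of) a term with variables below \<open>n\<close>.\<close>

definition TmR :: "'p fm" where
  "TmR = (let t = V 3; n = V 2; a = V 1; b = V 0; y = V 4; w = V 5 in
     Exs 4 (conjs [Eq y (pr t n), disjs [
       conjs [Eq t (qVar a), Less a n],
       Eq t qZero,
       conjs [Eq t (qSucc a), mem (pr a n) w],
       conjs [Eq t (qAdd a b), mem (pr a n) w, mem (pr b n) w],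
       conjs [Eq t (qMul a b), mem (pr a n) w, mem (pr b n) w]]]))"

definition isTm :: "trm \<Rightarrow> trm \<Rightarrow> 'p fm" where
  "isTm t n = derivable TmR (pr t n)"

text \<open>\<open>\<langle>f,n\<rangle>\<close>: \<open>f\<close> is an arithmetical formula with free variables below \<open>n\<close>.\<close>

definition FmR :: "'p fm" where
  "FmR = (let f = V 3; n = V 2; a = V 1; b = V 0; y = V 4; w = V 5 in
     Exs 4 (conjs [Eq y (pr f n), disjs [
       conjs [Eq f (qEq a b), isTm a n, isTm b n],
       conjs [Eq f (qLess a b), isTm a n, isTm b n],
       conjs [Eq f (qNeg a), mem (pr a n) w],
       conjs [Eq f (qDisj a b), mem (pr a n) w, mem (pr b n) w],
       conjs [Eq f (qExi a), mem (pr a (Succ n)) w]]]))"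

definition isFm :: "trm \<Rightarrow> trm \<Rightarrow> 'p fm" where
  "isFm f n = derivable FmR (pr f n)"

definition isSent :: "trm \<Rightarrow> 'p fm" where
  "isSent f = isFm f Zero"

text \<open>
  Lists: the empty list is \<open>0\<close>, and \<open>cns a e\<close> is the list with head \<open>a\<close> and tail \<open>e\<close>.  A list
  \<open>e\<close> serves as the assignment that gives the variable \<open>i\<close> the \<open>i\<close>-th entry of \<open>e\<close>.
\<close>

definition cns :: "trm \<Rightarrow> trm \<Rightarrow> trm" where
  "cns a e = Succ (pr a e)"

text \<open>\<open>\<langle>e,i,x\<rangle>\<close>: the \<open>i\<close>-th entry of the list \<open>e\<close> is \<open>x\<close>.\<close>

definition LookupR :: "'p fm" where
  "LookupR = (let e = V 5; i = V 4; x = V 3; a = V 2; r = V 1; k = V 0; y = V 6; w = V 7 in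
     Exs 6 (conjs [Eq y (pr e (pr i x)), Eq e (cns a r), disjs [
       conjs [Eq i Zero, Eq x a],
       conjs [Eq i (Succ k), mem (pr r (pr k x)) w]]]))"

definition lookup :: "trm \<Rightarrow> trm \<Rightarrow> trm \<Rightarrow> 'p fm" where
  "lookup e i x = derivable LookupR (pr e (pr i x))"

text \<open>\<open>\<langle>e,n\<rangle>\<close>: \<open>e\<close> is a list of length \<open>n\<close>.\<close>

definition LenR :: "'p fm" where
  "LenR = (let e = V 4; n = V 3; a = V 2; r = V 1; k = V 0; y = V 5; w = V 6 in
     Exs 5 (conjs [Eq y (pr e n), disjs [
       conjs [Eq e Zero, Eq n Zero],
       conjs [Eq e (cns a r), Eq n (Succ k), mem (pr r k) w]]]))"

definition len :: "trm \<Rightarrow> trm \<Rightarrow> 'p fm" where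
  "len e n = derivable LenR (pr e n)"

text \<open>\<open>\<langle>e,l,h\<rangle>\<close>: \<open>h\<close> is the concatenation of the lists \<open>e\<close> and \<open>l\<close>.\<close>

definition AppendR :: "'p fm" where
  "AppendR = (let e = V 5; l = V 4; h = V 3; a = V 2; r = V 1; k = V 0; y = V 6; w = V 7 in
     Exs 6 (conjs [Eq y (pr e (pr l h)), disjs [
       conjs [Eq e Zero, Eq h l],
       conjs [Eq e (cns a r), Eq h (cns a k), mem (pr r (pr l k)) w]]]))"

definition append :: "trm \<Rightarrow> trm \<Rightarrow> trm \<Rightarrow> 'p fm" where
  "append e l h = derivable AppendR (pr e (pr l h))"

text \<open>\<open>\<langle>t,e,v\<rangle>\<close>: the term \<open>t\<close> has value \<open>v\<close> under the assignment \<open>e\<close>.\<close>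

definition ValR :: "'p fm" where
  "ValR = (let t = V 6; e = V 5; v = V 4; a = V 3; b = V 2; p = V 1; q = V 0; y = V 7; w = V 8 in
     Exs 7 (conjs [Eq y (pr t (pr e v)), disjs [
       conjs [Eq t (qVar a), lookup e a v],
       conjs [Eq t qZero, Eq v Zero],
       conjs [Eq t (qSucc a), Eq v (Succ p), mem (pr a (pr e p)) w],
       conjs [Eq t (qAdd a b), Eq v (Add p q), mem (pr a (pr e p)) w, mem (pr b (pr e q)) w],
       conjs [Eq t (qMul a b), Eq v (Mul p q), mem (pr a (pr e p)) w, mem (pr b (pr e q)) w]]]))"

definition val :: "trm \<Rightarrow> trm \<Rightarrow> trm \<Rightarrow> 'p fm" where
  "val t e v = derivable ValR (pr t (pr e v))"

text \<open>\<open>\<langle>m,u\<rangle>\<close>: \<open>u\<close> is the numeral of \<open>m\<close>.\<close>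

definition NumR :: "'p fm" where
  "NumR = (let m = V 3; u = V 2; k = V 1; r = V 0; y = V 4; w = V 5 in
     Exs 4 (conjs [Eq y (pr m u), disjs [
       conjs [Eq m Zero, Eq u qZero],
       conjs [Eq m (Succ k), Eq u (qSucc r), mem (pr k r) w]]]))"

definition isNum :: "trm \<Rightarrow> trm \<Rightarrow> 'p fm" where
  "isNum m u = derivable NumR (pr m u)"

text \<open>
  \<open>\<langle>t,d,u,g\<rangle>\<close>: \<open>g\<close> arises from the term \<open>t\<close> by substituting the closed term \<open>u\<close> for the variable
  \<open>d\<close> and lowering the variables above \<open>d\<close> by one.
\<close>

definition SubTmR :: "'p fm" where
  "SubTmR = (let t = V 7; d = V 6; u = V 5; g = V 4; a = V 3; b = V 2; a' = V 1; b' = V 0;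
                 y = V 8; w = V 9 in
     Exs 8 (conjs [Eq y (pr t (pr d (pr u g))), disjs [
       conjs [Eq t (qVar a), Less a d, Eq g t],
       conjs [Eq t (qVar d), Eq g u],
       conjs [Eq t (qVar (Succ a)), Less d (Succ a), Eq g (qVar a)],
       conjs [Eq t qZero, Eq g qZero],
       conjs [Eq t (qSucc a), Eq g (qSucc a'), mem (pr a (pr d (pr u a'))) w],
       conjs [Eq t (qAdd a b), Eq g (qAdd a' b'),
              mem (pr a (pr d (pr u a'))) w, mem (pr b (pr d (pr u b'))) w],
       conjs [Eq t (qMul a b), Eq g (qMul a' b'),
              mem (pr a (pr d (pr u a'))) w, mem (pr b (pr d (pr u b'))) w]]]))"

definition subTm :: "trm \<Rightarrow> trm \<Rightarrow> trm \<Rightarrow> trm \<Rightarrow> 'p fm" where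
  "subTm t d u g = derivable SubTmR (pr t (pr d (pr u g)))"

text \<open>The same for formulae; under a quantifier the variable to be replaced becomes \<open>d + 1\<close>.\<close>

definition SubFmR :: "'p fm" where
  "SubFmR = (let f = V 7; d = V 6; u = V 5; g = V 4; a = V 3; b = V 2; a' = V 1; b' = V 0;
                 y = V 8; w = V 9 in
     Exs 8 (conjs [Eq y (pr f (pr d (pr u g))), disjs [
       conjs [Eq f (qEq a b), Eq g (qEq a' b'), subTm a d u a', subTm b d u b'],
       conjs [Eq f (qLess a b), Eq g (qLess a' b'), subTm a d u a', subTm b d u b'],
       conjs [Eq f (qNeg a), Eq g (qNeg a'), mem (pr a (pr d (pr u a'))) w],
       conjs [Eq f (qDisj a b), Eq g (qDisj a' b'),
              mem (pr a (pr d (pr u a'))) w, mem (pr b (pr d (pr u b'))) w],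
       conjs [Eq f (qExi a), Eq g (qExi a'), mem (pr a (pr (Succ d) (pr u a'))) w]]]))"

definition subFm :: "trm \<Rightarrow> trm \<Rightarrow> trm \<Rightarrow> trm \<Rightarrow> 'p fm" where
  "subFm f d u g = derivable SubFmR (pr f (pr d (pr u g)))"

text \<open>\<open>\<langle>t,c,g\<rangle>\<close>: \<open>g\<close> arises from the term \<open>t\<close> by raising the variables \<open>\<ge> c\<close> by one.\<close>

definition LiftTmR :: "'p fm" where
  "LiftTmR = (let t = V 6; c = V 5; g = V 4; a = V 3; b = V 2; a' = V 1; b' = V 0;
                  y = V 7; w = V 8 in
     Exs 7 (conjs [Eq y (pr t (pr c g)), disjs [
       conjs [Eq t (qVar a), Less a c, Eq g t],
       conjs [Eq t (qVar a), Neg (Less a c), Eq g (qVar (Succ a))],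
       conjs [Eq t qZero, Eq g qZero],
       conjs [Eq t (qSucc a), Eq g (qSucc a'), mem (pr a (pr c a')) w],
       conjs [Eq t (qAdd a b), Eq g (qAdd a' b'), mem (pr a (pr c a')) w, mem (pr b (pr c b')) w],
       conjs [Eq t (qMul a b), Eq g (qMul a' b'), mem (pr a (pr c a')) w, mem (pr b (pr c b')) w]]]))"

definition liftTm :: "trm \<Rightarrow> trm \<Rightarrow> trm \<Rightarrow> 'p fm" where
  "liftTm t c g = derivable LiftTmR (pr t (pr c g))"

definition LiftFmR :: "'p fm" where
  "LiftFmR = (let f = V 6; c = V 5; g = V 4; a = V 3; b = V 2; a' = V 1; b' = V 0;
                  y = V 7; w = V 8 in
     Exs 7 (conjs [Eq y (pr f (pr c g)), disjs [
       conjs [Eq f (qEq a b), Eq g (qEq a' b'), liftTm a c a', liftTm b c b'],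
       conjs [Eq f (qLess a b), Eq g (qLess a' b'), liftTm a c a', liftTm b c b'],
       conjs [Eq f (qNeg a), Eq g (qNeg a'), mem (pr a (pr c a')) w],
       conjs [Eq f (qDisj a b), Eq g (qDisj a' b'), mem (pr a (pr c a')) w, mem (pr b (pr c b')) w],
       conjs [Eq f (qExi a), Eq g (qExi a'), mem (pr a (pr (Succ c) a')) w]]]))"

definition liftFm :: "trm \<Rightarrow> trm \<Rightarrow> trm \<Rightarrow> 'p fm" where
  "liftFm f c g = derivable LiftFmR (pr f (pr c g))"

text \<open>
  \<open>\<langle>f,n,g\<rangle>\<close>: \<open>g\<close> is the transform \<open>f\<^sup>*\<close> of \<open>f\<close>, a formula with free variables below \<open>n\<close>.
  In \<open>f\<^sup>*\<close> the new variables \<open>z\<^sub>1, z\<^sub>2, \<dots>\<close> are \<open>n, n + 1, \<dots>\<close>.  In the clause for \<open>\<exists>y a\<close> the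
  body \<open>a\<close> has free variables below \<open>n + 1\<close> (with \<open>y\<close> being \<open>0\<close>), so in its transform \<open>a'\<close> the variable
  \<open>z\<^sub>i\<close> is \<open>n + i\<close>.  Raising the variables \<open>\<ge> n + 1\<close> replaces each \<open>z\<^sub>i\<close> by \<open>z\<^sub>i\<^sub>+\<^sub>1\<close> and makes
  \<open>n + 1\<close> available for the bound \<open>z\<^sub>1\<close>, which outside the quantifier is \<open>n\<close>.
\<close>

definition StarR :: "'p fm" where
  "StarR = (let f = V 6; n = V 5; g = V 4; a = V 3; b = V 2; a' = V 1; b' = V 0;
                y = V 7; w = V 8 in
     Exs 7 (conjs [Eq y (pr f (pr n g)), disjs [
       conjs [Eq f (qEq a b), Eq g f],
       conjs [Eq f (qLess a b), Eq g f],
       conjs [Eq f (qNeg a), Eq g (qNeg a'), mem (pr a (pr n a')) w],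
       conjs [Eq f (qDisj a b), Eq g (qDisj a' b'), mem (pr a (pr n a')) w, mem (pr b (pr n b')) w],
       conjs [Eq f (qExi a), mem (pr a (pr (Succ n) a')) w, liftFm a' (Succ n) b',
              Eq g (qExi (qConj (qLess (qVar Zero) (qVar (Succ n))) b'))]]]))"

definition star :: "trm \<Rightarrow> trm \<Rightarrow> trm \<Rightarrow> 'p fm" where
  "star f n g = derivable StarR (pr f (pr n g))"

text \<open>
  \<open>\<langle>g,e,c\<rangle>\<close>: the \<open>\<Delta>\<^sub>0\<close>-formula \<open>g\<close> has truth value \<open>c \<in> {0,1}\<close> under the assignment \<open>e\<close>.
  A bounded quantification is \<open>\<exists>y (y < s \<and> h)\<close> where \<open>y\<close> does not occur in \<open>s\<close>.  In de
  Bruijn form the bound occurs in the body as the lifting \<open>t\<close> of a term \<open>s\<close>.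
  Formulae that are not \<open>\<Delta>\<^sub>0\<close> receive no truth value from the clause for the quantifier.
\<close>

definition Sat0R :: "'p fm" where
  "Sat0R = (let g = V 8; e = V 7; c = V 6; s = V 5; t = V 4; h = V 3; p = V 2; q = V 1; r = V 0;
                y = V 9; w = V 10; zero = Zero; one = Succ Zero in
     Exs 9 (conjs [Eq y (pr g (pr e c)), disjs [
       conjs [Eq g (qEq s t), val s e p, val t e q,
              disjs [conjs [Eq c one, Eq p q], conjs [Eq c zero, Neg (Eq p q)]]],
       conjs [Eq g (qLess s t), val s e p, val t e q,
              disjs [conjs [Eq c one, Less p q], conjs [Eq c zero, Neg (Less p q)]]],
       conjs [Eq g (qNeg s),
              disjs [conjs [Eq c one, mem (pr s (pr e zero)) w],
                     conjs [Eq c zero, mem (pr s (pr e one)) w]]],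
       conjs [Eq g (qDisj s t), mem (pr s (pr e p)) w, mem (pr t (pr e q)) w,
              disjs [conjs [Eq c one, disjs [Eq p one, Eq q one]],
                     conjs [Eq c zero, Eq p zero, Eq q zero]]],
       conjs [Eq g (qExi (qConj (qLess (qVar Zero) t) h)), liftTm s Zero t, val s e p,
              All (Imp (Less (V 0) (lift p))
                (disjs [mem (pr (lift h) (pr (cns (V 0) (lift e)) one)) (lift w),
                        mem (pr (lift h) (pr (cns (V 0) (lift e)) zero)) (lift w)])),
              disjs [conjs [Eq c one, Less r p, mem (pr h (pr (cns r e) one)) w],
                     conjs [Eq c zero,
                       All (Imp (Less (V 0) (lift p))
                         (mem (pr (lift h) (pr (cns (V 0) (lift e)) zero)) (lift w)))]]]]]))"

definition sat0 :: "trm \<Rightarrow> trm \<Rightarrow> 'p fm" where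
  "sat0 g e = derivable Sat0R (pr g (pr e (Succ Zero)))"


section \<open>Compositional truth\<close>

datatype tsym = TruthP

abbreviation T :: "trm \<Rightarrow> tsym fm" where
  "T \<equiv> Pr TruthP"

text \<open>
  Tarski's clauses.  As usual, \<open>T\<close> is required to hold of sentences only.  Since closed terms contain no variables, their
  value is computed under the empty assignment.
\<close>

definition Tarski_truth :: "tsym fm" where
  "Tarski_truth = conjs [
     All (Imp (T (V 0)) (isSent (V 0))),
     (let s = V 1; t = V 0 in Alls 2 (Imp (conjs [isTm s Zero, isTm t Zero]) (Iff (T (qEq s t))
        (let s = V 3; t = V 2; p = V 1; q = V 0 in
           Exs 2 (conjs [val s Zero p, val t Zero q, Eq p q]))))),
     (let s = V 1; t = V 0 in Alls 2 (Imp (conjs [isTm s Zero, isTm t Zero]) (Iff (T (qLess s t))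
        (let s = V 3; t = V 2; p = V 1; q = V 0 in
           Exs 2 (conjs [val s Zero p, val t Zero q, Less p q]))))),
     (let f = V 0 in All (Imp (isSent f) (Iff (T (qNeg f)) (Neg (T f))))),
     (let f = V 1; g = V 0 in Alls 2 (Imp (conjs [isSent f, isSent g])
        (Iff (T (qDisj f g)) (Disj (T f) (T g))))),
     (let f = V 0 in All (Imp (isFm f (Succ Zero)) (Iff (T (qExi f))
        (let f = V 3; m = V 2; u = V 1; g = V 0 in
           Exs 3 (conjs [isNum m u, subFm f Zero u g, T g])))))]"

definition CT :: "tsym fm set" where
  "CT = PA \<union> {Tarski_truth}"


section \<open>Indiscernibles\<close>

datatype isym = IndisP

abbreviation I :: "trm \<Rightarrow> isym fm" where
  "I \<equiv> Pr IndisP"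

definition unbounded_I :: "isym fm" where
  "unbounded_I = All (Exi (Conj (Less (V 1) (V 0)) (I (V 0))))"

definition ascending :: "trm list \<Rightarrow> 'p fm" where
  "ascending ts = conjs (map (\<lambda>i. Less (ts ! i) (ts ! Suc i)) [0..<length ts - 1])"

definition indiscernible :: "nat \<Rightarrow> isym fm \<Rightarrow> isym fm" where
  "indiscernible n \<phi> =
     (let xs = map (\<lambda>i. V (n + i)) [0..<n]; ys = map V [0..<n] in
      Alls (2 * n)
        (Imp (conjs (map I xs @ map I ys @
                [ascending xs, ascending ys,
                 Less (num (code \<phi>)) (hd xs), Less (num (code \<phi>)) (hd ys)]))
          (Iff (\<phi> \<bullet> xs) (\<phi> \<bullet> ys))))"

definition PAI0 :: "isym fm set" where
  "PAI0 = PA \<union> {unbounded_I} \<union>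
     {indiscernible n \<phi> | n \<phi>. 1 \<le> n \<and> arithmetical \<phi> \<and> fm_below n \<phi>}"

text \<open>\<open>i\<close> is the least element of \<open>I\<close> above \<open>j\<close>.\<close>

definition nextI :: "trm \<Rightarrow> trm \<Rightarrow> isym fm" where
  "nextI j i = conjs [I i, Less j i,
     All (Imp (conjs [I (V 0), Less (lift j) (V 0)]) (Neg (Less (V 0) (lift i))))]"

text \<open>\<open>\<langle>j,l\<rangle>\<close>: \<open>l\<close> lists, in increasing order, the next elements of \<open>I\<close> above \<open>j\<close>.\<close>

definition ChainR :: "isym fm" where
  "ChainR = (let j = V 3; l = V 2; i = V 1; r = V 0; y = V 4; w = V 5 in
     Exs 4 (conjs [Eq y (pr j l), disjs [
       Eq l Zero,
       conjs [Eq l (cns i r), nextI j i, mem (pr i r) w]]]))"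

definition chain :: "trm \<Rightarrow> trm \<Rightarrow> isym fm" where
  "chain j l = derivable ChainR (pr j l)"

text \<open>\<open>j\<close> is an element of \<open>I\<close> that exceeds \<open>f\<close> and all entries of the list \<open>a\<close>.\<close>

definition exceedsI :: "trm \<Rightarrow> trm \<Rightarrow> trm \<Rightarrow> isym fm" where
  "exceedsI f a j = conjs [I j, Less f j,
     Alls 2 (Imp (lookup (lift (lift a)) (V 1) (V 0)) (Less (V 0) (lift (lift j))))]"

text \<open>
  The formula \<open>\<sigma>\<close> with the free variable \<open>x = V 0\<close>.  A formula \<open>f\<close> is paired with a list \<open>a\<close>, of
  some length \<open>n\<close>, that assigns values to (at least) all its free variables; \<open>f\<^sup>*\<close> is
  evaluated under the concatenation of \<open>a\<close> with the list \<open>l\<close> of \<open>i\<^sub>1 < \<dots> < i\<^sub>k\<close>.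
\<close>

definition sigmaF :: "isym fm" where
  "sigmaF = (let f = V 7; a = V 6; n = V 5; j = V 4; g = V 3; k = V 2; l = V 1; e = V 0; x = V 8 in
     Exs 8 (conjs [Eq x (pr f a), len a n, isFm f n,
       exceedsI f a j, All (Imp (exceedsI (lift f) (lift a) (V 0)) (Neg (Less (V 0) (lift j)))),
       star f n g, isFm g (Add n k), len l k, chain j l,
       append a l e, sat0 g e]))"

definition sigma :: "trm \<Rightarrow> trm \<Rightarrow> isym fm" where
  "sigma f a = sigmaF \<bullet> [pr f a]"

text \<open>Tarski's satisfaction clauses for the class defined by \<open>\<sigma>\<close>.\<close>

definition alpha :: "isym fm" where
  "alpha = conjs [
     (let s = V 3; t = V 2; a = V 1; n = V 0 in
        Alls 4 (Imp (conjs [len a n, isTm s n, isTm t n]) (Iff (sigma (qEq s t) a)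
          (let s = V 5; t = V 4; a = V 3; p = V 1; q = V 0 in
             Exs 2 (conjs [val s a p, val t a q, Eq p q]))))),
     (let s = V 3; t = V 2; a = V 1; n = V 0 in
        Alls 4 (Imp (conjs [len a n, isTm s n, isTm t n]) (Iff (sigma (qLess s t) a)
          (let s = V 5; t = V 4; a = V 3; p = V 1; q = V 0 in
             Exs 2 (conjs [val s a p, val t a q, Less p q]))))),
     (let f = V 2; a = V 1; n = V 0 in
        Alls 3 (Imp (conjs [len a n, isFm f n])
          (Iff (sigma (qNeg f) a) (Neg (sigma f a))))),
     (let f = V 3; g = V 2; a = V 1; n = V 0 in
        Alls 4 (Imp (conjs [len a n, isFm f n, isFm g n])
          (Iff (sigma (qDisj f g) a) (Disj (sigma f a) (sigma g a))))),
     (let f = V 2; a = V 1; n = V 0 in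
        Alls 3 (Imp (conjs [len a n, isFm f (Succ n)])
          (Iff (sigma (qExi f) a) (Exi (sigma (lift f) (cns (V 0) (lift a)))))))]"


section \<open>Interpretations and retracts\<close>

text \<open>
  The predicates that an interpretation translates: equality, \<open><\<close>, the graphs of the function
  symbols (the value is the last argument), and the additional predicates.
\<close>

datatype 'q sym = EqS | LessS | ZeroS | SuccS | AddS | MulS | PrS 'q

primrec arity :: "'q sym \<Rightarrow> nat" where
  "arity EqS = 2"
| "arity LessS = 2"
| "arity ZeroS = 1"
| "arity SuccS = 2"
| "arity AddS = 3"
| "arity MulS = 3"
| "arity (PrS q) = 1"

text \<open>
  A translation (one-dimensional, without parameters) from the language with additional predicates
  \<open>'q\<close> to the one with additional predicates \<open>'p\<close>.  The \<open>i\<close>-th argument of a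
  predicate is the variable \<open>i\<close> of the formula that translates it.  Equality may be
  translated by any definable congruence.
\<close>

record ('q, 'p) translation =
  domain :: "'p fm"
  rel :: "'q sym \<Rightarrow> 'p fm"

definition ExD :: "('q, 'p) translation \<Rightarrow> 'p fm \<Rightarrow> 'p fm" where
  "ExD J \<phi> = Exi (Conj (domain J \<bullet> [V 0]) \<phi>)"

definition AllD :: "('q, 'p) translation \<Rightarrow> 'p fm \<Rightarrow> 'p fm" where
  "AllD J \<phi> = All (Imp (domain J \<bullet> [V 0]) \<phi>)"

text \<open>
  \<open>graph J k t y\<close> says that \<open>V y\<close> is a value of the term \<open>t\<close>, each variable \<open>V i\<close> of \<open>t\<close> being
  read as \<open>V (i + k)\<close>; the values of the subterms are existentially quantified.
\<close>

primrec graph :: "('q, 'p) translation \<Rightarrow> nat \<Rightarrow> trm \<Rightarrow> nat \<Rightarrow> 'p fm" where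
  "graph J k (V i) y = rel J EqS \<bullet> [V (i + k), V y]"
| "graph J k Zero y = rel J ZeroS \<bullet> [V y]"
| "graph J k (Succ s) y =
     ExD J (conjs [graph J (k + 1) s 0, rel J SuccS \<bullet> [V 0, V (y + 1)]])"
| "graph J k (Add s t) y =
     ExD J (ExD J (conjs [graph J (k + 2) s 1, graph J (k + 2) t 0,
       rel J AddS \<bullet> [V 1, V 0, V (y + 2)]]))"
| "graph J k (Mul s t) y =
     ExD J (ExD J (conjs [graph J (k + 2) s 1, graph J (k + 2) t 0,
       rel J MulS \<bullet> [V 1, V 0, V (y + 2)]]))"

primrec translate :: "('q, 'p) translation \<Rightarrow> 'q fm \<Rightarrow> 'p fm" where
  "translate J (Eq s t) =
     ExD J (ExD J (conjs [graph J 2 s 1, graph J 2 t 0, rel J EqS \<bullet> [V 1, V 0]]))"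
| "translate J (Less s t) =
     ExD J (ExD J (conjs [graph J 2 s 1, graph J 2 t 0, rel J LessS \<bullet> [V 1, V 0]]))"
| "translate J (Pr q t) = ExD J (conjs [graph J 1 t 0, rel J (PrS q) \<bullet> [V 0]])"
| "translate J (Neg \<phi>) = Neg (translate J \<phi>)"
| "translate J (Disj \<phi> \<psi>) = Disj (translate J \<phi>) (translate J \<psi>)"
| "translate J (Exi \<phi>) = ExD J (translate J \<phi>)"

text \<open>
  The following say that the translated predicates yield a structure on the domain
  modulo the translated equality.  Symmetry and transitivity of equality are
  instances of congruence for \<open>EqS\<close>, given reflexivity.
\<close>

definition congruence :: "('q, 'p) translation \<Rightarrow> 'q sym \<Rightarrow> 'p fm" where
  "congruence J s = (let n = arity s; xs = map (\<lambda>i. V (n + i)) [0..<n]; ys = map V [0..<n] in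
     (AllD J ^^ (2 * n))
       (Imp (conjs (map (\<lambda>i. rel J EqS \<bullet> [xs ! i, ys ! i]) [0..<n] @ [rel J s \<bullet> xs]))
         (rel J s \<bullet> ys)))"

definition total :: "('q, 'p) translation \<Rightarrow> 'q sym \<Rightarrow> 'p fm" where
  "total J s = (let n = arity s - 1 in
     (AllD J ^^ n) (ExD J (rel J s \<bullet> (map (\<lambda>i. V (i + 1)) [0..<n] @ [V 0]))))"

definition functional :: "('q, 'p) translation \<Rightarrow> 'q sym \<Rightarrow> 'p fm" where
  "functional J s = (let n = arity s - 1; xs = map (\<lambda>i. V (i + 2)) [0..<n] in
     (AllD J ^^ (n + 2))
       (Imp (conjs [rel J s \<bullet> (xs @ [V 1]), rel J s \<bullet> (xs @ [V 0])])
         (rel J EqS \<bullet> [V 1, V 0])))"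

definition interpretation_of ::
    "('q, 'p) translation \<Rightarrow> 'q fm set \<Rightarrow> 'p fm set \<Rightarrow> bool" where
  "interpretation_of J U W \<longleftrightarrow>
     fm_below 1 (domain J) \<and> (\<forall>s. fm_below (arity s) (rel J s)) \<and>
     W \<turnstile> Exi (domain J) \<and>
     W \<turnstile> AllD J (rel J EqS \<bullet> [V 0, V 0]) \<and>
     (\<forall>s. W \<turnstile> congruence J s) \<and>
     (\<forall>s \<in> {ZeroS, SuccS, AddS, MulS}. W \<turnstile> total J s \<and> W \<turnstile> functional J s) \<and>
     (\<forall>\<phi> \<in> U. W \<turnstile> translate J \<phi>)"

definition id_trans :: "('p, 'p) translation" where
  "id_trans = \<lparr>domain = Eq (V 0) (V 0),
     rel = (\<lambda>s. case s of
        EqS \<Rightarrow> Eq (V 0) (V 1)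
      | LessS \<Rightarrow> Less (V 0) (V 1)
      | ZeroS \<Rightarrow> Eq Zero (V 0)
      | SuccS \<Rightarrow> Eq (Succ (V 0)) (V 1)
      | AddS \<Rightarrow> Eq (Add (V 0) (V 1)) (V 2)
      | MulS \<Rightarrow> Eq (Mul (V 0) (V 1)) (V 2)
      | PrS p \<Rightarrow> Pr p (V 0))\<rparr>"

text \<open>
  If \<open>J\<close> interprets \<open>W\<close> in \<open>U\<close>, and \<open>K\<close> interprets some theory in \<open>W\<close>, then in a
  model \<open>M\<close> of \<open>U\<close> the translation \<open>comp_trans K J\<close> defines the structure \<open>K(J(M))\<close>.
\<close>

definition comp_trans ::
    "('r, 'q) translation \<Rightarrow> ('q, 'p) translation \<Rightarrow> ('r, 'p) translation" where
  "comp_trans K J = \<lparr>domain = Conj (domain J) (translate J (domain K)),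
     rel = (\<lambda>s. translate J (rel K s))\<rparr>"

text \<open>
  The theory \<open>U\<close> proves that \<open>F(x,y)\<close>, with \<open>x = V 0\<close> and \<open>y = V 1\<close>, defines an isomorphism
  between the structures given by \<open>J\<close> and \<open>K\<close>.  Preservation of \<open>EqS\<close> says that the induced map
  is well defined and injective modulo the two equalities.
\<close>

definition defines_iso ::
    "'p fm set \<Rightarrow> 'p fm \<Rightarrow> ('q, 'p) translation \<Rightarrow> ('q, 'p) translation \<Rightarrow> bool" where
  "defines_iso U F J K \<longleftrightarrow>
     fm_below 2 F \<and>
     U \<turnstile> Alls 2 (Imp F (Conj (domain J \<bullet> [V 0]) (domain K \<bullet> [V 1]))) \<and>
     U \<turnstile> AllD J (ExD K (F \<bullet> [V 1, V 0])) \<and>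
     U \<turnstile> AllD K (ExD J (F \<bullet> [V 0, V 1])) \<and>
     (\<forall>s. let n = arity s; xs = map (\<lambda>i. V (n + i)) [0..<n]; ys = map V [0..<n] in
        U \<turnstile> Alls (2 * n)
          (Imp (conjs (map (\<lambda>i. F \<bullet> [xs ! i, ys ! i]) [0..<n]))
            (Iff (rel J s \<bullet> xs) (rel K s \<bullet> ys))))"

definition retract_of :: "'p fm set \<Rightarrow> 'q fm set \<Rightarrow> bool" where
  "retract_of U W \<longleftrightarrow>
     (\<exists>(J :: ('p, 'q) translation) (K :: ('q, 'p) translation) F.
        interpretation_of J U W \<and> interpretation_of K W U \<and>
        defines_iso U F id_trans (comp_trans J K))"

end

theory Submission
  imports Defs "HOL-Number_Theory.Cong" "HOL-Library.Ramsey" "HOL-Library.Countable_Set"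
begin

text \<open>
  Every finite part of \<open>PAI0 \<union> {alpha}\<close> holds in \<open>(\<nat>, A)\<close> for a suitable infinite \<open>A\<close>: by
  Ramsey's theorem \<open>A\<close> can be chosen homogeneous for the finitely many instances of
  indiscernibility, and if \<open>A\<close> grows so fast that each element bounds the witnesses required by
  the smaller ones, then \<open>\<sigma>\<close> is true satisfaction.  Both properties pass to infinite
  subsets, so there are two different sets \<open>A\<close>, \<open>B\<close> of this kind.

  Suppose the theory is a retract of \<open>CT\<close>.  Only finitely many sentences are needed to see
  that \<open>K(\<nat>, A)\<close> is a model of the truth axiom and of a fragment of arithmetic, and that
  \<open>J(K(\<nat>, A))\<close> is isomorphic to \<open>(\<nat>, A)\<close>.  Thus \<open>K(\<nat>, A)\<close> defines a well-founded order
  without maximal element, and coded ascending sequences force it to be standard.  As Tarski's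
  clauses determine the truth predicate on \<open>\<nat>\<close>, it is \<open>(\<nat>, T)\<close> with the same \<open>T\<close> for \<open>A\<close> and \<open>B\<close>.
  Hence \<open>(\<nat>, A)\<close> and \<open>(\<nat>, B)\<close> are isomorphic to the same structure \<open>J(\<nat>, T)\<close>, and \<open>A = B\<close>
  because \<open>\<nat>\<close> is rigid.
\<close>

section \<open>Semantics\<close>

text \<open>Ramsey's theorem treats finitely many formulae at a time, so the whole argument has to
  run on finitely many sentences. Soundness is therefore proved together with compactness: each
  derived sentence comes with a finite set of axioms that suffices in every structure on a given
  type. No completeness theorem is involved. The price is paid in \<open>K(\<nat>, A)\<close>: of
  the induction scheme of \<open>CT\<close> only instances listed in advance are at hand. They serve
  elementary arithmetic, a coding of finite sets that admits insertion, and one formula that depends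
  on \<open>J\<close>. That structure may a priori be nonstandard. What excludes this comes from
  outside: the order that \<open>J\<close> defines in it is isomorphic to that of \<nat>, so its
  elements have natural numbers as ranks. A coded sequence ascending along that order, with an entry
  at a nonstandard index, would make the ranks descend for ever. Translated equality is only a
  congruence, so \<open>K(\<nat>, A)\<close> is a quotient. It is countable and infinite, and a copy
  with domain \<nat> allows arithmetic with unrestricted quantifiers.\<close>

definition scons :: "'a \<Rightarrow> (nat \<Rightarrow> 'a) \<Rightarrow> nat \<Rightarrow> 'a" (infixr "##" 65) where
  "x ## e = case_nat x e"

lemma scons_simps [simp]:
  "(x ## e) 0 = x" "(x ## e) (Suc i) = e i" "(x ## e) 1 = e 0"
  "(x ## e) (numeral k) = e (pred_numeral k)"
  by (simp_all add: scons_def numeral_eq_Suc)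

record ('a, 'p) struct =
  dom :: "'a set"
  zr :: 'a
  sc :: "'a \<Rightarrow> 'a"
  ad :: "'a \<Rightarrow> 'a \<Rightarrow> 'a"
  mu :: "'a \<Rightarrow> 'a \<Rightarrow> 'a"
  ls :: "'a \<Rightarrow> 'a \<Rightarrow> bool"
  pd :: "'p \<Rightarrow> 'a \<Rightarrow> bool"

primrec tv :: "('a, 'p) struct \<Rightarrow> (nat \<Rightarrow> 'a) \<Rightarrow> trm \<Rightarrow> 'a" where
  "tv M e (V i) = e i"
| "tv M e Zero = zr M"
| "tv M e (Succ a) = sc M (tv M e a)"
| "tv M e (Add a b) = ad M (tv M e a) (tv M e b)"
| "tv M e (Mul a b) = mu M (tv M e a) (tv M e b)"

primrec sat :: "('a, 'p) struct \<Rightarrow> (nat \<Rightarrow> 'a) \<Rightarrow> 'p fm \<Rightarrow> bool" where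
  "sat M e (Eq a b) \<longleftrightarrow> tv M e a = tv M e b"
| "sat M e (Less a b) \<longleftrightarrow> ls M (tv M e a) (tv M e b)"
| "sat M e (Pr p a) \<longleftrightarrow> pd M p (tv M e a)"
| "sat M e (Neg a) \<longleftrightarrow> \<not> sat M e a"
| "sat M e (Disj a b) \<longleftrightarrow> sat M e a \<or> sat M e b"
| "sat M e (Exi a) \<longleftrightarrow> (\<exists>x\<in>dom M. sat M (x ## e) a)"

lemma sat_defs [simp]:
  "sat M e (Conj a b) \<longleftrightarrow> sat M e a \<and> sat M e b"
  "sat M e (Imp a b) \<longleftrightarrow> (sat M e a \<longrightarrow> sat M e b)"
  "sat M e (Iff a b) \<longleftrightarrow> (sat M e a \<longleftrightarrow> sat M e b)"
  "sat M e (All a) \<longleftrightarrow> (\<forall>x\<in>dom M. sat M (x ## e) a)"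
  by (auto simp: Conj_def Imp_def Iff_def All_def)

lemma sat_conjs [simp]: "sat M e (conjs as) \<longleftrightarrow> (\<forall>a\<in>set as. sat M e a)"
  unfolding conjs_def by (induction as) auto

lemma sat_disjs [simp]: "sat M e (disjs as) \<longleftrightarrow> (\<exists>a\<in>set as. sat M e a)"
  unfolding disjs_def by (induction as) auto

lemma tv_subt: "tv M e (subt s t) = tv M (\<lambda>i. tv M e (s i)) t"
  by (induction t) auto

lemma tv_lift [simp]: "tv M (x ## e) (lift t) = tv M e t"
  by (simp add: lift_def tv_subt)

lemma tv_under: "(\<lambda>i. tv M (x ## e) (under s i)) = x ## (\<lambda>i. tv M e (s i))"
proof (rule ext)
  show "tv M (x ## e) (under s i) = (x ## (\<lambda>i. tv M e (s i))) i" for i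
    by (cases i) (simp_all add: under_def)
qed

lemma sat_subf: "sat M e (subf s a) \<longleftrightarrow> sat M (\<lambda>i. tv M e (s i)) a"
  by (induction a arbitrary: e s) (simp_all add: tv_subt tv_under)

lemma sat_liftf [simp]: "sat M (x ## e) (liftf a) \<longleftrightarrow> sat M e a"
  by (simp add: liftf_def sat_subf)

lemma sat_sub0: "sat M e (sub0 t a) \<longleftrightarrow> sat M (tv M e t ## e) a"
proof -
  have "(\<lambda>i. tv M e (case i of 0 \<Rightarrow> t | Suc j \<Rightarrow> V j)) = tv M e t ## e"
    by (rule ext) (auto simp: scons_def split: nat.split)
  then show ?thesis by (simp add: sub0_def sat_subf)
qed

lemma tv_cong: "trm_below n t \<Longrightarrow> (\<And>i. i < n \<Longrightarrow> e i = e' i) \<Longrightarrow> tv M e t = tv M e' t"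
  by (induction t) auto

lemma sat_cong: "fm_below n a \<Longrightarrow> (\<And>i. i < n \<Longrightarrow> e i = e' i) \<Longrightarrow> sat M e a \<longleftrightarrow> sat M e' a"
proof (induction a arbitrary: n e e')
  case (Exi a)
  have "sat M (x ## e) a = sat M (x ## e') a" for x
  proof (rule Exi.IH)
    show "fm_below (Suc n) a" using Exi.prems by simp
    show "(x ## e) i = (x ## e') i" if "i < Suc n" for i
      using that Exi.prems(2) by (cases i) auto
  qed
  then show ?case by simp
next
  case (Disj a b)
  have "sat M e a = sat M e' a" by (rule Disj.IH(1)) (use Disj.prems in auto)
  moreover have "sat M e b = sat M e' b" by (rule Disj.IH(2)) (use Disj.prems in auto)
  ultimately show ?case by simp
next
  case (Neg a)
  have "sat M e a = sat M e' a" by (rule Neg.IH) (use Neg.prems in auto)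
  then show ?case by simp
next
  case (Eq s t)
  then have "tv M e s = tv M e' s" "tv M e t = tv M e' t"
    using tv_cong[of n s e e' M] tv_cong[of n t e e' M] by simp_all
  then show ?case by simp
next
  case (Less s t)
  then have "tv M e s = tv M e' s" "tv M e t = tv M e' t"
    using tv_cong[of n s e e' M] tv_cong[of n t e e' M] by simp_all
  then show ?case by simp
next
  case (Pr p t)
  then have "tv M e t = tv M e' t" using tv_cong[of n t e e' M] by simp
  then show ?case by simp
qed

definition sseq :: "'a \<Rightarrow> 'a list \<Rightarrow> nat \<Rightarrow> 'a" where
  "sseq d xs i = (if i < length xs then xs ! i else d)"

definition satl :: "('a, 'p) struct \<Rightarrow> 'a list \<Rightarrow> 'p fm \<Rightarrow> bool" where
  "satl M xs a \<longleftrightarrow> sat M (sseq (zr M) xs) a"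

lemma sat_inst: "sat M e (a \<bullet> ts) \<longleftrightarrow> sat M (\<lambda>i. if i < length ts then tv M e (ts ! i) else e i) a"
  unfolding inst_def sat_subf by (rule arg_cong[where f = "\<lambda>e. sat M e a"]) auto

lemma sat_inst_satl:
  "fm_below n a \<Longrightarrow> length ts = n \<Longrightarrow> sat M e (a \<bullet> ts) \<longleftrightarrow> satl M (map (tv M e) ts) a"
  unfolding sat_inst satl_def by (rule sat_cong) (auto simp: sseq_def)

lemma satl_cong:
  "fm_below n a \<Longrightarrow> length xs = n \<Longrightarrow> (\<And>i. i < n \<Longrightarrow> e i = xs ! i) \<Longrightarrow> sat M e a \<longleftrightarrow> satl M xs a"
  unfolding satl_def by (rule sat_cong) (auto simp: sseq_def)

text \<open>Soundness and compactness in one induction on derivations: \<open>H\<close> is collected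
  from the derivation, hence chosen before the structure and the assignment. Full domains make every
  value of a term an admissible witness.\<close>

lemma proves_finite_sound:
  assumes "G \<turnstile> a"
  shows "\<exists>H\<subseteq>G. finite H \<and> (\<forall>(M :: ('a, 'p) struct) e. dom M = UNIV \<longrightarrow>
           (\<forall>h\<in>H. sat M e h) \<longrightarrow> sat M e a)"
proof -
  define ent :: "'p fm set \<Rightarrow> 'p fm \<Rightarrow> bool" where
    "ent H a \<longleftrightarrow> (\<forall>(M :: ('a, 'p) struct) e. dom M = UNIV \<longrightarrow> (\<forall>h\<in>H. sat M e h) \<longrightarrow> sat M e a)"
    for H a
  have entI: "ent H a" if "\<And>(M :: ('a, 'p) struct) e. dom M = UNIV \<Longrightarrow> \<forall>h\<in>H. sat M e h \<Longrightarrow> sat M e a" for H a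
    using that unfolding ent_def by blast
  have entD: "sat M e a" if "ent H a" "dom M = UNIV" "\<And>h. h \<in> H \<Longrightarrow> sat M e h"
    for H a and M :: "('a, 'p) struct" and e
    using that unfolding ent_def by blast
  have "\<exists>H\<subseteq>G. finite H \<and> ent H a"
    using assms
  proof (induction rule: proves.induct)
    case (Assm a G)
    then show ?case by (intro exI[of _ "{a}"]) (auto intro: entI)
  next
    case (NegI a G b)
    then obtain H1 H2 where 1: "H1 \<subseteq> insert a G" "finite H1" "H2 \<subseteq> insert a G" "finite H2"
      "ent H1 b" "ent H2 (Neg b)" by blast
    have "ent ((H1 \<union> H2) - {a}) (Neg a)"
    proof (rule entI)
      fix M :: "('a, 'p) struct" and e
      assume 2: "dom M = UNIV" "\<forall>h\<in>H1 \<union> H2 - {a}. sat M e h"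
      show "sat M e (Neg a)"
      proof (rule ccontr)
        assume "\<not> sat M e (Neg a)"
        then have "sat M e h" if "h \<in> H1 \<union> H2" for h using 2 that by (cases "h = a") auto
        then have "sat M e b" "sat M e (Neg b)" using entD[OF 1(5) 2(1)] entD[OF 1(6) 2(1)] by blast+
        then show False by simp
      qed
    qed
    then show ?case using 1 by (intro exI[of _ "(H1 \<union> H2) - {a}"]) auto
  next
    case (NegE a G b)
    then obtain H1 H2 where 1: "H1 \<subseteq> insert (Neg a) G" "finite H1" "H2 \<subseteq> insert (Neg a) G" "finite H2"
      "ent H1 b" "ent H2 (Neg b)" by blast
    have "ent ((H1 \<union> H2) - {Neg a}) a"
    proof (rule entI)
      fix M :: "('a, 'p) struct" and e
      assume 2: "dom M = UNIV" "\<forall>h\<in>H1 \<union> H2 - {Neg a}. sat M e h"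
      show "sat M e a"
      proof (rule ccontr)
        assume "\<not> sat M e a"
        then have "sat M e h" if "h \<in> H1 \<union> H2" for h using 2 that by (cases "h = Neg a") auto
        then have "sat M e b" "sat M e (Neg b)" using entD[OF 1(5) 2(1)] entD[OF 1(6) 2(1)] by blast+
        then show False by simp
      qed
    qed
    then show ?case using 1 by (intro exI[of _ "(H1 \<union> H2) - {Neg a}"]) auto
  next
    case (DisjI1 G a b)
    then show ?case unfolding ent_def by auto
  next
    case (DisjI2 G b a)
    then show ?case unfolding ent_def by auto
  next
    case (DisjE G a b c)
    then obtain H1 H2 H3 where 1: "H1 \<subseteq> G" "finite H1" "H2 \<subseteq> insert a G" "finite H2"
      "H3 \<subseteq> insert b G" "finite H3" "ent H1 (Disj a b)" "ent H2 c" "ent H3 c"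
      by blast
    have "ent (H1 \<union> (H2 - {a}) \<union> (H3 - {b})) c"
    proof (rule entI)
      fix M :: "('a, 'p) struct" and e
      assume 2: "dom M = UNIV" "\<forall>h\<in>H1 \<union> (H2 - {a}) \<union> (H3 - {b}). sat M e h"
      then have "sat M e a \<or> sat M e b" using entD[OF 1(7), of M e] by auto
      then show "sat M e c"
      proof
        assume "sat M e a"
        then have "sat M e h" if "h \<in> H2" for h using 2 that by (cases "h = a") auto
        then show ?thesis using entD 1 2 by blast
      next
        assume "sat M e b"
        then have "sat M e h" if "h \<in> H3" for h using 2 that by (cases "h = b") auto
        then show ?thesis using entD 1 2 by blast
      qed
    qed
    then show ?case using 1 by (intro exI[of _ "H1 \<union> (H2 - {a}) \<union> (H3 - {b})"]) auto
  next
    case (ExiI G t a)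
    then obtain H where "H \<subseteq> G" "finite H" "ent H (sub0 t a)" by blast
    then show ?case unfolding ent_def by (intro exI[of _ H]) (auto simp: sat_sub0)
  next
    case (ExiE G a c)
    then obtain H1 H2 where 1: "H1 \<subseteq> G" "finite H1" "H2 \<subseteq> insert a (liftf ` G)" "finite H2"
      "ent H1 (Exi a)" "ent H2 (liftf c)"
      by blast
    \<comment> \<open>Apart from the witness formula \<open>a\<close>, the premises used are
      liftings. Finitely many of their originals suffice, and a lifted formula ignores the new value
      \<open>x\<close>.\<close>
    from 1 have "finite (H2 - {a})" "H2 - {a} \<subseteq> liftf ` G" by auto
    then obtain H3 where 4: "H3 \<subseteq> G" "finite H3" "H2 - {a} = liftf ` H3"
      by (metis finite_subset_image)
    have "ent (H1 \<union> H3) c"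
    proof (rule entI)
      fix M :: "('a, 'p) struct" and e
      assume 2: "dom M = UNIV" "\<forall>h\<in>H1 \<union> H3. sat M e h"
      have "sat M e (Exi a)" using entD[OF 1(5), of M e] 2 by blast
      then obtain x where x: "sat M (x ## e) a" by auto
      have "sat M (x ## e) h" if "h \<in> H2" for h
      proof (cases "h = a")
        case False
        then have "h \<in> liftf ` H3" using that unfolding 4(3)[symmetric] by simp
        then obtain h' where "h' \<in> H3" "h = liftf h'" by blast
        then show ?thesis using 2 by simp
      qed (use x in simp)
      then have "sat M (x ## e) (liftf c)" using entD[OF 1(6)] 2 by blast
      then show "sat M e c" by simp
    qed
    then show ?case using 1 4 by (intro exI[of _ "H1 \<union> H3"]) auto
  next
    case (EqI G t)
    then show ?case unfolding ent_def by (intro exI[of _ "{}"]) auto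
  next
    case (EqE G s t a)
    then obtain H1 H2 where 1: "H1 \<subseteq> G" "finite H1" "H2 \<subseteq> G" "finite H2"
      "ent H1 (Eq s t)" "ent H2 (sub0 s a)"
      by blast
    have "ent (H1 \<union> H2) (sub0 t a)"
    proof (rule entI)
      fix M :: "('a, 'p) struct" and e
      assume 2: "dom M = UNIV" "\<forall>h\<in>H1 \<union> H2. sat M e h"
      then show "sat M e (sub0 t a)"
        using entD[OF 1(5), of M e] entD[OF 1(6), of M e] by (simp add: sat_sub0)
    qed
    then show ?case using 1 by (intro exI[of _ "H1 \<union> H2"]) auto
  qed
  then show ?thesis unfolding ent_def .
qed

text \<open>Free variables are read as universally quantified, so that closures by
  \<open>Alls\<close> can be stripped. Assignments are confined to the domain because interpreted
  structures occupy only a part of their type.\<close>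

definition models :: "('a, 'p) struct \<Rightarrow> 'p fm \<Rightarrow> bool" (infix "\<Turnstile>" 50) where
  "M \<Turnstile> a \<longleftrightarrow> (\<forall>e. range e \<subseteq> dom M \<longrightarrow> sat M e a)"

lemma proves_finite_sound_set:
  assumes "finite S" "\<And>a. a \<in> S \<Longrightarrow> G \<turnstile> a"
  shows "\<exists>H\<subseteq>G. finite H \<and> (\<forall>(M :: ('a, 'p) struct). dom M = UNIV \<longrightarrow>
           (\<forall>h\<in>H. M \<Turnstile> h) \<longrightarrow> (\<forall>a\<in>S. M \<Turnstile> a))"
  using assms
proof (induction S rule: finite_induct)
  case empty
  then show ?case by auto
next
  case (insert a S)
  then obtain H where H: "H \<subseteq> G" "finite H" "\<forall>(M :: ('a, 'p) struct). dom M = UNIV \<longrightarrow>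
           (\<forall>h\<in>H. M \<Turnstile> h) \<longrightarrow> (\<forall>a\<in>S. M \<Turnstile> a)" by blast
  have "G \<turnstile> a" using insert.prems by blast
  from proves_finite_sound[OF this, where ?'a = 'a] obtain H' where H': "H' \<subseteq> G" "finite H'"
    "\<forall>(M :: ('a, 'p) struct) e. dom M = UNIV \<longrightarrow> (\<forall>h\<in>H'. sat M e h) \<longrightarrow> sat M e a"
    by blast
  have "M \<Turnstile> b" if M: "dom M = UNIV" "\<forall>h\<in>H \<union> H'. M \<Turnstile> h" and b: "b \<in> insert a S"
    for M :: "('a, 'p) struct" and b
  proof (cases "b = a")
    case True
    have "sat M e a" if "range e \<subseteq> dom M" for e
    proof -
      have "\<forall>h\<in>H'. sat M e h" using M(2) that unfolding models_def by blast
      then show ?thesis using H'(3) M(1) by blast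
    qed
    then show ?thesis using True by (simp add: models_def)
  next
    case False
    have "\<forall>h\<in>H. M \<Turnstile> h" using M(2) by blast
    then show ?thesis using H(3) M(1) b False by blast
  qed
  then show ?case using H(1,2) H'(1,2)
    by (intro exI[of _ "H \<union> H'"]) auto
qed

section \<open>The structure defined by an interpretation\<close>

definition tdom :: "('q, 'p) translation \<Rightarrow> ('a, 'p) struct \<Rightarrow> 'a set" where
  "tdom K A = {x \<in> dom A. satl A [x] (domain K)}"

definition trel :: "('q, 'p) translation \<Rightarrow> ('a, 'p) struct \<Rightarrow> 'q sym \<Rightarrow> 'a list \<Rightarrow> bool" where
  "trel K A s xs = satl A xs (rel K s)"

definition tcl :: "('q, 'p) translation \<Rightarrow> ('a, 'p) struct \<Rightarrow> 'a \<Rightarrow> 'a set" where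
  "tcl K A x = {y \<in> tdom K A. trel K A EqS [x, y]}"

text \<open>The quotient by the translated equality, which turns \<open>EqS\<close> into identity.
  The choices by \<open>SOME\<close> are harmless: totality provides a value, and functionality
  together with congruence makes its class unique.\<close>

definition interpreted :: "('q, 'p) translation \<Rightarrow> ('a, 'p) struct \<Rightarrow> ('a set, 'q) struct" where
  "interpreted K A =
     \<lparr>dom = tcl K A ` tdom K A,
      zr = tcl K A (SOME x. x \<in> tdom K A \<and> trel K A ZeroS [x]),
      sc = (\<lambda>c. tcl K A (SOME z. z \<in> tdom K A \<and> (\<exists>x\<in>c. trel K A SuccS [x, z]))),
      ad = (\<lambda>c d. tcl K A (SOME z. z \<in> tdom K A \<and> (\<exists>x\<in>c. \<exists>y\<in>d. trel K A AddS [x, y, z]))),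
      mu = (\<lambda>c d. tcl K A (SOME z. z \<in> tdom K A \<and> (\<exists>x\<in>c. \<exists>y\<in>d. trel K A MulS [x, y, z]))),
      ls = (\<lambda>c d. \<exists>x\<in>c. \<exists>y\<in>d. trel K A LessS [x, y]),
      pd = (\<lambda>q c. \<exists>x\<in>c. trel K A (PrS q) [x])\<rparr>"

lemma upt_simps: "[0..<1] = [0]" "[0..<2] = [0, 1]" "[0..<3] = [0, 1, 2]" "[0..<Suc 0] = [0]"
  by (simp_all add: upt_rec eval_nat_numeral)

lemma range_scons_subset: "range (x ## e) \<subseteq> S \<longleftrightarrow> x \<in> S \<and> range e \<subseteq> S"
proof
  assume *: "range (x ## e) \<subseteq> S"
  have "(x ## e) 0 \<in> S" "(x ## e) (Suc i) \<in> S" for i using * by blast+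
  then show "x \<in> S \<and> range e \<subseteq> S" by auto
next
  assume *: "x \<in> S \<and> range e \<subseteq> S"
  have "(x ## e) i \<in> S" for i using * by (cases i) auto
  then show "range (x ## e) \<subseteq> S" by blast
qed

lemma funpow_simps:
  "(f ^^ 2) x = f (f x)" "(f ^^ 3) x = f (f (f x))" "(f ^^ 4) x = f (f (f (f x)))"
  "(f ^^ 5) x = f (f (f (f (f x))))" "(f ^^ 6) x = f (f (f (f (f (f x)))))"
  "(f ^^ 7) x = f (f (f (f (f (f (f x))))))" "(f ^^ 8) x = f (f (f (f (f (f (f (f x)))))))"
  "(f ^^ 9) x = f (f (f (f (f (f (f (f (f x))))))))"
  by (simp_all add: eval_nat_numeral)

text \<open>The clauses of \<open>interpretation_of\<close> other than those about translated
  axioms, with truth in one structure in place of provability.\<close>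

locale interpreted_model =
  fixes K :: "('q, 'p) translation" and A :: "('a, 'p) struct"
  assumes dom_below: "fm_below 1 (domain K)"
    and rel_below: "\<And>s. fm_below (arity s) (rel K s)"
    and dom_A: "dom A = UNIV"
    and nonempty: "A \<Turnstile> Exi (domain K)"
    and eq_refl: "A \<Turnstile> AllD K (rel K EqS \<bullet> [V 0, V 0])"
    and cong: "\<And>s. A \<Turnstile> congruence K s"
    and tot: "\<And>s. s \<in> {ZeroS, SuccS, AddS, MulS} \<Longrightarrow> A \<Turnstile> total K s"
    and func: "\<And>s. s \<in> {ZeroS, SuccS, AddS, MulS} \<Longrightarrow> A \<Turnstile> functional K s"
begin

abbreviation "D \<equiv> tdom K A"
abbreviation "R \<equiv> trel K A"
abbreviation "E x y \<equiv> trel K A EqS [x, y]"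
abbreviation "cl \<equiv> tcl K A"
abbreviation "N \<equiv> interpreted K A"

lemma models_A: "A \<Turnstile> a \<longleftrightarrow> (\<forall>e. sat A e a)"
  by (simp add: models_def dom_A)

lemma sat_dom: "sat A e (domain K \<bullet> [t]) \<longleftrightarrow> tv A e t \<in> D"
  using sat_inst_satl[OF dom_below, of "[t]"] by (simp add: tdom_def dom_A)

lemma sat_AllD [simp]: "sat A e (AllD K a) \<longleftrightarrow> (\<forall>x\<in>D. sat A (x ## e) a)"
  by (auto simp: AllD_def sat_dom dom_A)

lemma sat_ExD [simp]: "sat A e (ExD K a) \<longleftrightarrow> (\<exists>x\<in>D. sat A (x ## e) a)"
  by (auto simp: ExD_def sat_dom dom_A)

lemma sat_rel [simp]: "length ts = arity s \<Longrightarrow> sat A e (rel K s \<bullet> ts) \<longleftrightarrow> R s (map (tv A e) ts)"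
  using sat_inst_satl[OF rel_below] by (simp add: trel_def)

lemma D_nonempty: "D \<noteq> {}"
proof -
  obtain x where "sat A (x ## undefined) (domain K)" using nonempty by (auto simp: models_A)
  then have "satl A [x] (domain K)" using satl_cong[OF dom_below, of "[x]"] by simp
  then show ?thesis by (auto simp: tdom_def dom_A)
qed

lemma E_refl: "x \<in> D \<Longrightarrow> E x x"
  using eq_refl by (auto simp: models_A)

lemma cong1:
  assumes "arity s = 1" "x \<in> D" "x' \<in> D" "E x x'" "R s [x]" shows "R s [x']"
proof -
  have "sat A undefined (congruence K s) \<longleftrightarrow> (\<forall>x\<in>D. \<forall>x'\<in>D. E x x' \<and> R s [x] \<longrightarrow> R s [x'])"
    using assms(1) by (simp add: congruence_def Let_def upt_simps funpow_simps)
  moreover have "sat A undefined (congruence K s)" using cong by (auto simp: models_A)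
  ultimately show ?thesis using assms by blast
qed

lemma cong2:
  assumes "arity s = 2" "x \<in> D" "x' \<in> D" "y \<in> D" "y' \<in> D" "E x x'" "E y y'" "R s [x, y]"
  shows "R s [x', y']"
proof -
  have "sat A undefined (congruence K s) \<longleftrightarrow> (\<forall>y\<in>D. \<forall>x\<in>D. \<forall>y'\<in>D. \<forall>x'\<in>D. E x x' \<and> E y y' \<and> R s [x, y] \<longrightarrow> R s [x', y'])"
    using assms(1) by (simp add: congruence_def Let_def upt_simps funpow_simps)
  moreover have "sat A undefined (congruence K s)" using cong by (auto simp: models_A)
  ultimately show ?thesis using assms by blast
qed

lemma cong3:
  assumes "arity s = 3" "x \<in> D" "x' \<in> D" "y \<in> D" "y' \<in> D" "z \<in> D" "z' \<in> D"
    "E x x'" "E y y'" "E z z'" "R s [x, y, z]"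
  shows "R s [x', y', z']"
proof -
  have "sat A undefined (congruence K s) \<longleftrightarrow> (\<forall>z\<in>D. \<forall>y\<in>D. \<forall>x\<in>D. \<forall>z'\<in>D. \<forall>y'\<in>D. \<forall>x'\<in>D.
      E x x' \<and> E y y' \<and> E z z' \<and> R s [x, y, z] \<longrightarrow> R s [x', y', z'])"
    using assms(1) by (simp add: congruence_def Let_def upt_simps funpow_simps)
  moreover have "sat A undefined (congruence K s)" using cong by (auto simp: models_A)
  ultimately show ?thesis using assms by blast
qed

lemma E_sym: "x \<in> D \<Longrightarrow> y \<in> D \<Longrightarrow> E x y \<Longrightarrow> E y x"
  using cong2[of EqS x y x x] E_refl by auto

lemma E_trans: "x \<in> D \<Longrightarrow> y \<in> D \<Longrightarrow> z \<in> D \<Longrightarrow> E x y \<Longrightarrow> E y z \<Longrightarrow> E x z"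
  using cong2[of EqS x x y z] E_refl by auto

lemma cl_eq_iff: "x \<in> D \<Longrightarrow> y \<in> D \<Longrightarrow> cl x = cl y \<longleftrightarrow> E x y"
  unfolding tcl_def using E_sym E_trans E_refl by blast

lemma mem_cl: "y \<in> cl x \<longleftrightarrow> y \<in> D \<and> E x y"
  by (simp add: tcl_def)

lemma total_iff:
  "sat A e (total K ZeroS) \<longleftrightarrow> (\<exists>z\<in>D. R ZeroS [z])"
  "sat A e (total K SuccS) \<longleftrightarrow> (\<forall>x\<in>D. \<exists>z\<in>D. R SuccS [x, z])"
  "sat A e (total K AddS) \<longleftrightarrow> (\<forall>y\<in>D. \<forall>x\<in>D. \<exists>z\<in>D. R AddS [x, y, z])"
  "sat A e (total K MulS) \<longleftrightarrow> (\<forall>y\<in>D. \<forall>x\<in>D. \<exists>z\<in>D. R MulS [x, y, z])"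
  by (simp_all add: total_def Let_def upt_simps funpow_simps)

lemma functional_iff:
  "sat A e (functional K ZeroS) \<longleftrightarrow> (\<forall>y\<in>D. \<forall>z\<in>D. R ZeroS [y] \<and> R ZeroS [z] \<longrightarrow> E y z)"
  "sat A e (functional K SuccS) \<longleftrightarrow> (\<forall>x\<in>D. \<forall>y\<in>D. \<forall>z\<in>D.
     R SuccS [x, y] \<and> R SuccS [x, z] \<longrightarrow> E y z)"
  "sat A e (functional K AddS) \<longleftrightarrow> (\<forall>x\<in>D. \<forall>w\<in>D. \<forall>y\<in>D. \<forall>z\<in>D.
     R AddS [w, x, y] \<and> R AddS [w, x, z] \<longrightarrow> E y z)"
  "sat A e (functional K MulS) \<longleftrightarrow> (\<forall>x\<in>D. \<forall>w\<in>D. \<forall>y\<in>D. \<forall>z\<in>D.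
     R MulS [w, x, y] \<and> R MulS [w, x, z] \<longrightarrow> E y z)"
  by (simp_all add: functional_def Let_def upt_simps funpow_simps)

lemma tots:
  "\<exists>z\<in>D. R ZeroS [z]" "\<And>x. x \<in> D \<Longrightarrow> \<exists>z\<in>D. R SuccS [x, z]"
  "\<And>x y. x \<in> D \<Longrightarrow> y \<in> D \<Longrightarrow> \<exists>z\<in>D. R AddS [x, y, z]"
  "\<And>x y. x \<in> D \<Longrightarrow> y \<in> D \<Longrightarrow> \<exists>z\<in>D. R MulS [x, y, z]"
  using tot[of ZeroS] tot[of SuccS] tot[of AddS] tot[of MulS]
  unfolding models_A total_iff by blast+

lemma func1:
  "y \<in> D \<Longrightarrow> z \<in> D \<Longrightarrow> R ZeroS [y] \<Longrightarrow> R ZeroS [z] \<Longrightarrow> E y z"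
  using func[of ZeroS] unfolding models_A functional_iff by blast

lemma func2:
  "x \<in> D \<Longrightarrow> y \<in> D \<Longrightarrow> z \<in> D \<Longrightarrow> R SuccS [x, y] \<Longrightarrow> R SuccS [x, z] \<Longrightarrow> E y z"
  using func[of SuccS] unfolding models_A functional_iff by blast

lemma func3:
  assumes "s \<in> {AddS, MulS}" "w \<in> D" "x \<in> D" "y \<in> D" "z \<in> D" "R s [w, x, y]" "R s [w, x, z]"
  shows "E y z"
  using func[of AddS] func[of MulS] assms unfolding models_A functional_iff by blast

lemma zr_N: "x \<in> D \<Longrightarrow> cl x = zr N \<longleftrightarrow> R ZeroS [x]"
proof -
  assume x: "x \<in> D"
  define w where "w = (SOME x. x \<in> D \<and> R ZeroS [x])"
  have "\<exists>x. x \<in> D \<and> R ZeroS [x]" using tots(1) by blast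
  then have w: "w \<in> D \<and> R ZeroS [w]" unfolding w_def by (rule someI_ex)
  have "cl x = cl w \<longleftrightarrow> R ZeroS [x]"
    unfolding cl_eq_iff[OF x conjunct1[OF w]]
  proof
    assume "E x w"
    then have "E w x" by (rule E_sym[OF x conjunct1[OF w]])
    then show "R ZeroS [x]" by (rule cong1[of ZeroS w x, rotated 3]) (use w x in simp_all)
  next
    assume "R ZeroS [x]"
    then show "E x w" by (rule func1[rotated 2]) (use w x in simp_all)
  qed
  then show ?thesis by (simp add: interpreted_def w_def)
qed

lemma sc_N: "x \<in> D \<Longrightarrow> z \<in> D \<Longrightarrow> cl z = sc N (cl x) \<longleftrightarrow> R SuccS [x, z]"
proof -
  assume x: "x \<in> D" and z: "z \<in> D"
  let ?P = "\<lambda>z. z \<in> D \<and> (\<exists>x\<in>cl x. R SuccS [x, z])"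
  have "\<exists>z. z \<in> D \<and> R SuccS [x, z]" using x tots by blast
  then have "\<exists>z. ?P z" using E_refl[OF x] x mem_cl by blast
  then have P: "?P (SOME z. ?P z)" by (rule someI_ex)
  define w where "w = (SOME z. ?P z)"
  from P obtain x' where w: "w \<in> D" "x' \<in> D" "E x x'" "R SuccS [x', w]" by (auto simp: w_def mem_cl)
  have w': "R SuccS [x, w]" 
    by (rule cong2[OF _ w(2) x w(1,1) E_sym[OF x w(2,3)] E_refl[OF w(1)] w(4)]) simp
  have "cl z = cl w \<longleftrightarrow> R SuccS [x, z]"
    unfolding cl_eq_iff[OF z w(1)]
  proof
    assume "E z w"
    then show "R SuccS [x, z]"
      by (intro cong2[OF _ x x w(1) z E_refl[OF x] E_sym[OF z w(1)] w']) auto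
  next
    assume "R SuccS [x, z]"
    then show "E z w" by (rule func2[OF x z w(1) _ w'])
  qed
  then show ?thesis by (simp add: interpreted_def w_def)
qed

text \<open>Addition and multiplication share one argument: the chosen value belongs to possibly
  different representatives of the two classes, and congruence carries it back to \<open>x\<close>
  and \<open>y\<close>.\<close>

lemma op_N:
  assumes s: "s \<in> {AddS, MulS}" and x: "x \<in> D" and y: "y \<in> D" and z: "z \<in> D"
  shows "cl z = cl (SOME z. z \<in> D \<and> (\<exists>x'\<in>cl x. \<exists>y'\<in>cl y. R s [x', y', z])) \<longleftrightarrow> R s [x, y, z]"
proof -
  let ?P = "\<lambda>z. z \<in> D \<and> (\<exists>x'\<in>cl x. \<exists>y'\<in>cl y. R s [x', y', z])"
  have ar: "arity s = 3" using s by auto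
  have "\<exists>z. z \<in> D \<and> R s [x, y, z]" using x y tots s by blast
  then have "\<exists>z. ?P z" using E_refl[OF x] E_refl[OF y] x y mem_cl by blast
  then have P: "?P (SOME z. ?P z)" by (rule someI_ex)
  define w where "w = (SOME z. ?P z)"
  from P obtain x' y' where w: "w \<in> D" "x' \<in> D" "E x x'" "y' \<in> D" "E y y'" "R s [x', y', w]"
    by (auto simp: w_def mem_cl)
  have w': "R s [x, y, w]" 
    by (rule cong3[OF ar w(2) x w(4) y w(1,1) E_sym[OF x w(2,3)] E_sym[OF y w(4,5)] E_refl[OF w(1)] w(6)])
  have "cl z = cl w \<longleftrightarrow> R s [x, y, z]"
    unfolding cl_eq_iff[OF z w(1)]
  proof
    assume "E z w"
    then show "R s [x, y, z]"
      by (intro cong3[OF ar x x y y w(1) z E_refl[OF x] E_refl[OF y] E_sym[OF z w(1)] w'])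
  next
    assume "R s [x, y, z]"
    then show "E z w" by (rule func3[OF s x y z w(1) _ w'])
  qed
  then show ?thesis by (simp add: w_def)
qed

lemma ad_N: "x \<in> D \<Longrightarrow> y \<in> D \<Longrightarrow> z \<in> D \<Longrightarrow> cl z = ad N (cl x) (cl y) \<longleftrightarrow> R AddS [x, y, z]"
  using op_N[of AddS x y z] by (simp add: interpreted_def)

lemma mu_N: "x \<in> D \<Longrightarrow> y \<in> D \<Longrightarrow> z \<in> D \<Longrightarrow> cl z = mu N (cl x) (cl y) \<longleftrightarrow> R MulS [x, y, z]"
  using op_N[of MulS x y z] by (simp add: interpreted_def)

lemma ls_N:
  assumes "x \<in> D" "y \<in> D" shows "ls N (cl x) (cl y) \<longleftrightarrow> R LessS [x, y]"
proof -
  have "R LessS [x, y]" if "x' \<in> cl x" "y' \<in> cl y" "R LessS [x', y']" for x' y'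
    by (rule cong2[of LessS x' x y' y]) (use that assms in \<open>simp_all add: mem_cl E_sym\<close>)
  moreover have "x \<in> cl x" "y \<in> cl y" using assms by (simp_all add: mem_cl E_refl)
  ultimately show ?thesis unfolding interpreted_def struct.simps by blast
qed

lemma pd_N:
  assumes "x \<in> D" shows "pd N q (cl x) \<longleftrightarrow> R (PrS q) [x]"
proof -
  have "R (PrS q) [x]" if "x' \<in> cl x" "R (PrS q) [x']" for x'
    by (rule cong1[of "PrS q" x' x]) (use that assms in \<open>simp_all add: mem_cl E_sym\<close>)
  moreover have "x \<in> cl x" using assms by (simp add: mem_cl E_refl)
  ultimately show ?thesis unfolding interpreted_def struct.simps by blast
qed

lemma dom_N: "dom N = cl ` D"
  by (simp add: interpreted_def)

lemma closed_N:
  "zr N \<in> dom N" "c \<in> dom N \<Longrightarrow> sc N c \<in> dom N"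
  "c \<in> dom N \<Longrightarrow> d \<in> dom N \<Longrightarrow> ad N c d \<in> dom N" "c \<in> dom N \<Longrightarrow> d \<in> dom N \<Longrightarrow> mu N c d \<in> dom N"
proof -
  have some: "cl (SOME z. z \<in> D \<and> P z) \<in> cl ` D" if "\<exists>z\<in>D. P z" for P
    using someI_ex[of "\<lambda>z. z \<in> D \<and> P z"] that by blast
  show "zr N \<in> dom N" using some[OF tots(1)] by (simp add: interpreted_def)
  show "sc N c \<in> dom N" if "c \<in> dom N"
  proof -
    obtain x where x: "x \<in> D" "c = cl x" using \<open>c \<in> dom N\<close> by (auto simp: dom_N)
    obtain z where "z \<in> D" "R SuccS [x, z]" using tots x by blast
    then show ?thesis using sc_N[of x z] x by (auto simp: dom_N)
  qed
  show "ad N c d \<in> dom N" if "c \<in> dom N" "d \<in> dom N"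
  proof -
    obtain x y where x: "x \<in> D" "c = cl x" "y \<in> D" "d = cl y" using \<open>c \<in> dom N\<close> \<open>d \<in> dom N\<close> unfolding dom_N by blast
    obtain z where "z \<in> D" "R AddS [x, y, z]" using tots x by blast
    then show ?thesis using ad_N[of x y z] x by (auto simp: dom_N)
  qed
  show "mu N c d \<in> dom N" if "c \<in> dom N" "d \<in> dom N"
  proof -
    obtain x y where x: "x \<in> D" "c = cl x" "y \<in> D" "d = cl y" using \<open>c \<in> dom N\<close> \<open>d \<in> dom N\<close> unfolding dom_N by blast
    obtain z where "z \<in> D" "R MulS [x, y, z]" using tots x by blast
    then show ?thesis using mu_N[of x y z] x by (auto simp: dom_N)
  qed
qed

lemma tv_closed_N: "range e \<subseteq> dom N \<Longrightarrow> tv N e t \<in> dom N"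
  by (induction t) (auto simp: closed_N)

lemma tv_cl_N: "range e \<subseteq> D \<Longrightarrow> tv N (\<lambda>i. cl (e (i + k))) t \<in> dom N"
  "range e \<subseteq> D \<Longrightarrow> tv N (\<lambda>i. cl (e i)) t \<in> dom N"
  by (rule tv_closed_N; auto simp: dom_N)+

text \<open>The quantifiers over values of subterms run over representatives, and every value in
  \<open>N\<close> has one by \<open>tv_cl_N\<close>. The offset \<open>k\<close> must be general
  because these quantifiers shift the variables of \<open>t\<close>.\<close>

lemma sat_graph:
  assumes "range e \<subseteq> D"
  shows "sat A e (graph K k t y) \<longleftrightarrow> cl (e y) = tv N (\<lambda>i. cl (e (i + k))) t"
  using assms
proof (induction t arbitrary: e k y)
  case (V i)
  then have "e y \<in> D" "e (i + k) \<in> D" by auto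
  then show ?case using cl_eq_iff[of "e (i + k)" "e y"] by auto
next
  case Zero
  then have "e y \<in> D" by auto
  then show ?case by (simp add: zr_N)
next
  case (Succ s)
  have r: "range (x ## e) \<subseteq> D" if "x \<in> D" for x
    using that Succ.prems by (simp add: range_scons_subset)
  have y: "e y \<in> D" using Succ.prems by auto
  have "tv N (\<lambda>i. cl (e (i + k))) s \<in> dom N" using Succ.prems by (simp only: tv_cl_N)
  then obtain x0 where x0: "x0 \<in> D" "tv N (\<lambda>i. cl (e (i + k))) s = cl x0" by (auto simp: dom_N)
  have "sat A e (graph K k (Succ s) y) \<longleftrightarrow>
      (\<exists>x\<in>D. cl x = tv N (\<lambda>i. cl (e (i + k))) s \<and> R SuccS [x, e y])"
    by (simp add: Succ.IH[OF r] cong: bex_cong_simp)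
  also have "\<dots> \<longleftrightarrow> (\<exists>x\<in>D. cl x = tv N (\<lambda>i. cl (e (i + k))) s \<and> cl (e y) = sc N (cl x))"
    using y by (simp add: sc_N cong: bex_cong_simp)
  finally show ?case using x0 by auto
next
  case (Add s t)
  have r: "range (x ## y ## e) \<subseteq> D" if "x \<in> D" "y \<in> D" for x y
    using that Add.prems by (simp add: range_scons_subset)
  have y: "e y \<in> D" using Add.prems by auto
  have "tv N (\<lambda>i. cl (e (i + k))) s \<in> dom N" "tv N (\<lambda>i. cl (e (i + k))) t \<in> dom N"
    using Add.prems by (simp_all only: tv_cl_N)
  then obtain x0 y0 where x0: "x0 \<in> D" "tv N (\<lambda>i. cl (e (i + k))) s = cl x0"
    "y0 \<in> D" "tv N (\<lambda>i. cl (e (i + k))) t = cl y0" by (auto simp: dom_N)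
  have "sat A e (graph K k (Add s t) y) \<longleftrightarrow>
      (\<exists>a\<in>D. \<exists>b\<in>D. cl a = tv N (\<lambda>i. cl (e (i + k))) s \<and> cl b = tv N (\<lambda>i. cl (e (i + k))) t
        \<and> R AddS [a, b, e y])"
    by (simp add: Add.IH[OF r] cong: bex_cong_simp)
  also have "\<dots> \<longleftrightarrow> (\<exists>a\<in>D. \<exists>b\<in>D. cl a = tv N (\<lambda>i. cl (e (i + k))) s \<and> cl b = tv N (\<lambda>i. cl (e (i + k))) t
        \<and> cl (e y) = ad N (cl a) (cl b))"
    using y by (simp add: ad_N cong: bex_cong_simp)
  finally show ?case using x0 by auto
next
  case (Mul s t)
  have r: "range (x ## y ## e) \<subseteq> D" if "x \<in> D" "y \<in> D" for x y
    using that Mul.prems by (simp add: range_scons_subset)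
  have y: "e y \<in> D" using Mul.prems by auto
  have "tv N (\<lambda>i. cl (e (i + k))) s \<in> dom N" "tv N (\<lambda>i. cl (e (i + k))) t \<in> dom N"
    using Mul.prems by (simp_all only: tv_cl_N)
  then obtain x0 y0 where x0: "x0 \<in> D" "tv N (\<lambda>i. cl (e (i + k))) s = cl x0"
    "y0 \<in> D" "tv N (\<lambda>i. cl (e (i + k))) t = cl y0" by (auto simp: dom_N)
  have "sat A e (graph K k (Mul s t) y) \<longleftrightarrow>
      (\<exists>a\<in>D. \<exists>b\<in>D. cl a = tv N (\<lambda>i. cl (e (i + k))) s \<and> cl b = tv N (\<lambda>i. cl (e (i + k))) t
        \<and> R MulS [a, b, e y])"
    by (simp add: Mul.IH[OF r] cong: bex_cong_simp)
  also have "\<dots> \<longleftrightarrow> (\<exists>a\<in>D. \<exists>b\<in>D. cl a = tv N (\<lambda>i. cl (e (i + k))) s \<and> cl b = tv N (\<lambda>i. cl (e (i + k))) t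
        \<and> cl (e y) = mu N (cl a) (cl b))"
    using y by (simp add: mu_N cong: bex_cong_simp)
  finally show ?case using x0 by auto
qed

lemma cl_scons: "(\<lambda>i. cl ((x ## e) i)) = cl x ## (\<lambda>i. cl (e i))"
  by (rule ext) (simp add: scons_def split: nat.split)

text \<open>Relativized quantifiers run over \<open>D\<close>, those of \<open>N\<close> over the
  classes of elements of \<open>D\<close>. By \<open>sat_graph\<close>, \<open>ls_N\<close> and
  \<open>pd_N\<close>, atomic formulae depend on the classes only.\<close>

lemma sat_translate:
  assumes "range e \<subseteq> D"
  shows "sat A e (translate K a) \<longleftrightarrow> sat N (\<lambda>i. cl (e i)) a"
  using assms
proof (induction a arbitrary: e)
  case (Eq s t)
  have r: "range (x ## y ## e) \<subseteq> D" if "x \<in> D" "y \<in> D" for x y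
    using that Eq.prems by (simp add: range_scons_subset)
  have "tv N (\<lambda>i. cl (e i)) s \<in> dom N" "tv N (\<lambda>i. cl (e i)) t \<in> dom N"
    using Eq.prems by (simp_all only: tv_cl_N)
  then obtain x0 y0 where x0: "x0 \<in> D" "tv N (\<lambda>i. cl (e i)) s = cl x0"
    "y0 \<in> D" "tv N (\<lambda>i. cl (e i)) t = cl y0" by (auto simp: dom_N)
  have "sat A e (translate K (Eq s t)) \<longleftrightarrow> (\<exists>a\<in>D. \<exists>b\<in>D. cl a = tv N (\<lambda>i. cl (e i)) s \<and>
      cl b = tv N (\<lambda>i. cl (e i)) t \<and> cl a = cl b)"
    by (simp add: sat_graph[OF r] cl_eq_iff cong: bex_cong_simp)
  then show ?case using x0 by auto
next
  case (Less s t)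
  have r: "range (x ## y ## e) \<subseteq> D" if "x \<in> D" "y \<in> D" for x y
    using that Less.prems by (simp add: range_scons_subset)
  have "tv N (\<lambda>i. cl (e i)) s \<in> dom N" "tv N (\<lambda>i. cl (e i)) t \<in> dom N"
    using Less.prems by (simp_all only: tv_cl_N)
  then obtain x0 y0 where x0: "x0 \<in> D" "tv N (\<lambda>i. cl (e i)) s = cl x0"
    "y0 \<in> D" "tv N (\<lambda>i. cl (e i)) t = cl y0" by (auto simp: dom_N)
  have "sat A e (translate K (Less s t)) \<longleftrightarrow> (\<exists>a\<in>D. \<exists>b\<in>D. cl a = tv N (\<lambda>i. cl (e i)) s \<and>
      cl b = tv N (\<lambda>i. cl (e i)) t \<and> ls N (cl a) (cl b))"
    by (simp add: sat_graph[OF r] ls_N cong: bex_cong_simp)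
  then show ?case using x0 by auto
next
  case (Pr q t)
  have r: "range (x ## e) \<subseteq> D" if "x \<in> D" for x
    using that Pr.prems by (simp add: range_scons_subset)
  have "tv N (\<lambda>i. cl (e i)) t \<in> dom N"
    using Pr.prems by (simp_all only: tv_cl_N)
  then obtain y0 where x0: "y0 \<in> D" "tv N (\<lambda>i. cl (e i)) t = cl y0" by (auto simp: dom_N)
  have "sat A e (translate K (Pr q t)) \<longleftrightarrow> (\<exists>b\<in>D. cl b = tv N (\<lambda>i. cl (e i)) t \<and> pd N q (cl b))"
    by (simp add: sat_graph[OF r] pd_N cong: bex_cong_simp)
  then show ?case using x0 by auto
next
  case (Exi a)
  have r: "range (x ## e) \<subseteq> D" if "x \<in> D" for x
    using that Exi.prems by (simp add: range_scons_subset)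
  show ?case by (simp add: Exi.IH[OF r] cl_scons dom_N cong: bex_cong_simp)
qed auto

lemma models_translate:
  assumes "A \<Turnstile> translate K a"
  shows "N \<Turnstile> a"
  unfolding models_def
proof (intro allI impI)
  fix e :: "nat \<Rightarrow> 'a set"
  assume "range e \<subseteq> dom N"
  then have "\<forall>i. \<exists>x\<in>D. e i = cl x" by (auto simp: dom_N)
  then obtain g where g: "\<And>i. g i \<in> D" "\<And>i. e i = cl (g i)" by metis
  then have "e = (\<lambda>i. cl (g i))" by auto
  moreover have "sat A g (translate K a)" using assms by (auto simp: models_A)
  ultimately show "sat N e a" using sat_translate[of g a] g by auto
qed

end

section \<open>Standardness of models with a definable well-founded relation\<close>

lemma models_All [simp]:
  fixes M :: "('a, 'p) struct"
  shows "M \<Turnstile> All a \<longleftrightarrow> M \<Turnstile> a"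
proof
  assume *: "M \<Turnstile> All a"
  show "M \<Turnstile> a"
    unfolding models_def
  proof (intro allI impI)
    fix e :: "nat \<Rightarrow> 'a"
    assume e: "range e \<subseteq> dom M"
    have "e 0 ## (\<lambda>i. e (Suc i)) = e" by (rule ext) (simp add: scons_def split: nat.split)
    moreover have "range (\<lambda>i. e (Suc i)) \<subseteq> dom M" using e by auto
    then have "sat M (\<lambda>i. e (Suc i)) (All a)" using * unfolding models_def by blast
    moreover have "e 0 \<in> dom M" using e by auto
    ultimately show "sat M e a" by (metis sat_defs(4))
  qed
next
  assume *: "M \<Turnstile> a"
  show "M \<Turnstile> All a"
    unfolding models_def sat_defs
  proof (intro allI impI ballI)
    fix e :: "nat \<Rightarrow> 'a" and x
    assume "range e \<subseteq> dom M" "x \<in> dom M"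
    then have "range (x ## e) \<subseteq> dom M" unfolding range_scons_subset by blast
    then show "sat M (x ## e) a" using * unfolding models_def by blast
  qed
qed

lemma models_Alls [simp]: "M \<Turnstile> Alls n a \<longleftrightarrow> M \<Turnstile> a"
  by (induction n) auto

lemma sat_induction_for:
  assumes "M \<Turnstile> induction_for a" and dom: "dom M = UNIV"
    and "sat M (zr M ## e) a" "\<And>x. sat M (x ## e) a \<Longrightarrow> sat M (sc M x ## e) a"
  shows "sat M (x ## e) a"
proof -
  have "(\<lambda>i. tv M (x ## e) (case i of 0 \<Rightarrow> Succ (V 0) | Suc j \<Rightarrow> V (Suc j))) = sc M x ## e" for x
    by (rule ext) (simp split: nat.split)
  then have "sat M e (induction_for a) \<longleftrightarrow> (sat M (zr M ## e) a \<longrightarrow>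
    (\<forall>x. sat M (x ## e) a \<longrightarrow> sat M (sc M x ## e) a) \<longrightarrow> (\<forall>x. sat M (x ## e) a))"
    by (simp add: induction_for_def sat_sub0 sat_subf dom)
  moreover have "sat M e (induction_for a)" using assms(1) by (simp add: models_def dom)
  ultimately show ?thesis using assms by blast
qed

lemma trm_below_subt: "trm_below m t \<Longrightarrow> (\<And>i. i < m \<Longrightarrow> trm_below n (s i)) \<Longrightarrow> trm_below n (subt s t)"
  by (induction t) auto

lemma trm_below_lift [simp]: "trm_below (Suc n) (lift t) \<longleftrightarrow> trm_below n t"
  by (induction t) (auto simp: lift_def)

lemma fm_below_subf: "fm_below m a \<Longrightarrow> (\<And>i. i < m \<Longrightarrow> trm_below n (s i)) \<Longrightarrow> fm_below n (subf s a)"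
proof (induction a arbitrary: m n s)
  case (Exi a)
  have "fm_below (Suc n) (subf (under s) a)"
  proof (rule Exi.IH)
    show "fm_below (Suc m) a" using Exi.prems by simp
    show "trm_below (Suc n) (under s i)" if "i < Suc m" for i
      using that Exi.prems(2) by (cases i) (auto simp: under_def)
  qed
  then show ?case by simp
next
  case (Disj a b)
  have "fm_below n (subf s a)" "fm_below n (subf s b)"
    by (rule Disj.IH[of m], use Disj.prems in auto)+
  then show ?case by simp
next
  case (Neg a)
  have "fm_below n (subf s a)" by (rule Neg.IH[of m], use Neg.prems in auto)
  then show ?case by simp
qed (auto intro: trm_below_subt)

lemma fm_below_inst:
  "fm_below m a \<Longrightarrow> m = length ts \<Longrightarrow> \<forall>t\<in>set ts. trm_below n t \<Longrightarrow> fm_below n (a \<bullet> ts)"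
  unfolding inst_def by (rule fm_below_subf) auto

text \<open>
  Finite sets are coded by divisors rather than by remainders: adding an element then only
  multiplies the code by a modulus, and no Chinese remainder theorem is needed in the model.
\<close>

definition setmemF :: "trm \<Rightarrow> trm \<Rightarrow> trm \<Rightarrow> trm \<Rightarrow> 'p fm" where
  "setmemF p c d b = Conj (Less p b)
     (Exi (Eq (lift c) (Mul (Succ (Mul (Succ (lift p)) (lift d))) (V 0))))"

definition setmem :: "('a, 'p) struct \<Rightarrow> 'a \<Rightarrow> 'a \<Rightarrow> 'a \<Rightarrow> 'a \<Rightarrow> bool" where
  "setmem M p c d b \<longleftrightarrow> ls M p b \<and> (\<exists>q\<in>dom M. c = mu M (sc M (mu M (sc M p) d)) q)"

lemma sat_setmemF [simp]:
  "sat M e (setmemF p c d b) \<longleftrightarrow> setmem M (tv M e p) (tv M e c) (tv M e d) (tv M e b)"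
  by (simp add: setmemF_def setmem_def)

lemma fm_below_setmemF [simp]:
  "fm_below n (setmemF p c d b) \<longleftrightarrow> trm_below n p \<and> trm_below n c \<and> trm_below n d \<and> trm_below n b"
  by (auto simp: setmemF_def Conj_def)

lemma fm_below_defs [simp]:
  "fm_below n (Conj a b) \<longleftrightarrow> fm_below n a \<and> fm_below n b"
  "fm_below n (Imp a b) \<longleftrightarrow> fm_below n a \<and> fm_below n b"
  "fm_below n (Iff a b) \<longleftrightarrow> fm_below n a \<and> fm_below n b"
  "fm_below n (All a) \<longleftrightarrow> fm_below (Suc n) a"
  by (auto simp: Conj_def Imp_def Iff_def All_def)

text \<open>Induction formula of \<open>comprehension\<close>. Outside its quantifiers the variables
  0 to 6 are the induction variable \<open>y\<close>, the bound \<open>x\<close>, the new parameter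
  \<open>S d\<close>, the old code \<open>c0\<close>, \<open>d0\<close>, \<open>b0\<close> and the
  new element \<open>p\<close>.\<close>

abbreviation "insertF \<equiv> Exi (All (Imp (Less (V 0) (V 3))
   (Iff (Exi (Eq (V 2) (Mul (Succ (Mul (Succ (V 1)) (V 5))) (V 0))))
     (Conj (Less (V 0) (V 2)) (Disj (setmemF (V 0) (V 5) (V 6) (V 7)) (Eq (V 0) (V 8)))))))"

abbreviation "multipleF \<equiv> Exi (All (Imp (Less (V 0) (V 2)) (Exi (Eq (Succ (V 2)) (Mul (Succ (V 1)) (V 0))))))"

text \<open>All the induction that arithmetic and the coding of sets will use. The list is finite so
  that the translated instances fit into the finite set of sentences to be made true.\<close>

definition arith_inductions :: "'p fm set" where
  "arith_inductions = {
     Eq (Add Zero (V 0)) (V 0),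
     Eq (Add (Succ (V 1)) (V 0)) (Succ (Add (V 1) (V 0))),
     Eq (Add (V 1) (V 0)) (Add (V 0) (V 1)),
     Eq (Add (Add (V 2) (V 1)) (V 0)) (Add (V 2) (Add (V 1) (V 0))),
     Eq (Mul Zero (V 0)) Zero,
     Eq (Mul (Succ (V 1)) (V 0)) (Add (Mul (V 1) (V 0)) (V 0)),
     Eq (Mul (V 1) (V 0)) (Mul (V 0) (V 1)),
     Eq (Mul (Add (V 2) (V 1)) (V 0)) (Add (Mul (V 2) (V 0)) (Mul (V 1) (V 0))),
     Eq (Mul (Mul (V 2) (V 1)) (V 0)) (Mul (V 2) (Mul (V 1) (V 0))),
     Imp (Eq (Add (V 2) (V 0)) (Add (V 1) (V 0))) (Eq (V 2) (V 1)),
     Disj (Eq (V 0) Zero) (Exi (Eq (V 1) (Succ (V 0)))),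
     Iff (Less (V 1) (V 0)) (Exi (Eq (V 1) (Add (V 2) (Succ (V 0))))),
     Exi (Disj (Eq (V 1) (Add (V 2) (V 0))) (Eq (V 2) (Add (V 1) (V 0)))),
     multipleF, insertF}"

section \<open>Arithmetic from finitely many instances of induction\<close>

locale pa_model =
  fixes M :: "('a, 'p) struct"
  assumes dom_UNIV: "dom M = UNIV"
    and basic: "\<And>a. a \<in> basic_axioms \<Longrightarrow> M \<Turnstile> a"
    and arith_ind: "\<And>a. a \<in> arith_inductions \<Longrightarrow> M \<Turnstile> induction_for a"
begin

abbreviation zero ("\<zero>") where "\<zero> \<equiv> zr M"
abbreviation S where "S \<equiv> sc M"
abbreviation add (infixl "\<oplus>" 65) where "x \<oplus> y \<equiv> ad M x y"
abbreviation mul (infixl "\<otimes>" 70) where "x \<otimes> y \<equiv> mu M x y"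
abbreviation less (infix "\<sqsubset>" 50) where "x \<sqsubset> y \<equiv> ls M x y"

lemma models_UNIV: "M \<Turnstile> a \<longleftrightarrow> (\<forall>e. sat M e a)"
  by (simp add: models_def dom_UNIV)

lemma S_neq_zero [simp]: "S x \<noteq> \<zero>" "\<zero> \<noteq> S x"
  and S_inj [simp]: "S x = S y \<longleftrightarrow> x = y"
  and add_zero [simp]: "x \<oplus> \<zero> = x"
  and add_S [simp]: "x \<oplus> S y = S (x \<oplus> y)"
  and mul_zero [simp]: "x \<otimes> \<zero> = \<zero>"
  and mul_S [simp]: "x \<otimes> S y = x \<otimes> y \<oplus> x"
  and not_less_zero [simp]: "\<not> x \<sqsubset> \<zero>"
  and less_S: "x \<sqsubset> S y \<longleftrightarrow> x \<sqsubset> y \<or> x = y"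
proof -
  have *: "\<forall>a\<in>basic_axioms. sat M (\<lambda>_. \<zero>) a" using basic by (auto simp: models_UNIV)
  show "S x \<noteq> \<zero>" "\<zero> \<noteq> S x" "S x = S y \<longleftrightarrow> x = y" "x \<oplus> \<zero> = x" "x \<oplus> S y = S (x \<oplus> y)"
    "x \<otimes> \<zero> = \<zero>" "x \<otimes> S y = x \<otimes> y \<oplus> x" "\<not> x \<sqsubset> \<zero>" "x \<sqsubset> S y \<longleftrightarrow> x \<sqsubset> y \<or> x = y"
    using * by (auto simp: basic_axioms_def dom_UNIV)
qed

lemmas ind = sat_induction_for[OF arith_ind dom_UNIV]

lemma zero_add [simp]: "\<zero> \<oplus> x = x"
  using ind[of "Eq (Add Zero (V 0)) (V 0)" "\<lambda>_. \<zero>" x] by (simp add: arith_inductions_def)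

lemma S_add [simp]: "S y \<oplus> x = S (y \<oplus> x)"
  using ind[of "Eq (Add (Succ (V 1)) (V 0)) (Succ (Add (V 1) (V 0)))" "\<lambda>_. y" x]
  by (simp add: arith_inductions_def)

lemma add_comm: "y \<oplus> x = x \<oplus> y"
  using ind[of "Eq (Add (V 1) (V 0)) (Add (V 0) (V 1))" "\<lambda>_. y" x]
  by (simp add: arith_inductions_def)

lemma add_assoc: "z \<oplus> y \<oplus> x = z \<oplus> (y \<oplus> x)"
  using ind[of "Eq (Add (Add (V 2) (V 1)) (V 0)) (Add (V 2) (Add (V 1) (V 0)))" "y ## (\<lambda>_. z)" x]
  by (simp add: arith_inductions_def)

lemma add_left_comm: "z \<oplus> (y \<oplus> x) = y \<oplus> (z \<oplus> x)"
  by (metis add_comm add_assoc)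

lemmas add_ac = add_comm add_assoc add_left_comm

lemma zero_mul [simp]: "\<zero> \<otimes> x = \<zero>"
  using ind[of "Eq (Mul Zero (V 0)) Zero" "\<lambda>_. \<zero>" x] by (simp add: arith_inductions_def)

lemma S_mul [simp]: "S y \<otimes> x = y \<otimes> x \<oplus> x"
  using ind[of "Eq (Mul (Succ (V 1)) (V 0)) (Add (Mul (V 1) (V 0)) (V 0))" "\<lambda>_. y" x]
  by (simp add: arith_inductions_def add_ac)

lemma mul_comm: "y \<otimes> x = x \<otimes> y"
  using ind[of "Eq (Mul (V 1) (V 0)) (Mul (V 0) (V 1))" "\<lambda>_. y" x]
  by (simp add: arith_inductions_def)

lemma add_mul: "(z \<oplus> y) \<otimes> x = z \<otimes> x \<oplus> y \<otimes> x"
  using ind[of "Eq (Mul (Add (V 2) (V 1)) (V 0)) (Add (Mul (V 2) (V 0)) (Mul (V 1) (V 0)))"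
      "y ## (\<lambda>_. z)" x]
  by (simp add: arith_inductions_def add_ac)

lemma mul_add: "x \<otimes> (z \<oplus> y) = x \<otimes> z \<oplus> x \<otimes> y"
  using add_mul[of z y x] by (simp add: mul_comm)

lemma mul_assoc: "z \<otimes> y \<otimes> x = z \<otimes> (y \<otimes> x)"
  using ind[of "Eq (Mul (Mul (V 2) (V 1)) (V 0)) (Mul (V 2) (Mul (V 1) (V 0)))" "y ## (\<lambda>_. z)" x]
  by (simp add: arith_inductions_def mul_add)

lemma mul_left_comm: "z \<otimes> (y \<otimes> x) = y \<otimes> (z \<otimes> x)"
  by (metis mul_comm mul_assoc)

lemmas semiring = add_ac mul_comm mul_assoc mul_left_comm add_mul mul_add

lemma add_cancel_right [simp]: "z \<oplus> x = y \<oplus> x \<longleftrightarrow> z = y"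
  using ind[of "Imp (Eq (Add (V 2) (V 0)) (Add (V 1) (V 0))) (Eq (V 2) (V 1))" "y ## (\<lambda>_. z)" x]
  by (auto simp: arith_inductions_def)

lemma add_cancel_left [simp]: "x \<oplus> z = x \<oplus> y \<longleftrightarrow> z = y"
  by (metis add_comm add_cancel_right)

lemma zero_or_S: "x = \<zero> \<or> (\<exists>y. x = S y)"
  using ind[of "Disj (Eq (V 0) Zero) (Exi (Eq (V 1) (Succ (V 0))))" "\<lambda>_. \<zero>" x]
  by (simp add: arith_inductions_def dom_UNIV)

lemma less_iff: "x \<sqsubset> y \<longleftrightarrow> (\<exists>z. y = x \<oplus> S z)"
proof -
  have "(x \<sqsubset> v \<longleftrightarrow> (\<exists>z. v = S (x \<oplus> z))) \<Longrightarrow> (x \<sqsubset> S v \<longleftrightarrow> (\<exists>z. v = x \<oplus> z))" for v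
    unfolding less_S by (metis add_S add_zero zero_or_S)
  then show ?thesis
    using ind[of "Iff (Less (V 1) (V 0)) (Exi (Eq (V 1) (Add (V 2) (Succ (V 0)))))" "\<lambda>_. x" y]
    by (simp add: arith_inductions_def dom_UNIV)
qed

lemma linear: "\<exists>z. y = x \<oplus> z \<or> x = y \<oplus> z"
proof -
  have "\<exists>z. v = x \<oplus> z \<or> x = v \<oplus> z \<Longrightarrow> \<exists>z. S v = x \<oplus> z \<or> x = S (v \<oplus> z)" for v
    by (metis add_S add_zero zero_or_S)
  then show ?thesis
    using ind[of "Exi (Disj (Eq (V 1) (Add (V 2) (V 0))) (Eq (V 2) (Add (V 1) (V 0))))" "\<lambda>_. x" y]
    by (auto simp: arith_inductions_def dom_UNIV)
qed

lemma trichotomy: "x \<sqsubset> y \<or> x = y \<or> y \<sqsubset> x"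
  unfolding less_iff using linear[of y x] by (metis add_zero zero_or_S)

lemma less_irrefl [simp]: "\<not> x \<sqsubset> x"
  unfolding less_iff by (metis S_neq_zero(2) add_S add_cancel_left add_zero)

section \<open>Divisibility and codes of finite sets inside the model\<close>

definition dv (infix "\<lhd>" 50) where "a \<lhd> b \<longleftrightarrow> (\<exists>q. b = a \<otimes> q)"

lemma dv_mul: "a \<lhd> b \<Longrightarrow> a \<lhd> c \<otimes> b" "a \<lhd> b \<Longrightarrow> a \<lhd> b \<otimes> c"
  unfolding dv_def by (metis mul_left_comm mul_comm)+

lemma dv_refl [simp]: "a \<lhd> a"
  unfolding dv_def by (metis mul_S mul_zero zero_add)

lemma add_eq_zero: "x \<oplus> y = \<zero> \<longleftrightarrow> x = \<zero> \<and> y = \<zero>"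
  by (metis S_neq_zero(1) add_S add_zero zero_or_S)

lemma S_mul_eq_zero: "S x \<otimes> y = \<zero> \<longleftrightarrow> y = \<zero>"
  by (auto simp: add_eq_zero)

text \<open>In the absence of subtraction the two quotients are compared by \<open>linear\<close>.
  If the quotient of \<open>u\<close> is at least that of \<open>u \<oplus> v\<close>, cancellation
  leaves \<open>v = \<zero>\<close>.\<close>

lemma dv_add_cancel:
  assumes "S a \<lhd> u \<oplus> v" "S a \<lhd> u" shows "S a \<lhd> v"
proof -
  obtain p q where pq: "u \<oplus> v = S a \<otimes> p" "u = S a \<otimes> q" using assms by (auto simp: dv_def)
  obtain z where z: "p = q \<oplus> z \<or> q = p \<oplus> z" using linear by metis
  then show ?thesis
  proof
    assume "p = q \<oplus> z"
    then have "u \<oplus> v = u \<oplus> S a \<otimes> z" using pq by (simp only: mul_add)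
    then have "v = S a \<otimes> z" by simp
    then show ?thesis by (auto simp only: dv_def)
  next
    assume "q = p \<oplus> z"
    then have "u = u \<oplus> (v \<oplus> S a \<otimes> z)" using pq by (metis mul_add add_assoc)
    then have "v \<oplus> S a \<otimes> z = \<zero>" by (metis add_zero add_cancel_left)
    then have "v = \<zero>" by (simp only: add_eq_zero)
    then show ?thesis unfolding dv_def by (metis mul_zero)
  qed
qed

text \<open>Write a and b for the moduli at \<open>i\<close> and \<open>y\<close>. Then (y+1)a and
  (i+1)b differ by exactly k+1, so a divides (k+1)c and, as k+1 divides d, also dc. Since ac =
  (i+1)dc + c, it divides c.\<close>

lemma modulus_coprime:
  assumes k: "y = i \<oplus> S k \<or> i = y \<oplus> S k" and kd: "S k \<lhd> d"
    and dv: "S (S i \<otimes> d) \<lhd> c \<otimes> S (S y \<otimes> d)"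
  shows "S (S i \<otimes> d) \<lhd> c"
proof -
  let ?a = "S (S i \<otimes> d)" and ?b = "S (S y \<otimes> d)"
  have "?a \<lhd> S k \<otimes> c"
    using k
  proof
    assume y: "y = i \<oplus> S k"
    have "S y \<otimes> ?a = S i \<otimes> ?b \<oplus> S k" unfolding y by (simp add: semiring)
    then have "S y \<otimes> ?a \<otimes> c = S i \<otimes> (c \<otimes> ?b) \<oplus> S k \<otimes> c" by (simp only: semiring)
    moreover have "?a \<lhd> S y \<otimes> ?a \<otimes> c" by (intro dv_mul dv_refl)
    ultimately have "?a \<lhd> S i \<otimes> (c \<otimes> ?b) \<oplus> S k \<otimes> c" by simp
    then show ?thesis by (rule dv_add_cancel) (intro dv_mul dv)
  next
    assume i: "i = y \<oplus> S k"
    have "S i \<otimes> ?b = S y \<otimes> ?a \<oplus> S k" unfolding i by (simp add: semiring)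
    then have "S i \<otimes> (c \<otimes> ?b) = S y \<otimes> ?a \<otimes> c \<oplus> S k \<otimes> c" by (metis mul_left_comm mul_comm add_mul)
    moreover have "?a \<lhd> S i \<otimes> (c \<otimes> ?b)" by (intro dv_mul dv)
    ultimately have "?a \<lhd> S y \<otimes> ?a \<otimes> c \<oplus> S k \<otimes> c" by simp
    then show ?thesis by (rule dv_add_cancel) (intro dv_mul dv_refl)
  qed
  moreover obtain d' where "d = S k \<otimes> d'" using kd by (auto simp: dv_def)
  ultimately have "?a \<lhd> d \<otimes> c" using dv_mul(1)[of ?a "S k \<otimes> c" d'] by (simp only: mul_left_comm mul_comm mul_assoc)
  then have "?a \<lhd> S i \<otimes> d \<otimes> c" unfolding mul_assoc by (rule dv_mul)
  moreover have "?a \<lhd> S i \<otimes> d \<otimes> c \<oplus> c" using dv_mul(2)[OF dv_refl, of ?a c] by (simp only: S_mul)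
  ultimately show ?thesis by (metis dv_add_cancel)
qed

text \<open>The internal counterpart of a factorial: the induction step multiplies by
  \<open>S x\<close>. The multiple is a successor because zero, a multiple of everything, would be
  useless as a parameter of the moduli.\<close>

lemma common_multiple: "\<exists>d. \<forall>i. i \<sqsubset> x \<longrightarrow> S i \<lhd> S d"
proof -
  have step: "\<exists>d'. \<forall>i. i \<sqsubset> S x \<longrightarrow> S i \<lhd> S d'" if d: "\<forall>i. i \<sqsubset> x \<longrightarrow> S i \<lhd> S d" for x d
  proof -
    have "S d \<otimes> S x = S (d \<otimes> S x \<oplus> x)" by (simp add: semiring)
    moreover have "S i \<lhd> S d \<otimes> S x" if "i \<sqsubset> S x" for i
      using that d unfolding less_S by (auto intro: dv_mul simp del: S_mul mul_S)
    ultimately show ?thesis by metis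
  qed
  have "sat M (x ## (\<lambda>_. \<zero>)) multipleF"
  proof (rule ind)
    fix x assume "sat M (x ## (\<lambda>_. \<zero>)) multipleF"
    then show "sat M (S x ## (\<lambda>_. \<zero>)) multipleF"
      using step[of x] by (simp only: sat.simps sat_defs tv.simps scons_simps dom_UNIV UNIV_I bex_UNIV ball_UNIV dv_def pred_numeral_simps BitM.simps One_nat_def numeral_2_eq_2) blast
  qed (simp_all add: arith_inductions_def dom_UNIV)
  then show ?thesis by (simp add: dom_UNIV dv_def)
qed

lemma setmem_iff: "setmem M p c d b \<longleftrightarrow> p \<sqsubset> b \<and> S (S p \<otimes> d) \<lhd> c"
  by (simp add: setmem_def dv_def dom_UNIV del: S_mul)

text \<open>Induction on \<open>y\<close>: if \<open>y\<close> qualifies, the code is multiplied by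
  its modulus. At other indices below \<open>x\<close> divisibility does not change, since two such
  indices differ by at most \<open>x\<close>, so their difference divides \<open>S d\<close> and
  \<open>modulus_coprime\<close> applies.\<close>

lemma comprehension:
  assumes "\<forall>i. i \<sqsubset> x \<longrightarrow> S i \<lhd> S d"
  shows "\<exists>c. \<forall>i. i \<sqsubset> x \<longrightarrow> (S (S i \<otimes> S d) \<lhd> c \<longleftrightarrow> i \<sqsubset> y \<and> (setmem M i c0 d0 b0 \<or> i = p))"
proof -
  let ?e = "x ## S d ## c0 ## d0 ## b0 ## (\<lambda>_. p)"
  define Q where "Q i \<longleftrightarrow> setmem M i c0 d0 b0 \<or> i = p" for i
  have sat: "sat M (y ## ?e) insertF \<longleftrightarrow>
    (\<exists>c. \<forall>i. i \<sqsubset> x \<longrightarrow> (S (S i \<otimes> S d) \<lhd> c \<longleftrightarrow> i \<sqsubset> y \<and> Q i))" for y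
    by (simp add: dom_UNIV dv_def Q_def del: S_mul mul_S)
  have "sat M (y ## ?e) insertF"
  proof (rule ind)
    show "sat M (\<zero> ## ?e) insertF"
    proof -
      \<comment> \<open>The initial code is one. No modulus divides it, because a modulus exceeds
        one: this is where the parameter has to be nonzero.\<close>
      have "\<not> S (S i \<otimes> S d) \<lhd> S \<zero>" for i
      proof
        assume "S (S i \<otimes> S d) \<lhd> S \<zero>"
        then obtain q where q: "S \<zero> = S (S i \<otimes> S d) \<otimes> q" by (auto simp: dv_def)
        then obtain q' where "q = S q'" using zero_or_S[of q] by auto
        with q have "\<zero> = S i \<otimes> S d \<oplus> S (S i \<otimes> S d) \<otimes> q'" by (simp add: add_ac)
        then show False by (metis add_eq_zero S_mul_eq_zero S_neq_zero(1))
      qed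
      then show ?thesis unfolding sat by (intro exI[of _ "S \<zero>"]) simp
    qed
  next
    fix y assume "sat M (y ## ?e) insertF"
    then obtain c where c: "\<forall>i. i \<sqsubset> x \<longrightarrow> (S (S i \<otimes> S d) \<lhd> c \<longleftrightarrow> i \<sqsubset> y \<and> Q i)"
      unfolding sat by blast
    show "sat M (S y ## ?e) insertF"
    proof (cases "y \<sqsubset> x \<and> Q y")
      case False
      then show ?thesis using c unfolding sat by (metis less_S)
    next
      case True
      let ?c = "c \<otimes> S (S y \<otimes> S d)"
      have "S (S i \<otimes> S d) \<lhd> ?c \<longleftrightarrow> i \<sqsubset> S y \<and> Q i" if i: "i \<sqsubset> x" for i
      proof (cases "i = y")
        case True
        then show ?thesis using \<open>y \<sqsubset> x \<and> Q y\<close> dv_mul(1)[OF dv_refl] by (auto simp: less_S simp del: S_mul mul_S)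
      next
        case False
        have "S (S i \<otimes> S d) \<lhd> ?c \<longleftrightarrow> S (S i \<otimes> S d) \<lhd> c"
        proof
          assume dv: "S (S i \<otimes> S d) \<lhd> ?c"
          obtain k where k: "y = i \<oplus> S k \<or> i = y \<oplus> S k"
            using trichotomy[of i y] False by (auto simp: less_iff)
          then have "k \<sqsubset> x"
            using i True unfolding less_iff by (metis add_S add_assoc add_comm)
          then show "S (S i \<otimes> S d) \<lhd> c" using modulus_coprime[OF k _ dv] assms by blast
        qed (rule dv_mul)
        then show ?thesis using c i False by (auto simp: less_S)
      qed
      then show ?thesis unfolding sat by blast
    qed
  qed (simp add: arith_inductions_def)
  then show ?thesis unfolding sat Q_def .
qed

text \<open>The parameter of the old code need not suit the enlarged range of indices, so the set is
  coded afresh with a new parameter; the old code only enters the condition that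
  \<open>comprehension\<close> handles.\<close>

lemma insert_code: "\<exists>c d b. \<forall>i. setmem M i c d b \<longleftrightarrow> setmem M i c0 d0 b0 \<or> i = p"
proof -
  \<comment> \<open>Exceeds \<open>p\<close> and, as members lie below \<open>b0\<close>, every old
    member.\<close>
  let ?b = "S (b0 \<oplus> p)"
  obtain d where d: "\<forall>i. i \<sqsubset> ?b \<longrightarrow> S i \<lhd> S d" using common_multiple by blast
  obtain c where c: "\<forall>i. i \<sqsubset> ?b \<longrightarrow> (S (S i \<otimes> S d) \<lhd> c \<longleftrightarrow> i \<sqsubset> ?b \<and> (setmem M i c0 d0 b0 \<or> i = p))"
    using comprehension[OF d] by blast
  have "i \<sqsubset> ?b" if "setmem M i c0 d0 b0 \<or> i = p" for i
    using that unfolding setmem_iff less_iff by (metis add_S add_assoc add_comm)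
  then have "setmem M i c (S d) ?b \<longleftrightarrow> setmem M i c0 d0 b0 \<or> i = p" for i
    using c setmem_iff by blast
  then show ?thesis by blast
qed

definition pair where "pair x y = (x \<oplus> y) \<otimes> (x \<oplus> y) \<oplus> x"

lemma pair_inj: "pair x y = pair x' y' \<longleftrightarrow> x = x' \<and> y = y'"
proof -
  have le: "x \<oplus> y = x' \<oplus> y'" if eq: "pair x y = pair x' y'"
  proof (rule ccontr)
    have no: False if eq: "pair x y = pair x' y'" and less: "x \<oplus> y \<sqsubset> x' \<oplus> y'" for x y x' y'
    proof -
      obtain k where k: "x' \<oplus> y' = x \<oplus> y \<oplus> S k" using less unfolding less_iff by blast
      \<comment> \<open>With s = x+y, the last summand is (s+k+1)^2 + x' - s^2 - x written without
        subtraction; 2s - x becomes s + y.\<close>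
      have "pair x' y' = (x \<oplus> y) \<otimes> (x \<oplus> y) \<oplus> x \<oplus> S (y \<oplus> (x \<oplus> y) \<otimes> k \<oplus> (k \<otimes> (x \<oplus> y)) \<oplus> k \<otimes> k \<oplus> k \<oplus> k \<oplus> (x \<oplus> y) \<oplus> x')"
        unfolding pair_def k by (simp add: semiring)
      also have "\<dots> = pair x y \<oplus> S (y \<oplus> (x \<oplus> y) \<otimes> k \<oplus> (k \<otimes> (x \<oplus> y)) \<oplus> k \<otimes> k \<oplus> k \<oplus> k \<oplus> (x \<oplus> y) \<oplus> x')"
        by (simp add: pair_def)
      finally have "pair x y \<oplus> \<zero> = pair x y \<oplus> S (y \<oplus> (x \<oplus> y) \<otimes> k \<oplus> (k \<otimes> (x \<oplus> y)) \<oplus> k \<otimes> k \<oplus> k \<oplus> k \<oplus> (x \<oplus> y) \<oplus> x')"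
        using eq by simp
      then show False by (metis add_cancel_left S_neq_zero(1))
    qed
    assume "x \<oplus> y \<noteq> x' \<oplus> y'"
    then show False using no[of x y x' y'] no[of x' y' x y] eq trichotomy[of "x \<oplus> y" "x' \<oplus> y'"] by metis
  qed
  then show ?thesis by (auto simp: pair_def)
qed

end

text \<open>
  If \<open>M\<close> defines a well-founded relation without maximal elements, then every element of \<open>M\<close> is
  standard: by induction in \<open>M\<close>, for every \<open>x\<close> there is a coded ascending sequence of length \<open>x\<close>.
\<close>

definition ascentF :: "'p fm \<Rightarrow> 'p fm \<Rightarrow> 'p fm" where
  "ascentF d l = Exs 3 (Conj (Exi (setmemF (pr (V 4) (V 0)) (V 3) (V 2) (V 1)))
     (All (All (Imp (setmemF (pr (V 1) (V 0)) (V 4) (V 3) (V 2))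
       (Conj (d \<bullet> [V 0]) (Disj (Eq (V 1) Zero) (Exi (Exi (Conj (Eq (V 3) (Succ (V 1)))
         (Conj (setmemF (pr (V 1) (V 0)) (V 6) (V 5) (V 4)) (l \<bullet> [V 0, V 2])))))))))))"

text \<open>In the application \<open>d\<close> and \<open>l\<close> are the domain and the order
  that \<open>J\<close> defines, and \<open>rk\<close> reverses the isomorphism from \<nat>. It is
  the only external information about \<open>M\<close>.\<close>

locale well_founded_model = pa_model M for M :: "('a, 'p) struct" +
  fixes d l :: "'p fm" and rk :: "'a \<Rightarrow> nat"
  assumes d_below: "fm_below 1 d" and l_below: "fm_below 2 l"
    and ascent_ind: "M \<Turnstile> induction_for (ascentF d l)"
    and rk: "\<And>x y. satl M [x] d \<Longrightarrow> satl M [y] d \<Longrightarrow> satl M [x, y] l \<Longrightarrow> rk x < rk y"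
    and no_max: "\<And>x. satl M [x] d \<Longrightarrow> \<exists>y. satl M [y] d \<and> satl M [x, y] l"
    and nonempty: "\<exists>x. satl M [x] d"
begin

text \<open>Two inductions meet: one inside \<open>M\<close> builds a coded sequence with an entry
  at index \<open>x\<close>, one outside \<open>M\<close> walks it back to index zero. Each step
  back lowers the rank, so \<open>x\<close> is reached from zero by finitely many
  successors.\<close>

lemma standard: "\<exists>n. x = (S ^^ n) \<zero>"
proof -
  define R where "R c d b i e \<longleftrightarrow> setmem M (pair i e) c d b" for c d b i e
  define H where "H c d' b \<longleftrightarrow> (\<forall>i e. R c d' b i e \<longrightarrow> satl M [e] d \<and>
    (i = \<zero> \<or> (\<exists>k e'. i = S k \<and> R c d' b k e' \<and> satl M [e', e] l)))" for c d' b
  have sat: "sat M (x ## (\<lambda>_. \<zero>)) (ascentF d l) \<longleftrightarrow> (\<exists>c d' b. (\<exists>e. R c d' b x e) \<and> H c d' b)" for x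
    unfolding ascentF_def R_def H_def pair_def
    by (simp add: dom_UNIV funpow_simps pr_def sat_inst_satl[OF d_below] sat_inst_satl[OF l_below])
  have "sat M (x ## (\<lambda>_. \<zero>)) (ascentF d l)"
  proof (rule sat_induction_for[OF ascent_ind dom_UNIV])
    obtain e where e: "satl M [e] d" using nonempty by blast
    \<comment> \<open>The bound zero makes \<open>\<zero> \<zero> \<zero>\<close> a code of the
      empty set.\<close>
    obtain c d' b where *: "\<forall>i. setmem M i c d' b \<longleftrightarrow> setmem M i \<zero> \<zero> \<zero> \<or> i = pair \<zero> e"
      using insert_code by blast
    have R: "R c d' b i f \<longleftrightarrow> i = \<zero> \<and> f = e" for i f
      unfolding R_def *[rule_format] by (simp add: pair_inj setmem_iff)
    have "R c d' b \<zero> e" "H c d' b" unfolding H_def R using e by simp_all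
    then show "sat M (\<zero> ## (\<lambda>_. \<zero>)) (ascentF d l)" unfolding sat by blast
  next
    fix x assume "sat M (x ## (\<lambda>_. \<zero>)) (ascentF d l)"
    then obtain c d' b e where e: "R c d' b x e" and H: "H c d' b" unfolding sat by blast
    then have "satl M [e] d" unfolding H_def by blast
    then obtain f where f: "satl M [f] d" "satl M [e, f] l" using no_max by blast
    obtain c1 d1 b1 where *: "\<forall>i. setmem M i c1 d1 b1 \<longleftrightarrow> setmem M i c d' b \<or> i = pair (S x) f"
      using insert_code by blast
    then have R: "R c1 d1 b1 i g \<longleftrightarrow> R c d' b i g \<or> i = S x \<and> g = f" for i g
      unfolding R_def *[rule_format] by (simp add: pair_inj)
    have "H c1 d1 b1" using H f e unfolding H_def R by blast
    then show "sat M (S x ## (\<lambda>_. \<zero>)) (ascentF d l)" unfolding sat using R by blast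
  qed
  then obtain c d' b e where e: "R c d' b x e" and H: "H c d' b" unfolding sat by blast
  \<comment> \<open>The measure is the rank of the entry, not the index, which is not yet known to
    be standard.\<close>
  have "R c d' b i e \<Longrightarrow> \<exists>n. i = (S ^^ n) \<zero>" for i e
  proof (induction "rk e" arbitrary: e i rule: less_induct)
    case less
    show ?case
    proof (cases "i = \<zero>")
      case True
      then show ?thesis by (intro exI[of _ 0]) simp
    next
      case False
      then obtain k e' where k: "i = S k" "R c d' b k e'" "satl M [e', e] l"
        using H less.prems unfolding H_def by blast
      then have "rk e' < rk e" using H less.prems unfolding H_def by (metis rk)
      then obtain n where "k = (S ^^ n) \<zero>" using less.hyps k by blast
      then show ?thesis using k by (intro exI[of _ "Suc n"]) simp
    qed
  qed
  then show ?thesis using e .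
qed

end

section \<open>Isomorphisms, and models whose elements are all standard\<close>

definition isomorphic_by :: "('a \<Rightarrow> 'b) \<Rightarrow> ('a, 'p) struct \<Rightarrow> ('b, 'p) struct \<Rightarrow> bool" where
  "isomorphic_by h M N \<longleftrightarrow> bij_betw h (dom M) (dom N) \<and>
     zr M \<in> dom M \<and> h (zr M) = zr N \<and>
     (\<forall>x\<in>dom M. sc M x \<in> dom M \<and> h (sc M x) = sc N (h x)) \<and>
     (\<forall>x\<in>dom M. \<forall>y\<in>dom M. ad M x y \<in> dom M \<and> h (ad M x y) = ad N (h x) (h y) \<and>
        mu M x y \<in> dom M \<and> h (mu M x y) = mu N (h x) (h y) \<and> (ls M x y \<longleftrightarrow> ls N (h x) (h y))) \<and>
     (\<forall>p. \<forall>x\<in>dom M. pd M p x \<longleftrightarrow> pd N p (h x))"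

lemma tv_isomorphic:
  assumes "isomorphic_by h M N" "range e \<subseteq> dom M"
  shows "tv M e t \<in> dom M \<and> h (tv M e t) = tv N (\<lambda>i. h (e i)) t"
  using assms by (induction t) (auto simp: isomorphic_by_def)

lemma sat_isomorphic:
  fixes M :: "('a, 'p) struct" and N :: "('b, 'p) struct"
  assumes iso: "isomorphic_by h M N" and "range e \<subseteq> dom M"
  shows "sat M e a \<longleftrightarrow> sat N (\<lambda>i. h (e i)) a"
  using assms(2)
proof (induction a arbitrary: e)
  case (Eq s t)
  have "inj_on h (dom M)" using iso by (auto simp: isomorphic_by_def bij_betw_def)
  then show ?case using tv_isomorphic[OF iso Eq] by (metis inj_onD sat.simps(1))
next
  case (Less s t)
  then show ?case using tv_isomorphic[OF iso Less] iso unfolding isomorphic_by_def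
    by (metis sat.simps(2))
next
  case (Pr p t)
  then show ?case using tv_isomorphic[OF iso Pr] iso unfolding isomorphic_by_def
    by (metis sat.simps(3))
next
  case (Exi a)
  have *: "(\<lambda>i. h ((x ## e) i)) = h x ## (\<lambda>i. h (e i))" for x
    by (rule ext) (simp add: scons_def split: nat.split)
  have "sat M (x ## e) a \<longleftrightarrow> sat N (h x ## (\<lambda>i. h (e i))) a" if "x \<in> dom M" for x
    unfolding *[symmetric] by (rule Exi.IH) (simp add: range_scons_subset that Exi.prems)
  moreover have "dom N = h ` dom M" using iso by (simp add: isomorphic_by_def bij_betw_def)
  ultimately show ?case by auto
qed auto

lemma models_isomorphic:
  fixes M :: "('a, 'p) struct" and N :: "('b, 'p) struct"
  assumes iso: "isomorphic_by h M N"
  shows "M \<Turnstile> a \<longleftrightarrow> N \<Turnstile> a"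
  unfolding models_def
proof (intro iffI allI impI)
  have dom: "dom N = h ` dom M" using iso by (simp add: isomorphic_by_def bij_betw_def)
  {
    fix e :: "nat \<Rightarrow> 'a"
    assume *: "\<forall>e. range e \<subseteq> dom N \<longrightarrow> sat N e a" and e: "range e \<subseteq> dom M"
    then show "sat M e a" using sat_isomorphic[OF iso e] dom by (auto simp: image_subset_iff)
  next
    fix e :: "nat \<Rightarrow> 'b"
    assume *: "\<forall>e. range e \<subseteq> dom M \<longrightarrow> sat M e a" and e: "range e \<subseteq> dom N"
    then have "\<forall>i. \<exists>x\<in>dom M. e i = h x" using dom by blast
    then obtain g where g: "\<And>i. g i \<in> dom M" "\<And>i. e i = h (g i)" by metis
    then have "range g \<subseteq> dom M" "e = (\<lambda>i. h (g i))" by blast+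
    then show "sat N e a" using sat_isomorphic[OF iso, of g] * by auto
  }
qed

lemma isomorphic_by_trans:
  assumes "isomorphic_by g L M" "isomorphic_by h M N"
  shows "isomorphic_by (h \<circ> g) L N"
proof -
  have "g x \<in> dom M" if "x \<in> dom L" for x
    using assms(1) that by (auto simp: isomorphic_by_def bij_betw_def)
  then show ?thesis using assms unfolding isomorphic_by_def
    by (auto intro: bij_betw_trans)
qed

definition nat_model :: "('p \<Rightarrow> nat \<Rightarrow> bool) \<Rightarrow> (nat, 'p) struct" where
  "nat_model P = \<lparr>dom = UNIV, zr = 0, sc = Suc, ad = (+), mu = (*), ls = (<), pd = P\<rparr>"

lemma nat_model_simps [simp]:
  "dom (nat_model P) = UNIV" "zr (nat_model P) = 0" "sc (nat_model P) = Suc"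
  "ad (nat_model P) = (+)" "mu (nat_model P) = (*)" "ls (nat_model P) = (<)" "pd (nat_model P) = P"
  by (simp_all add: nat_model_def)

lemma (in well_founded_model) isomorphic_nat:
  "\<exists>h P. isomorphic_by h M (nat_model P)"
proof -
  define g where "g n = (S ^^ n) \<zero>" for n
  have g_simps: "g 0 = \<zero>" "g (Suc n) = S (g n)" for n by (simp_all add: g_def)
  have "g m = g n \<Longrightarrow> m = n" for m n
  proof (induction m arbitrary: n)
    case 0
    then show ?case by (cases n) (auto simp: g_simps)
  next
    case (Suc m)
    then show ?case by (cases n) (auto simp: g_simps)
  qed
  moreover have "surj g" using standard unfolding g_def by (metis surjI)
  ultimately have "bij g" by (simp add: bij_def inj_def)
  then have gi [simp]: "inv g (g n) = n" "g (inv g x) = x" for n x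
    by (simp_all add: bij_is_inj bij_is_surj surj_f_inv_f)
  have ad: "g m \<oplus> g n = g (m + n)" for m n by (induction n) (auto simp: g_simps)
  have mu: "g m \<otimes> g n = g (m * n)" for m n by (induction n) (auto simp: g_simps ad add.commute)
  have ls: "g m \<sqsubset> g n \<longleftrightarrow> m < n" for m n
  proof (induction n)
    case (Suc n)
    have "g m = g n \<longleftrightarrow> m = n" by (metis gi(1))
    with Suc show ?case by (auto simp: g_simps less_S)
  qed (simp add: g_simps)
  have "isomorphic_by (inv g) M (nat_model (\<lambda>p n. pd M p (g n)))"
    unfolding isomorphic_by_def nat_model_simps dom_UNIV
  proof (intro conjI ballI allI)
    show "bij_betw (inv g) UNIV UNIV" using \<open>bij g\<close> by (rule bij_imp_bij_inv)
    show "inv g \<zero> = 0" by (metis g_simps(1) gi(1))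
    show "inv g (S x) = Suc (inv g x)" for x by (metis g_simps(2) gi)
    show "inv g (x \<oplus> y) = inv g x + inv g y" "inv g (x \<otimes> y) = inv g x * inv g y"
      "x \<sqsubset> y \<longleftrightarrow> inv g x < inv g y" for x y
      by (metis ad gi, metis mu gi, metis ls gi(2))
  qed auto
  then show ?thesis by blast
qed

section \<open>Arithmetized syntax in the standard model\<close>

text \<open>The code lies between (x+y)^2 and (x+y+1)^2, the latter excluded, so it determines x+y
  and then x.\<close>

lemma npair_inj [simp]: "npair x y = npair x' y' \<longleftrightarrow> x = x' \<and> y = y'"
proof -
  have no: "npair x y < npair x' y'" if "x + y < x' + y'" for x y x' y'
  proof -
    have "npair x y < Suc (x + y) * Suc (x + y)" by (simp add: npair_def)
    also have "\<dots> \<le> (x' + y') * (x' + y')" using that by (intro mult_le_mono) auto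
    also have "\<dots> \<le> npair x' y'" by (simp add: npair_def)
    finally show ?thesis .
  qed
  have "x + y = x' + y'" if "npair x y = npair x' y'"
    using no[of x y x' y'] no[of x' y' x y] that by (metis less_irrefl nat_neq_iff)
  then show ?thesis by (auto simp: npair_def)
qed

lemma npair_ge: "x \<le> npair x y" "y \<le> npair x y"
proof -
  show "x \<le> npair x y" by (simp add: npair_def)
  have "y \<le> (x + y) * (x + y)" by (cases "x + y") auto
  then show "y \<le> npair x y" by (simp add: npair_def)
qed

lemma npair_greater: "0 < x \<Longrightarrow> y < npair x y"
proof -
  assume "0 < x"
  have "y \<le> (x + y) * (x + y)" by (cases "x + y") auto
  then show "y < npair x y" using \<open>0 < x\<close> by (simp add: npair_def)
qed

definition elems :: "nat \<Rightarrow> nat set" where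
  "elems w = {x. \<exists>c d l i q. w = npair c (npair d l) \<and> i < l \<and>
     c = q * Suc (Suc i * d) + x \<and> x < Suc (Suc i * d)}"

text \<open>A common divisor of the moduli divides their combination (j+1)m_i - (i+1)m_j = j - i,
  hence d, hence one.\<close>

lemma moduli_coprime:
  fixes i j d :: nat
  assumes "i < j" "j - i dvd d"
  shows "coprime (Suc (Suc i * d)) (Suc (Suc j * d))"
proof (rule coprimeI)
  fix c assume c: "c dvd Suc (Suc i * d)" "c dvd Suc (Suc j * d)"
  have "Suc j * Suc (Suc i * d) = Suc i * Suc (Suc j * d) + (j - i)"
    using assms(1) by (simp add: algebra_simps)
  then have "c dvd Suc i * Suc (Suc j * d) + (j - i)" using c(1) by (metis dvd_mult)
  then have "c dvd j - i" using c(2) by (metis dvd_add_right_iff dvd_mult)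
  then have "c dvd Suc i * d" using assms(2) by (meson dvd_mult dvd_trans)
  then show "is_unit c" using c(1) by (metis Suc_eq_plus1 dvd_add_right_iff)
qed

text \<open>Goedel's beta lemma: the Chinese remainder theorem yields \<open>c\<close> once the
  moduli are pairwise coprime and larger than the entries.\<close>

lemma elems_finite_set:
  assumes "finite S" shows "\<exists>w. elems w = S"
proof -
  obtain xs where xs: "set xs = S" using finite_list[OF assms] by blast
  define l where "l = length xs"
  \<comment> \<open>\<open>B\<close> bounds both the entries and the differences of indices. Its
    factorial is therefore divisible by those differences and makes every modulus larger than every
    entry.\<close>
  define B where "B = sum_list xs + l"
  define d where "d = (fact B :: nat)"
  have big: "xs ! i < Suc (Suc i * d)" if "i < l" for i
  proof -
    have "xs ! i \<le> B" using that member_le_sum_list[of "xs ! i" xs] by (simp add: B_def l_def)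
    also have "B \<le> d" unfolding d_def by (rule fact_ge_self)
    also have "d \<le> Suc i * d" by simp
    finally show ?thesis by simp
  qed
  have "j - i dvd d" if "i < j" "j < l" for i j
    unfolding d_def using that by (intro dvd_fact) (auto simp: B_def)
  then have "coprime (Suc (Suc i * d)) (Suc (Suc j * d))" if "i < l" "j < l" "i \<noteq> j" for i j
    using that moduli_coprime[of i j d] moduli_coprime[of j i d] by (metis coprime_commute nat_neq_iff)
  then obtain c where c: "\<forall>i\<in>{..<l}. [c = xs ! i] (mod Suc (Suc i * d))"
    using chinese_remainder_nat[of "{..<l}" "\<lambda>i. Suc (Suc i * d)" "\<lambda>i. xs ! i"] by auto
  have char: "x = xs ! i \<longleftrightarrow> (\<exists>q. c = q * Suc (Suc i * d) + x) \<and> x < Suc (Suc i * d)" if "i < l" for i x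
  proof -
    let ?m = "Suc (Suc i * d)"
    have m: "c mod ?m = xs ! i" using c that big[OF that] by (auto simp: cong_def simp del: mult_Suc)
    show ?thesis
    proof
      assume "x = xs ! i"
      then show "(\<exists>q. c = q * ?m + x) \<and> x < ?m"
        using big[OF that] m by (metis div_mult_mod_eq)
    next
      assume "(\<exists>q. c = q * ?m + x) \<and> x < ?m"
      then show "x = xs ! i" using m by (metis mod_mult_self3 mod_less)
    qed
  qed
  have "x \<in> elems (npair c (npair d l)) \<longleftrightarrow>
      (\<exists>i<l. (\<exists>q. c = q * Suc (Suc i * d) + x) \<and> x < Suc (Suc i * d))" for x
    unfolding elems_def npair_inj by blast
  also have "\<dots>x \<longleftrightarrow> (\<exists>i<l. x = xs ! i)" for x using char by blast
  finally show ?thesis using xs by (intro exI[of _ "npair c (npair d l)"]) (auto simp: set_conv_nth l_def)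
qed

lemma tv_pr [simp]: "tv (nat_model P) e (pr s t) = npair (tv (nat_model P) e s) (tv (nat_model P) e t)"
  by (simp add: pr_def npair_def)

lemma tv_num [simp]: "tv (nat_model P) e (num n) = n"
  unfolding num_def by (induction n) auto

lemma tv_q [simp]:
  "tv (nat_model P) e (qVar s) = npair 1 (tv (nat_model P) e s)"
  "tv (nat_model P) e qZero = npair 2 0"
  "tv (nat_model P) e (qSucc s) = npair 3 (tv (nat_model P) e s)"
  "tv (nat_model P) e (qAdd s t) = npair 4 (npair (tv (nat_model P) e s) (tv (nat_model P) e t))"
  "tv (nat_model P) e (qMul s t) = npair 5 (npair (tv (nat_model P) e s) (tv (nat_model P) e t))"
  "tv (nat_model P) e (qEq s t) = npair 6 (npair (tv (nat_model P) e s) (tv (nat_model P) e t))"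
  "tv (nat_model P) e (qLess s t) = npair 7 (npair (tv (nat_model P) e s) (tv (nat_model P) e t))"
  "tv (nat_model P) e (qNeg s) = npair 8 (tv (nat_model P) e s)"
  "tv (nat_model P) e (qDisj s t) = npair 9 (npair (tv (nat_model P) e s) (tv (nat_model P) e t))"
  "tv (nat_model P) e (qExi s) = npair 10 (tv (nat_model P) e s)"
  "tv (nat_model P) e (cns s t) = Suc (npair (tv (nat_model P) e s) (tv (nat_model P) e t))"
  by (simp_all add: qVar_def qZero_def qSucc_def qAdd_def qMul_def qEq_def qLess_def qNeg_def
      qDisj_def qExi_def cns_def)

lemma sat_memF: "sat (nat_model P) e memF \<longleftrightarrow> e 0 \<in> elems (e 1)"
  unfolding memF_def elems_def by (simp add: Let_def funpow_simps)

lemma sat_mem [simp]: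
  "sat (nat_model P) e (mem x w) \<longleftrightarrow> tv (nat_model P) e x \<in> elems (tv (nat_model P) e w)"
  by (simp add: mem_def sat_inst sat_memF)

section \<open>Finite derivations from finitary rules\<close>

definition finitary :: "('a set \<Rightarrow> bool) \<Rightarrow> bool" where
  "finitary F \<longleftrightarrow> (\<forall>W. F W \<longleftrightarrow> (\<exists>U\<subseteq>W. finite U \<and> F U))"

lemma finitary_mono: "finitary F \<Longrightarrow> F U \<Longrightarrow> U \<subseteq> W \<Longrightarrow> F W"
  unfolding finitary_def by (meson subset_trans)

lemma finitary_const: "finitary (\<lambda>_. c)"
  by (auto simp: finitary_def)

lemma finitary_mem: "finitary (\<lambda>W. a \<in> W)"
  unfolding finitary_def by (metis empty_subsetI finite.emptyI finite_insert insertI1 insert_subset subsetD)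

lemma finitary_Ex: "(\<And>x. finitary (F x)) \<Longrightarrow> finitary (\<lambda>W. \<exists>x. F x W)"
  unfolding finitary_def by metis

lemma finitary_disj: "finitary F \<Longrightarrow> finitary G \<Longrightarrow> finitary (\<lambda>W. F W \<or> G W)"
  unfolding finitary_def by metis

lemma finitary_conj:
  assumes "finitary F" "finitary G" shows "finitary (\<lambda>W. F W \<and> G W)"
  unfolding finitary_def
proof (intro allI iffI)
  fix W assume "F W \<and> G W"
  then obtain U V where "U \<subseteq> W" "finite U" "F U" "V \<subseteq> W" "finite V" "G V"
    using assms unfolding finitary_def by meson
  then show "\<exists>U\<subseteq>W. finite U \<and> F U \<and> G U"
    using finitary_mono[OF assms(1), of U "U \<union> V"] finitary_mono[OF assms(2), of V "U \<union> V"]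
    by (intro exI[of _ "U \<union> V"]) auto
next
  fix W assume "\<exists>U\<subseteq>W. finite U \<and> F U \<and> G U"
  then show "F W \<and> G W" using assms finitary_mono by meson
qed

text \<open>A bounded quantifier asks for finitely many premises only. The clause for bounded
  quantification in \<open>sat0_rule\<close> depends on this.\<close>

lemma finitary_all_less:
  fixes p :: nat
  assumes "\<And>i. finitary (F i)" shows "finitary (\<lambda>W. \<forall>i<p. F i W)"
proof (induction p)
  case (Suc p)
  have "(\<lambda>W. \<forall>i<Suc p. F i W) = (\<lambda>W. (\<forall>i<p. F i W) \<and> F p W)"
    by (auto simp: less_Suc_eq)
  then show ?case using finitary_conj[OF Suc assms] by simp
qed (simp add: finitary_const)

lemmas finitary_intros =
  finitary_Ex finitary_conj finitary_disj finitary_all_less finitary_mem finitary_const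

definition Deriv :: "('a set \<Rightarrow> 'a \<Rightarrow> bool) \<Rightarrow> 'a set" where
  "Deriv r = {x. \<exists>W. finite W \<and> x \<in> W \<and> (\<forall>y\<in>W. r W y)}"

text \<open>From left to right, a finite derivation consists of derivable elements. From right to
  left, finitely many premises suffice, and the union of their derivations with the conclusion
  supports itself. Since premises are simpler than conclusions, this equivalence alone determines
  the relations below, by induction on codes.\<close>

lemma Deriv_unfold:
  assumes fin: "\<And>y. finitary (\<lambda>W. r W y)"
  shows "x \<in> Deriv r \<longleftrightarrow> r (Deriv r) x"
proof
  assume "x \<in> Deriv r"
  then obtain W where W: "finite W" "x \<in> W" "\<forall>y\<in>W. r W y" by (auto simp: Deriv_def)
  then have "W \<subseteq> Deriv r" by (auto simp: Deriv_def)
  then show "r (Deriv r) x" using finitary_mono[OF fin] W by blast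
next
  assume "r (Deriv r) x"
  then obtain U where U: "U \<subseteq> Deriv r" "finite U" "r U x"
    using fin[of x] unfolding finitary_def by meson
  have "\<exists>W. finite W \<and> z \<in> W \<and> (\<forall>y\<in>W. r W y)" if "z \<in> U" for z
    using U(1) that unfolding Deriv_def by blast
  then obtain f where f: "\<And>z. z \<in> U \<Longrightarrow> finite (f z) \<and> z \<in> f z \<and> (\<forall>y\<in>f z. r (f z) y)" by metis
  define W where "W = insert x (\<Union>z\<in>U. f z)"
  have "finite W" using U f by (auto simp: W_def)
  moreover have "r W y" if y: "y \<in> W" for y
  proof (cases "y = x")
    case True
    have "U \<subseteq> W" using f by (auto simp: W_def)
    then show ?thesis using finitary_mono[OF fin] U(3) True by blast
  next
    case False
    then obtain z where z: "z \<in> U" "y \<in> f z" using y by (auto simp: W_def)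
    then have "f z \<subseteq> W" by (auto simp: W_def)
    moreover have "r (f z) y" using f z by blast
    ultimately show ?thesis using finitary_mono[OF fin] by blast
  qed
  ultimately show "x \<in> Deriv r" unfolding Deriv_def by (intro CollectI exI[of _ W]) (auto simp: W_def)
qed

lemma finite_elems: "finite (elems w)"
proof -
  have "elems w \<subseteq> {..w}"
  proof
    fix x assume "x \<in> elems w"
    then obtain c d l i q where "w = npair c (npair d l)" "c = q * Suc (Suc i * d) + x"
      by (auto simp: elems_def)
    then show "x \<in> {..w}" using npair_ge(1)[of c "npair d l"] by auto
  qed
  then show ?thesis by (rule finite_subset) simp
qed

text \<open>The coded sets range over all finite sets of numbers by \<open>elems_finite_set\<close>,
  so the internal quantifier over \<open>w\<close> is a true quantifier over finite derivations. The
  function \<open>pack\<close> turns a tuple into the number that the formula handles.\<close>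

lemma sat_derivable:
  assumes R: "\<And>y w e. sat (nat_model P) (y ## w ## e) R \<longleftrightarrow>
      (\<exists>k. y = pack k \<and> r {k. pack k \<in> elems w} k)" and inj: "inj pack"
  shows "sat (nat_model P) e (derivable R x) \<longleftrightarrow> (\<exists>k. tv (nat_model P) e x = pack k \<and> k \<in> Deriv r)"
proof -
  have "sat (nat_model P) e (derivable R x) \<longleftrightarrow> (\<exists>w. tv (nat_model P) e x \<in> elems w \<and>
      (\<forall>y\<in>elems w. \<exists>k. y = pack k \<and> r {k. pack k \<in> elems w} k))"
    unfolding derivable_def by (simp add: sat_inst R Ball_def)
  also have "\<dots> \<longleftrightarrow> (\<exists>k. tv (nat_model P) e x = pack k \<and> k \<in> Deriv r)"
  proof
    assume "\<exists>w. tv (nat_model P) e x \<in> elems w \<and>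
      (\<forall>y\<in>elems w. \<exists>k. y = pack k \<and> r {k. pack k \<in> elems w} k)"
    then obtain w where w: "tv (nat_model P) e x \<in> elems w"
      "\<forall>y\<in>elems w. \<exists>k. y = pack k \<and> r {k. pack k \<in> elems w} k" by blast
    let ?W = "{k. pack k \<in> elems w}"
    have "finite ?W" using finite_vimageI[OF finite_elems inj, of w] by (simp add: vimage_def)
    moreover have "\<forall>k\<in>?W. r ?W k" using w(2) injD[OF inj] by fastforce
    ultimately have "?W \<subseteq> Deriv r" unfolding Deriv_def by blast
    then show "\<exists>k. tv (nat_model P) e x = pack k \<and> k \<in> Deriv r" using w by (metis (mono_tags, lifting) mem_Collect_eq subsetD)
  next
    assume "\<exists>k. tv (nat_model P) e x = pack k \<and> k \<in> Deriv r"
    then obtain k W where k: "tv (nat_model P) e x = pack k" "finite W" "k \<in> W" "\<forall>y\<in>W. r W y"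
      by (auto simp: Deriv_def)
    then obtain w where w: "elems w = pack ` W" using elems_finite_set[of "pack ` W"] by auto
    then have "{k. pack k \<in> elems w} = W" using injD[OF inj] by auto
    then show "\<exists>w. tv (nat_model P) e x \<in> elems w \<and>
      (\<forall>y\<in>elems w. \<exists>k. y = pack k \<and> r {k. pack k \<in> elems w} k)"
      using k w by (intro exI[of _ w]) auto
  qed
  finally show ?thesis .
qed

definition pack2 :: "nat \<times> nat \<Rightarrow> nat" where "pack2 = (\<lambda>(a, b). npair a b)"
definition pack3 :: "nat \<times> nat \<times> nat \<Rightarrow> nat" where "pack3 = (\<lambda>(a, b, c). npair a (npair b c))"
definition pack4 :: "nat \<times> nat \<times> nat \<times> nat \<Rightarrow> nat" where
  "pack4 = (\<lambda>(a, b, c, d). npair a (npair b (npair c d)))"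

lemma inj_pack: "inj pack2" "inj pack3" "inj pack4"
  by (auto simp: inj_def pack2_def pack3_def pack4_def)

lemma pack_simps [simp]:
  "pack2 (a, b) = npair a b" "pack3 (a, b, c) = npair a (npair b c)"
  "pack4 (a, b, c, d) = npair a (npair b (npair c d))"
  by (simp_all add: pack2_def pack3_def pack4_def)

section \<open>Arithmetized relations as sets of tuples\<close>

definition tm_rule :: "(nat \<times> nat) set \<Rightarrow> nat \<times> nat \<Rightarrow> bool" where
  "tm_rule W = (\<lambda>(t, n). \<exists>a b.
     t = npair 1 a \<and> a < n \<or> t = npair 2 0 \<or>
     t = npair 3 a \<and> (a, n) \<in> W \<or>
     t = npair 4 (npair a b) \<and> (a, n) \<in> W \<and> (b, n) \<in> W \<or>
     t = npair 5 (npair a b) \<and> (a, n) \<in> W \<and> (b, n) \<in> W)"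

definition "TmS = Deriv tm_rule"

lemma TmS_iff: "(t, n) \<in> TmS \<longleftrightarrow> tm_rule TmS (t, n)"
  unfolding TmS_def by (rule Deriv_unfold) (auto simp: tm_rule_def split_def intro!: finitary_intros)

lemma sat_isTm [simp]:
  "sat (nat_model P) e (isTm t n) \<longleftrightarrow> (tv (nat_model P) e t, tv (nat_model P) e n) \<in> TmS"
proof -
  have "sat (nat_model P) (y ## w ## e) TmR \<longleftrightarrow>
      (\<exists>k. y = pack2 k \<and> tm_rule {k. pack2 k \<in> elems w} k)" for y w e
    unfolding TmR_def tm_rule_def by (simp add: Let_def funpow_simps)
  from sat_derivable[OF this inj_pack(1)] show ?thesis by (simp add: isTm_def TmS_def)
qed

definition fm_rule :: "(nat \<times> nat) set \<Rightarrow> nat \<times> nat \<Rightarrow> bool" where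
  "fm_rule W = (\<lambda>(f, n). \<exists>a b.
     f = npair 6 (npair a b) \<and> (a, n) \<in> TmS \<and> (b, n) \<in> TmS \<or>
     f = npair 7 (npair a b) \<and> (a, n) \<in> TmS \<and> (b, n) \<in> TmS \<or>
     f = npair 8 a \<and> (a, n) \<in> W \<or>
     f = npair 9 (npair a b) \<and> (a, n) \<in> W \<and> (b, n) \<in> W \<or>
     f = npair 10 a \<and> (a, Suc n) \<in> W)"

definition "FmS = Deriv fm_rule"

lemma FmS_iff: "(f, n) \<in> FmS \<longleftrightarrow> fm_rule FmS (f, n)"
  unfolding FmS_def by (rule Deriv_unfold) (auto simp: fm_rule_def split_def intro!: finitary_intros)

lemma sat_isFm [simp]:
  "sat (nat_model P) e (isFm f n) \<longleftrightarrow> (tv (nat_model P) e f, tv (nat_model P) e n) \<in> FmS"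
proof -
  have "sat (nat_model P) (y ## w ## e) FmR \<longleftrightarrow>
      (\<exists>k. y = pack2 k \<and> fm_rule {k. pack2 k \<in> elems w} k)" for y w e
    unfolding FmR_def fm_rule_def by (simp add: Let_def funpow_simps)
  from sat_derivable[OF this inj_pack(1)] show ?thesis by (simp add: isFm_def FmS_def)
qed

definition lookup_rule :: "(nat \<times> nat \<times> nat) set \<Rightarrow> nat \<times> nat \<times> nat \<Rightarrow> bool" where
  "lookup_rule W = (\<lambda>(e', i, x). \<exists>a r k. e' = Suc (npair a r) \<and>
     (i = 0 \<and> x = a \<or> i = Suc k \<and> (r, k, x) \<in> W))"

definition "LookupS = Deriv lookup_rule"

lemma LookupS_iff: "(e', i, x) \<in> LookupS \<longleftrightarrow> lookup_rule LookupS (e', i, x)"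
  unfolding LookupS_def by (rule Deriv_unfold) (auto simp: lookup_rule_def split_def intro!: finitary_intros)

lemma sat_lookup [simp]:
  "sat (nat_model P) e (lookup e' i x) \<longleftrightarrow> (tv (nat_model P) e e', tv (nat_model P) e i, tv (nat_model P) e x) \<in> LookupS"
proof -
  have "sat (nat_model P) (y ## w ## e) LookupR \<longleftrightarrow>
      (\<exists>k. y = pack3 k \<and> lookup_rule {k. pack3 k \<in> elems w} k)" for y w e
    unfolding LookupR_def lookup_rule_def by (simp add: Let_def funpow_simps)
  from sat_derivable[OF this inj_pack(2)] show ?thesis by (simp add: lookup_def LookupS_def)
qed

definition len_rule :: "(nat \<times> nat) set \<Rightarrow> nat \<times> nat \<Rightarrow> bool" where
  "len_rule W = (\<lambda>(e', n). \<exists>a r k.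
     e' = 0 \<and> n = 0 \<or> e' = Suc (npair a r) \<and> n = Suc k \<and> (r, k) \<in> W)"

definition "LenS = Deriv len_rule"

lemma LenS_iff: "(e', n) \<in> LenS \<longleftrightarrow> len_rule LenS (e', n)"
  unfolding LenS_def by (rule Deriv_unfold) (auto simp: len_rule_def split_def intro!: finitary_intros)

lemma sat_len [simp]:
  "sat (nat_model P) e (len e' n) \<longleftrightarrow> (tv (nat_model P) e e', tv (nat_model P) e n) \<in> LenS"
proof -
  have "sat (nat_model P) (y ## w ## e) LenR \<longleftrightarrow>
      (\<exists>k. y = pack2 k \<and> len_rule {k. pack2 k \<in> elems w} k)" for y w e
    unfolding LenR_def len_rule_def by (simp add: Let_def funpow_simps)
  from sat_derivable[OF this inj_pack(1)] show ?thesis by (simp add: len_def LenS_def)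
qed

definition append_rule :: "(nat \<times> nat \<times> nat) set \<Rightarrow> nat \<times> nat \<times> nat \<Rightarrow> bool" where
  "append_rule W = (\<lambda>(e', l, h). \<exists>a r k.
     e' = 0 \<and> h = l \<or> e' = Suc (npair a r) \<and> h = Suc (npair a k) \<and> (r, l, k) \<in> W)"

definition "AppendS = Deriv append_rule"

lemma AppendS_iff: "(e', l, h) \<in> AppendS \<longleftrightarrow> append_rule AppendS (e', l, h)"
  unfolding AppendS_def by (rule Deriv_unfold) (auto simp: append_rule_def split_def intro!: finitary_intros)

lemma sat_append [simp]:
  "sat (nat_model P) e (append e' l h) \<longleftrightarrow> (tv (nat_model P) e e', tv (nat_model P) e l, tv (nat_model P) e h) \<in> AppendS"
proof -
  have "sat (nat_model P) (y ## w ## e) AppendR \<longleftrightarrow>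
      (\<exists>k. y = pack3 k \<and> append_rule {k. pack3 k \<in> elems w} k)" for y w e
    unfolding AppendR_def append_rule_def by (simp add: Let_def funpow_simps)
  from sat_derivable[OF this inj_pack(2)] show ?thesis by (simp add: append_def AppendS_def)
qed

definition val_rule :: "(nat \<times> nat \<times> nat) set \<Rightarrow> nat \<times> nat \<times> nat \<Rightarrow> bool" where
  "val_rule W = (\<lambda>(t, e', v). \<exists>a b p q.
     t = npair 1 a \<and> (e', a, v) \<in> LookupS \<or>
     t = npair 2 0 \<and> v = 0 \<or>
     t = npair 3 a \<and> v = Suc p \<and> (a, e', p) \<in> W \<or>
     t = npair 4 (npair a b) \<and> v = p + q \<and> (a, e', p) \<in> W \<and> (b, e', q) \<in> W \<or>
     t = npair 5 (npair a b) \<and> v = p * q \<and> (a, e', p) \<in> W \<and> (b, e', q) \<in> W)"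

definition "ValS = Deriv val_rule"

lemma ValS_iff: "(t, e', v) \<in> ValS \<longleftrightarrow> val_rule ValS (t, e', v)"
  unfolding ValS_def by (rule Deriv_unfold) (auto simp: val_rule_def split_def intro!: finitary_intros)

lemma sat_val [simp]:
  "sat (nat_model P) e (val t e' v) \<longleftrightarrow> (tv (nat_model P) e t, tv (nat_model P) e e', tv (nat_model P) e v) \<in> ValS"
proof -
  have "sat (nat_model P) (y ## w ## e) ValR \<longleftrightarrow>
      (\<exists>k. y = pack3 k \<and> val_rule {k. pack3 k \<in> elems w} k)" for y w e
    unfolding ValR_def val_rule_def by (simp add: Let_def funpow_simps)
  from sat_derivable[OF this inj_pack(2)] show ?thesis by (simp add: val_def ValS_def)
qed

definition num_rule :: "(nat \<times> nat) set \<Rightarrow> nat \<times> nat \<Rightarrow> bool" where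
  "num_rule W = (\<lambda>(m, u). \<exists>k r.
     m = 0 \<and> u = npair 2 0 \<or> m = Suc k \<and> u = npair 3 r \<and> (k, r) \<in> W)"

definition "NumS = Deriv num_rule"

lemma sat_isNum [simp]:
  "sat (nat_model P) e (isNum m u) \<longleftrightarrow> (tv (nat_model P) e m, tv (nat_model P) e u) \<in> NumS"
proof -
  have "sat (nat_model P) (y ## w ## e) NumR \<longleftrightarrow>
      (\<exists>k. y = pack2 k \<and> num_rule {k. pack2 k \<in> elems w} k)" for y w e
    unfolding NumR_def num_rule_def by (simp add: Let_def funpow_simps)
  from sat_derivable[OF this inj_pack(1)] show ?thesis by (simp add: isNum_def NumS_def)
qed

definition subtm_rule :: "(nat \<times> nat \<times> nat \<times> nat) set \<Rightarrow> nat \<times> nat \<times> nat \<times> nat \<Rightarrow> bool" where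
  "subtm_rule W = (\<lambda>(t, d, u, g). \<exists>a b a' b'.
     t = npair 1 a \<and> a < d \<and> g = t \<or>
     t = npair 1 d \<and> g = u \<or>
     t = npair 1 (Suc a) \<and> d < Suc a \<and> g = npair 1 a \<or>
     t = npair 2 0 \<and> g = npair 2 0 \<or>
     t = npair 3 a \<and> g = npair 3 a' \<and> (a, d, u, a') \<in> W \<or>
     t = npair 4 (npair a b) \<and> g = npair 4 (npair a' b') \<and> (a, d, u, a') \<in> W \<and> (b, d, u, b') \<in> W \<or>
     t = npair 5 (npair a b) \<and> g = npair 5 (npair a' b') \<and> (a, d, u, a') \<in> W \<and> (b, d, u, b') \<in> W)"

definition "SubTmS = Deriv subtm_rule"

lemma sat_subTm [simp]:
  "sat (nat_model P) e (subTm t d u g) \<longleftrightarrow> (tv (nat_model P) e t, tv (nat_model P) e d, tv (nat_model P) e u, tv (nat_model P) e g) \<in> SubTmS"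
proof -
  have "sat (nat_model P) (y ## w ## e) SubTmR \<longleftrightarrow>
      (\<exists>k. y = pack4 k \<and> subtm_rule {k. pack4 k \<in> elems w} k)" for y w e
    unfolding SubTmR_def subtm_rule_def by (simp add: Let_def funpow_simps)
  from sat_derivable[OF this inj_pack(3)] show ?thesis by (simp add: subTm_def SubTmS_def)
qed

definition subfm_rule :: "(nat \<times> nat \<times> nat \<times> nat) set \<Rightarrow> nat \<times> nat \<times> nat \<times> nat \<Rightarrow> bool" where
  "subfm_rule W = (\<lambda>(f, d, u, g). \<exists>a b a' b'.
     f = npair 6 (npair a b) \<and> g = npair 6 (npair a' b') \<and> (a, d, u, a') \<in> SubTmS \<and> (b, d, u, b') \<in> SubTmS \<or>
     f = npair 7 (npair a b) \<and> g = npair 7 (npair a' b') \<and> (a, d, u, a') \<in> SubTmS \<and> (b, d, u, b') \<in> SubTmS \<or>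
     f = npair 8 a \<and> g = npair 8 a' \<and> (a, d, u, a') \<in> W \<or>
     f = npair 9 (npair a b) \<and> g = npair 9 (npair a' b') \<and> (a, d, u, a') \<in> W \<and> (b, d, u, b') \<in> W \<or>
     f = npair 10 a \<and> g = npair 10 a' \<and> (a, Suc d, u, a') \<in> W)"

definition "SubFmS = Deriv subfm_rule"

lemma SubFmS_iff: "(f, d, u, g) \<in> SubFmS \<longleftrightarrow> subfm_rule SubFmS (f, d, u, g)"
  unfolding SubFmS_def by (rule Deriv_unfold) (auto simp: subfm_rule_def split_def intro!: finitary_intros)

lemma sat_subFm [simp]:
  "sat (nat_model P) e (subFm f d u g) \<longleftrightarrow> (tv (nat_model P) e f, tv (nat_model P) e d, tv (nat_model P) e u, tv (nat_model P) e g) \<in> SubFmS"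
proof -
  have "sat (nat_model P) (y ## w ## e) SubFmR \<longleftrightarrow>
      (\<exists>k. y = pack4 k \<and> subfm_rule {k. pack4 k \<in> elems w} k)" for y w e
    unfolding SubFmR_def subfm_rule_def by (simp add: Let_def funpow_simps)
  from sat_derivable[OF this inj_pack(3)] show ?thesis by (simp add: subFm_def SubFmS_def)
qed

definition lifttm_rule :: "(nat \<times> nat \<times> nat) set \<Rightarrow> nat \<times> nat \<times> nat \<Rightarrow> bool" where
  "lifttm_rule W = (\<lambda>(t, c, g). \<exists>a b a' b'.
     t = npair 1 a \<and> a < c \<and> g = t \<or>
     t = npair 1 a \<and> \<not> a < c \<and> g = npair 1 (Suc a) \<or>
     t = npair 2 0 \<and> g = npair 2 0 \<or>
     t = npair 3 a \<and> g = npair 3 a' \<and> (a, c, a') \<in> W \<or>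
     t = npair 4 (npair a b) \<and> g = npair 4 (npair a' b') \<and> (a, c, a') \<in> W \<and> (b, c, b') \<in> W \<or>
     t = npair 5 (npair a b) \<and> g = npair 5 (npair a' b') \<and> (a, c, a') \<in> W \<and> (b, c, b') \<in> W)"

definition "LiftTmS = Deriv lifttm_rule"

lemma LiftTmS_iff: "(t, c, g) \<in> LiftTmS \<longleftrightarrow> lifttm_rule LiftTmS (t, c, g)"
  unfolding LiftTmS_def by (rule Deriv_unfold) (auto simp: lifttm_rule_def split_def intro!: finitary_intros)

lemma sat_liftTm [simp]:
  "sat (nat_model P) e (liftTm t c g) \<longleftrightarrow> (tv (nat_model P) e t, tv (nat_model P) e c, tv (nat_model P) e g) \<in> LiftTmS"
proof -
  have "sat (nat_model P) (y ## w ## e) LiftTmR \<longleftrightarrow>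
      (\<exists>k. y = pack3 k \<and> lifttm_rule {k. pack3 k \<in> elems w} k)" for y w e
    unfolding LiftTmR_def lifttm_rule_def by (simp add: Let_def funpow_simps)
  from sat_derivable[OF this inj_pack(2)] show ?thesis by (simp add: liftTm_def LiftTmS_def)
qed

definition liftfm_rule :: "(nat \<times> nat \<times> nat) set \<Rightarrow> nat \<times> nat \<times> nat \<Rightarrow> bool" where
  "liftfm_rule W = (\<lambda>(f, c, g). \<exists>a b a' b'.
     f = npair 6 (npair a b) \<and> g = npair 6 (npair a' b') \<and> (a, c, a') \<in> LiftTmS \<and> (b, c, b') \<in> LiftTmS \<or>
     f = npair 7 (npair a b) \<and> g = npair 7 (npair a' b') \<and> (a, c, a') \<in> LiftTmS \<and> (b, c, b') \<in> LiftTmS \<or>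
     f = npair 8 a \<and> g = npair 8 a' \<and> (a, c, a') \<in> W \<or>
     f = npair 9 (npair a b) \<and> g = npair 9 (npair a' b') \<and> (a, c, a') \<in> W \<and> (b, c, b') \<in> W \<or>
     f = npair 10 a \<and> g = npair 10 a' \<and> (a, Suc c, a') \<in> W)"

definition "LiftFmS = Deriv liftfm_rule"

lemma LiftFmS_iff: "(f, c, g) \<in> LiftFmS \<longleftrightarrow> liftfm_rule LiftFmS (f, c, g)"
  unfolding LiftFmS_def by (rule Deriv_unfold) (auto simp: liftfm_rule_def split_def intro!: finitary_intros)

lemma sat_liftFm [simp]:
  "sat (nat_model P) e (liftFm f c g) \<longleftrightarrow> (tv (nat_model P) e f, tv (nat_model P) e c, tv (nat_model P) e g) \<in> LiftFmS"
proof -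
  have "sat (nat_model P) (y ## w ## e) LiftFmR \<longleftrightarrow>
      (\<exists>k. y = pack3 k \<and> liftfm_rule {k. pack3 k \<in> elems w} k)" for y w e
    unfolding LiftFmR_def liftfm_rule_def by (simp add: Let_def funpow_simps)
  from sat_derivable[OF this inj_pack(2)] show ?thesis by (simp add: liftFm_def LiftFmS_def)
qed

definition nconj :: "nat \<Rightarrow> nat \<Rightarrow> nat" where
  "nconj a b = npair 8 (npair 9 (npair (npair 8 a) (npair 8 b)))"

lemma tv_qConj [simp]: "tv (nat_model P) e (qConj a b) =
    nconj (tv (nat_model P) e a) (tv (nat_model P) e b)"
  by (simp add: qConj_def nconj_def)

definition star_rule :: "(nat \<times> nat \<times> nat) set \<Rightarrow> nat \<times> nat \<times> nat \<Rightarrow> bool" where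
  "star_rule W = (\<lambda>(f, n, g). \<exists>a b a' b'.
     f = npair 6 (npair a b) \<and> g = f \<or>
     f = npair 7 (npair a b) \<and> g = f \<or>
     f = npair 8 a \<and> g = npair 8 a' \<and> (a, n, a') \<in> W \<or>
     f = npair 9 (npair a b) \<and> g = npair 9 (npair a' b') \<and> (a, n, a') \<in> W \<and> (b, n, b') \<in> W \<or>
     f = npair 10 a \<and> (a, Suc n, a') \<in> W \<and> (a', Suc n, b') \<in> LiftFmS \<and>
       g = npair 10 (nconj (npair 7 (npair (npair 1 0) (npair 1 (Suc n)))) b'))"

definition "StarS = Deriv star_rule"

lemma StarS_iff: "(f, n, g) \<in> StarS \<longleftrightarrow> star_rule StarS (f, n, g)"
  unfolding StarS_def by (rule Deriv_unfold) (auto simp: star_rule_def split_def intro!: finitary_intros)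

lemma sat_star [simp]:
  "sat (nat_model P) e (star f n g) \<longleftrightarrow> (tv (nat_model P) e f, tv (nat_model P) e n, tv (nat_model P) e g) \<in> StarS"
proof -
  have "sat (nat_model P) (y ## w ## e) StarR \<longleftrightarrow>
      (\<exists>k. y = pack3 k \<and> star_rule {k. pack3 k \<in> elems w} k)" for y w e
    unfolding StarR_def star_rule_def by (simp add: Let_def funpow_simps)
  from sat_derivable[OF this inj_pack(2)] show ?thesis by (simp add: star_def StarS_def)
qed

definition sat0_rule :: "(nat \<times> nat \<times> nat) set \<Rightarrow> nat \<times> nat \<times> nat \<Rightarrow> bool" where
  "sat0_rule W = (\<lambda>(g, e', c). \<exists>s t h p q r.
     g = npair 6 (npair s t) \<and> (s, e', p) \<in> ValS \<and> (t, e', q) \<in> ValS \<and>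
       (c = 1 \<and> p = q \<or> c = 0 \<and> p \<noteq> q) \<or>
     g = npair 7 (npair s t) \<and> (s, e', p) \<in> ValS \<and> (t, e', q) \<in> ValS \<and>
       (c = 1 \<and> p < q \<or> c = 0 \<and> \<not> p < q) \<or>
     g = npair 8 s \<and> (c = 1 \<and> (s, e', 0) \<in> W \<or> c = 0 \<and> (s, e', 1) \<in> W) \<or>
     g = npair 9 (npair s t) \<and> (s, e', p) \<in> W \<and> (t, e', q) \<in> W \<and>
       (c = 1 \<and> (p = 1 \<or> q = 1) \<or> c = 0 \<and> p = 0 \<and> q = 0) \<or>
     g = npair 10 (nconj (npair 7 (npair (npair 1 0) t)) h) \<and> (s, 0, t) \<in> LiftTmS \<and> (s, e', p) \<in> ValS \<and>
       (\<forall>x<p. (h, Suc (npair x e'), 1) \<in> W \<or> (h, Suc (npair x e'), 0) \<in> W) \<and>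
       (c = 1 \<and> r < p \<and> (h, Suc (npair r e'), 1) \<in> W \<or>
        c = 0 \<and> (\<forall>x<p. (h, Suc (npair x e'), 0) \<in> W)))"

definition "Sat0S = Deriv sat0_rule"

lemma Sat0S_iff: "(g, e', c) \<in> Sat0S \<longleftrightarrow> sat0_rule Sat0S (g, e', c)"
  unfolding Sat0S_def by (rule Deriv_unfold) (auto simp: sat0_rule_def split_def intro!: finitary_intros)

lemma sat_sat0 [simp]:
  "sat (nat_model P) e (sat0 g e') \<longleftrightarrow> (tv (nat_model P) e g, tv (nat_model P) e e', 1) \<in> Sat0S"
proof -
  have "sat (nat_model P) (y ## w ## e) Sat0R \<longleftrightarrow>
      (\<exists>k. y = pack3 k \<and> sat0_rule {k. pack3 k \<in> elems w} k)" for y w e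
    unfolding Sat0R_def sat0_rule_def by (simp add: Let_def funpow_simps)
  from sat_derivable[OF this inj_pack(2)] show ?thesis by (simp add: sat0_def Sat0S_def)
qed

section \<open>Uniqueness of truth\<close>

text \<open>
  Codes of formulae that have the same connectives in the same places.  Tarski's quantifier clause
  refers to substitution instances, which are similar to the immediate subformula but not smaller.
\<close>

inductive similar :: "nat \<Rightarrow> nat \<Rightarrow> bool" where
  "similar (npair 6 a) (npair 6 a')"
| "similar (npair 7 a) (npair 7 a')"
| "similar a a' \<Longrightarrow> similar (npair 8 a) (npair 8 a')"
| "similar a a' \<Longrightarrow> similar b b' \<Longrightarrow> similar (npair 9 (npair a b)) (npair 9 (npair a' b'))"
| "similar a a' \<Longrightarrow> similar (npair 10 a) (npair 10 a')"

inductive_cases similar_elims: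
  "similar f (npair 6 a)" "similar f (npair 7 a)" "similar f (npair 8 a)"
  "similar f (npair 9 a)" "similar f (npair 10 a)"
  "similar (npair 6 a) f" "similar (npair 7 a) f" "similar (npair 8 a) f"
  "similar (npair 9 a) f" "similar (npair 10 a) f"

lemma similar_trans: "similar a b \<Longrightarrow> similar b c \<Longrightarrow> similar a c"
  by (induction arbitrary: c rule: similar.induct)
    (auto elim!: similar_elims intro: similar.intros)

lemma npair_greater2 [simp]:
  "0 < k \<Longrightarrow> a < npair k (npair a b)" "0 < k \<Longrightarrow> b < npair k (npair a b)"
  using npair_greater[of k "npair a b"] npair_ge[of a b] npair_ge[of b a] npair_ge(2)[of b a]
  by (auto simp: npair_def)

declare npair_greater [simp]

text \<open>Substitution acts inside terms only, and \<open>similar\<close> ignores everything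
  inside atomic formulae.\<close>

lemma SubFmS_similar: "(f, d, u, g) \<in> SubFmS \<Longrightarrow> similar f g"
proof (induction f arbitrary: d g rule: less_induct)
  case (less f)
  then show ?case
    unfolding SubFmS_iff[of f d u g] subfm_rule_def by (auto intro!: similar.intros)
qed

lemma FmS_similar: "(f, n) \<in> FmS \<Longrightarrow> similar f f"
proof (induction f arbitrary: n rule: less_induct)
  case (less f)
  then show ?case
    unfolding FmS_iff[of f n] fm_rule_def by (auto intro!: similar.intros)
qed

lemma Tarski_clauses:
  assumes "nat_model P \<Turnstile> Tarski_truth"
  shows "\<And>f. P TruthP f \<Longrightarrow> (f, 0) \<in> FmS"
    and "\<And>s t. (s, 0) \<in> TmS \<Longrightarrow> (t, 0) \<in> TmS \<Longrightarrow> P TruthP (npair 6 (npair s t)) \<longleftrightarrow>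
      (\<exists>p q. (s, 0, p) \<in> ValS \<and> (t, 0, q) \<in> ValS \<and> p = q)"
    and "\<And>s t. (s, 0) \<in> TmS \<Longrightarrow> (t, 0) \<in> TmS \<Longrightarrow> P TruthP (npair 7 (npair s t)) \<longleftrightarrow>
      (\<exists>p q. (s, 0, p) \<in> ValS \<and> (t, 0, q) \<in> ValS \<and> p < q)"
    and "\<And>f. (f, 0) \<in> FmS \<Longrightarrow> P TruthP (npair 8 f) \<longleftrightarrow> \<not> P TruthP f"
    and "\<And>f g. (f, 0) \<in> FmS \<Longrightarrow> (g, 0) \<in> FmS \<Longrightarrow>
      P TruthP (npair 9 (npair f g)) \<longleftrightarrow> P TruthP f \<or> P TruthP g"
    and "\<And>f. (f, Suc 0) \<in> FmS \<Longrightarrow> P TruthP (npair 10 f) \<longleftrightarrow>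
      (\<exists>m u g. (m, u) \<in> NumS \<and> (f, 0, u, g) \<in> SubFmS \<and> P TruthP g)"
proof -
  have "sat (nat_model P) (\<lambda>_. 0) Tarski_truth" using assms by (simp add: models_def)
  then have *: "(\<forall>f. P TruthP f \<longrightarrow> (f, 0) \<in> FmS) \<and>
    (\<forall>s t. (s, 0) \<in> TmS \<and> (t, 0) \<in> TmS \<longrightarrow> (P TruthP (npair 6 (npair s t)) \<longleftrightarrow>
      (\<exists>p q. (s, 0, p) \<in> ValS \<and> (t, 0, q) \<in> ValS \<and> p = q))) \<and>
    (\<forall>s t. (s, 0) \<in> TmS \<and> (t, 0) \<in> TmS \<longrightarrow> (P TruthP (npair 7 (npair s t)) \<longleftrightarrow>
      (\<exists>p q. (s, 0, p) \<in> ValS \<and> (t, 0, q) \<in> ValS \<and> p < q))) \<and>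
    (\<forall>f. (f, 0) \<in> FmS \<longrightarrow> (P TruthP (npair 8 f) \<longleftrightarrow> \<not> P TruthP f)) \<and>
    (\<forall>f g. (f, 0) \<in> FmS \<and> (g, 0) \<in> FmS \<longrightarrow>
      (P TruthP (npair 9 (npair f g)) \<longleftrightarrow> P TruthP f \<or> P TruthP g)) \<and>
    (\<forall>f. (f, Suc 0) \<in> FmS \<longrightarrow> (P TruthP (npair 10 f) \<longleftrightarrow>
      (\<exists>m u g. (m, u) \<in> NumS \<and> (f, 0, u, g) \<in> SubFmS \<and> P TruthP g)))"
    unfolding Tarski_truth_def Let_def funpow_simps isSent_def by simp
  note c1 = *[THEN conjunct1, rule_format] and c2 = *[THEN conjunct2, THEN conjunct1, rule_format]
    and c3 = *[THEN conjunct2, THEN conjunct2, THEN conjunct1, rule_format]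
    and c4 = *[THEN conjunct2, THEN conjunct2, THEN conjunct2, THEN conjunct1, rule_format]
    and c5 = *[THEN conjunct2, THEN conjunct2, THEN conjunct2, THEN conjunct2, THEN conjunct1, rule_format]
    and c6 = *[THEN conjunct2, THEN conjunct2, THEN conjunct2, THEN conjunct2, THEN conjunct2, rule_format]
  fix f g s t
  show "P TruthP f \<Longrightarrow> (f, 0) \<in> FmS" by (rule c1)
  show "(s, 0) \<in> TmS \<Longrightarrow> (t, 0) \<in> TmS \<Longrightarrow> P TruthP (npair 6 (npair s t)) \<longleftrightarrow>
      (\<exists>p q. (s, 0, p) \<in> ValS \<and> (t, 0, q) \<in> ValS \<and> p = q)" by (rule c2, rule conjI)
  show "(s, 0) \<in> TmS \<Longrightarrow> (t, 0) \<in> TmS \<Longrightarrow> P TruthP (npair 7 (npair s t)) \<longleftrightarrow>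
      (\<exists>p q. (s, 0, p) \<in> ValS \<and> (t, 0, q) \<in> ValS \<and> p < q)" by (rule c3, rule conjI)
  show "(f, 0) \<in> FmS \<Longrightarrow> P TruthP (npair 8 f) \<longleftrightarrow> \<not> P TruthP f" by (rule c4)
  show "(f, 0) \<in> FmS \<Longrightarrow> (g, 0) \<in> FmS \<Longrightarrow>
      P TruthP (npair 9 (npair f g)) \<longleftrightarrow> P TruthP f \<or> P TruthP g" by (rule c5, rule conjI)
  show "(f, Suc 0) \<in> FmS \<Longrightarrow> P TruthP (npair 10 f) \<longleftrightarrow>
      (\<exists>m u g. (m, u) \<in> NumS \<and> (f, 0, u, g) \<in> SubFmS \<and> P TruthP g)" by (rule c6)
qed

text \<open>On sentences Tarski's clauses leave no freedom, as every number has a numeral with a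
  standard code. Elsewhere both predicates are false by the first clause, so they agree on all
  numbers.\<close>

lemma truth_unique:
  assumes P: "nat_model P \<Turnstile> Tarski_truth" and Q: "nat_model Q \<Turnstile> Tarski_truth"
  shows "P = Q"
proof -
  \<comment> \<open>The induction is on \<open>f\<close>, which merely supplies the pattern of
    connectives; the instances met on the side of \<open>g\<close> may grow.\<close>
  have *: "similar f g \<Longrightarrow> P TruthP g \<longleftrightarrow> Q TruthP g" for f g
  proof (induction f arbitrary: g rule: less_induct)
    case (less f)
    show ?case
    proof (cases "(g, 0) \<in> FmS")
      case False
      then show ?thesis using Tarski_clauses(1)[OF P] Tarski_clauses(1)[OF Q] by blast
    next
      case True
      then obtain a b where
        "g = npair 6 (npair a b) \<and> (a, 0) \<in> TmS \<and> (b, 0) \<in> TmS \<or>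
         g = npair 7 (npair a b) \<and> (a, 0) \<in> TmS \<and> (b, 0) \<in> TmS \<or>
         g = npair 8 a \<and> (a, 0) \<in> FmS \<or>
         g = npair 9 (npair a b) \<and> (a, 0) \<in> FmS \<and> (b, 0) \<in> FmS \<or>
         g = npair 10 a \<and> (a, Suc 0) \<in> FmS"
        unfolding FmS_iff[of g 0] fm_rule_def by auto
      then consider (eq) "g = npair 6 (npair a b)" "(a, 0) \<in> TmS" "(b, 0) \<in> TmS"
        | (less) "g = npair 7 (npair a b)" "(a, 0) \<in> TmS" "(b, 0) \<in> TmS"
        | (neg) "g = npair 8 a" "(a, 0) \<in> FmS"
        | (disj) "g = npair 9 (npair a b)" "(a, 0) \<in> FmS" "(b, 0) \<in> FmS"
        | (exi) "g = npair 10 a" "(a, Suc 0) \<in> FmS" by blast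
      then show ?thesis
      proof cases
        case eq
        then show ?thesis using Tarski_clauses(2)[OF P] Tarski_clauses(2)[OF Q] by simp
      next
        case less
        then show ?thesis using Tarski_clauses(3)[OF P] Tarski_clauses(3)[OF Q] by simp
      next
        case neg
        then obtain a' where "f = npair 8 a'" "similar a' a"
          using less.prems by (auto elim: similar_elims)
        then show ?thesis
          using less.IH[of a' a] neg Tarski_clauses(4)[OF P] Tarski_clauses(4)[OF Q] by simp
      next
        case disj
        then obtain a' b' where "f = npair 9 (npair a' b')" "similar a' a" "similar b' b"
          using less.prems by (auto elim: similar_elims)
        then show ?thesis
          using less.IH[of a' a] less.IH[of b' b] disj Tarski_clauses(5)[OF P] Tarski_clauses(5)[OF Q]
          by simp
      next
        case exi
        then obtain a' where a': "f = npair 10 a'" "similar a' a"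
          using less.prems by (auto elim: similar_elims)
        have "P TruthP h \<longleftrightarrow> Q TruthP h" if "(a, 0, u, h) \<in> SubFmS" for u h
          using less.IH[of a' h] a' similar_trans SubFmS_similar[OF that] by simp
        then show ?thesis
          using exi Tarski_clauses(6)[OF P] Tarski_clauses(6)[OF Q] by metis
      qed
    qed
  qed
  have "P TruthP x \<longleftrightarrow> Q TruthP x" for x
  proof (cases "(x, 0) \<in> FmS")
    case False
    then show ?thesis using Tarski_clauses(1)[OF P] Tarski_clauses(1)[OF Q] by blast
  next
    case True
    then show ?thesis using * FmS_similar by blast
  qed
  then show ?thesis by (intro ext) (metis tsym.exhaust)
qed

section \<open>Bounded transforms and fast growing sets\<close>

primrec lcode :: "nat list \<Rightarrow> nat" where
  "lcode [] = 0"
| "lcode (a # as) = Suc (npair a (lcode as))"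

lemma lcode_inj [simp]: "lcode as = lcode bs \<longleftrightarrow> as = bs"
proof (induction as arbitrary: bs)
  case Nil
  then show ?case by (cases bs) auto
next
  case (Cons a as)
  then show ?case by (cases bs) auto
qed

lemma LenS_lcode: "(e, n) \<in> LenS \<longleftrightarrow> (\<exists>as. e = lcode as \<and> length as = n)"
proof
  show "(e, n) \<in> LenS \<Longrightarrow> \<exists>as. e = lcode as \<and> length as = n"
  proof (induction e arbitrary: n rule: less_induct)
    case (less e)
    have "e = 0 \<and> n = 0 \<or> (\<exists>a r k. e = Suc (npair a r) \<and> n = Suc k \<and> (r, k) \<in> LenS)"
      using less.prems unfolding LenS_iff[of e n] len_rule_def by auto
    then show ?case
    proof
      assume "e = 0 \<and> n = 0"
      then show ?case by (intro exI[of _ "[]"]) simp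
    next
      assume "\<exists>a r k. e = Suc (npair a r) \<and> n = Suc k \<and> (r, k) \<in> LenS"
      then obtain a r k where *: "e = Suc (npair a r)" "n = Suc k" "(r, k) \<in> LenS" by blast
      moreover have "r < e" using * npair_ge(2)[of r a] by simp
      ultimately obtain as where "r = lcode as" "length as = k" using less.IH by blast
      then show ?case using * by (intro exI[of _ "a # as"]) simp
    qed
  qed
next
  assume "\<exists>as. e = lcode as \<and> length as = n"
  moreover have "(lcode as, length as) \<in> LenS" for as
  proof (induction as)
    case Nil
    show ?case unfolding LenS_iff[of "lcode []"] len_rule_def by simp
  next
    case (Cons a as)
    then show ?case unfolding LenS_iff[of "lcode (a # as)"] len_rule_def by simp
  qed
  ultimately show "(e, n) \<in> LenS" by blast
qed

lemma LookupS_lcode: "(lcode as, i, x) \<in> LookupS \<longleftrightarrow> i < length as \<and> as ! i = x"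
proof (induction as arbitrary: i)
  case Nil
  show ?case unfolding LookupS_iff[of "lcode []"] lookup_rule_def by simp
next
  case (Cons a as)
  show ?case unfolding LookupS_iff[of "lcode (a # as)"] lookup_rule_def
    using Cons.IH by (cases i) auto
qed

lemma AppendS_lcode: "(lcode as, lcode bs, h) \<in> AppendS \<longleftrightarrow> h = lcode (as @ bs)"
proof (induction as arbitrary: h)
  case Nil
  show ?case unfolding AppendS_iff[of "lcode []"] append_rule_def by simp
next
  case (Cons a as)
  show ?case unfolding AppendS_iff[of "lcode (a # as)"] append_rule_def
    using Cons.IH by auto
qed

lemma TmS_codet: "(t, n) \<in> TmS \<longleftrightarrow> (\<exists>s. t = codet s \<and> trm_below n s)"
proof
  show "(t, n) \<in> TmS \<Longrightarrow> \<exists>s. t = codet s \<and> trm_below n s"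
  proof (induction t rule: less_induct)
    case (less t)
    from less.prems obtain a b where "t = npair 1 a \<and> a < n \<or> t = npair 2 0 \<or>
     t = npair 3 a \<and> (a, n) \<in> TmS \<or>
     t = npair 4 (npair a b) \<and> (a, n) \<in> TmS \<and> (b, n) \<in> TmS \<or>
     t = npair 5 (npair a b) \<and> (a, n) \<in> TmS \<and> (b, n) \<in> TmS"
      unfolding TmS_iff[of t n] tm_rule_def by auto
    then consider "t = npair 1 a \<and> a < n" | "t = npair 2 0"
      | "t = npair 3 a \<and> (a, n) \<in> TmS"
      | "t = npair 4 (npair a b) \<and> (a, n) \<in> TmS \<and> (b, n) \<in> TmS"
      | "t = npair 5 (npair a b) \<and> (a, n) \<in> TmS \<and> (b, n) \<in> TmS" by blast
    then show ?case
    proof cases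
      case 1
      then show ?thesis by (intro exI[of _ "V a"]) simp
    next
      case 2
      then show ?thesis by (intro exI[of _ "Zero"]) simp
    next
      case 3
      then obtain s where "a = codet s" "trm_below n s" using less.IH[of a] by auto
      then show ?thesis using 3 by (intro exI[of _ "Succ s"]) simp
    next
      case 4
      then obtain s s' where "a = codet s" "trm_below n s" "b = codet s'" "trm_below n s'"
        using less.IH[of a] less.IH[of b] by auto
      then show ?thesis using 4 by (intro exI[of _ "Add s s'"]) simp
    next
      case 5
      then obtain s s' where "a = codet s" "trm_below n s" "b = codet s'" "trm_below n s'"
        using less.IH[of a] less.IH[of b] by auto
      then show ?thesis using 5 by (intro exI[of _ "Mul s s'"]) simp
    qed
  qed
next
  have "trm_below n s \<Longrightarrow> (codet s, n) \<in> TmS" for s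
  proof (induction s)
  qed (subst TmS_iff; simp add: tm_rule_def)+
  then show "\<exists>s. t = codet s \<and> trm_below n s \<Longrightarrow> (t, n) \<in> TmS" by blast
qed

text \<open>All numbers being standard, induction on the code recovers an actual formula. It
  contains no predicate symbol, so its type parameter is arbitrary.\<close>

lemma FmS_code:
  "(f, n) \<in> FmS \<longleftrightarrow> (\<exists>\<phi> :: 'p fm. arithmetical \<phi> \<and> f = code \<phi> \<and> fm_below n \<phi>)"
proof
  show "(f, n) \<in> FmS \<Longrightarrow> \<exists>\<phi> :: 'p fm. arithmetical \<phi> \<and> f = code \<phi> \<and> fm_below n \<phi>"
  proof (induction f arbitrary: n rule: less_induct)
    case (less f)
    from less.prems obtain a b where "f = npair 6 (npair a b) \<and> (a, n) \<in> TmS \<and> (b, n) \<in> TmS \<or>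
     f = npair 7 (npair a b) \<and> (a, n) \<in> TmS \<and> (b, n) \<in> TmS \<or>
     f = npair 8 a \<and> (a, n) \<in> FmS \<or>
     f = npair 9 (npair a b) \<and> (a, n) \<in> FmS \<and> (b, n) \<in> FmS \<or>
     f = npair 10 a \<and> (a, Suc n) \<in> FmS"
      unfolding FmS_iff[of f n] fm_rule_def by auto
    then consider "f = npair 6 (npair a b) \<and> (a, n) \<in> TmS \<and> (b, n) \<in> TmS"
      | "f = npair 7 (npair a b) \<and> (a, n) \<in> TmS \<and> (b, n) \<in> TmS"
      | "f = npair 8 a \<and> (a, n) \<in> FmS"
      | "f = npair 9 (npair a b) \<and> (a, n) \<in> FmS \<and> (b, n) \<in> FmS"
      | "f = npair 10 a \<and> (a, Suc n) \<in> FmS" by blast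
    then show ?case
    proof cases
      case 1
      then obtain s s' where "a = codet s" "trm_below n s" "b = codet s'" "trm_below n s'"
        unfolding TmS_codet by auto
      then show ?thesis using 1 by (intro exI[of _ "Eq s s'"]) simp
    next
      case 2
      then obtain s s' where "a = codet s" "trm_below n s" "b = codet s'" "trm_below n s'"
        unfolding TmS_codet by auto
      then show ?thesis using 2 by (intro exI[of _ "Less s s'"]) simp
    next
      case 3
      then obtain \<phi> :: "'p fm" where "arithmetical \<phi>" "a = code \<phi>" "fm_below n \<phi>"
        using less.IH[of a n] by auto
      then show ?thesis using 3 by (intro exI[of _ "Neg \<phi>"]) simp
    next
      case 4
      then obtain \<phi> \<psi> :: "'p fm" where "arithmetical \<phi>" "a = code \<phi>" "fm_below n \<phi>"
          "arithmetical \<psi>" "b = code \<psi>" "fm_below n \<psi>"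
        using less.IH[of a n] less.IH[of b n] by auto
      then show ?thesis using 4 by (intro exI[of _ "Disj \<phi> \<psi>"]) simp
    next
      case 5
      then obtain \<phi> :: "'p fm" where "arithmetical \<phi>" "a = code \<phi>" "fm_below (Suc n) \<phi>"
        using less.IH[of a "Suc n"] by auto
      then show ?thesis using 5 by (intro exI[of _ "Exi \<phi>"]) simp
    qed
  qed
next
  have "arithmetical \<phi> \<Longrightarrow> fm_below n \<phi> \<Longrightarrow> (code \<phi>, n) \<in> FmS" for \<phi> :: "'p fm"
  proof (induction \<phi> arbitrary: n)
  qed (subst FmS_iff; auto simp add: fm_rule_def TmS_codet)+
  then show "\<exists>\<phi> :: 'p fm. arithmetical \<phi> \<and> f = code \<phi> \<and> fm_below n \<phi> \<Longrightarrow> (f, n) \<in> FmS" by blast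
qed

abbreviation lenv :: "nat list \<Rightarrow> nat \<Rightarrow> nat" where
  "lenv \<equiv> sseq 0"

lemma lenv_Cons: "lenv (x # as) = x ## lenv as"
  by (rule ext) (auto simp: sseq_def scons_def split: nat.split)

text \<open>A variable beyond the end of the list has no value, hence the condition
  \<open>trm_below\<close>. Predicates do not affect terms, so \<open>P\<close> is
  arbitrary.\<close>

lemma ValS_codet: "(codet t, lcode as, v) \<in> ValS \<longleftrightarrow>
    trm_below (length as) t \<and> v = tv (nat_model P) (lenv as) t"
proof (induction t arbitrary: v)
  case (V i)
  then show ?case by (subst ValS_iff) (auto simp: val_rule_def LookupS_lcode sseq_def)
qed (subst ValS_iff; auto simp: val_rule_def)+

section \<open>The bounded transform and its evaluation\<close>

definition lift_var :: "nat \<Rightarrow> nat \<Rightarrow> trm" where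
  "lift_var c i = (if i < c then V i else V (Suc i))"

lemma LiftTmS_codet: "(codet t, c, g) \<in> LiftTmS \<longleftrightarrow> g = codet (subt (lift_var c) t)"
  by (induction t arbitrary: g)
    (subst LiftTmS_iff; auto simp: lifttm_rule_def lift_var_def)+

lemma under_lift_var: "under (lift_var c) = lift_var (Suc c)"
  by (rule ext) (auto simp: under_def lift_var_def lift_def split: nat.split)

lemma LiftFmS_code:
  "arithmetical \<phi> \<Longrightarrow> (code \<phi>, c, g) \<in> LiftFmS \<longleftrightarrow> g = code (subf (lift_var c) \<phi>)"
proof (induction \<phi> arbitrary: c g)
qed (subst LiftFmS_iff; auto simp: liftfm_rule_def LiftTmS_codet under_lift_var)+

primrec starf :: "nat \<Rightarrow> 'p fm \<Rightarrow> 'p fm" where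
  "starf n (Eq a b) = Eq a b"
| "starf n (Less a b) = Less a b"
| "starf n (Pr p a) = Pr p a"
| "starf n (Neg a) = Neg (starf n a)"
| "starf n (Disj a b) = Disj (starf n a) (starf n b)"
| "starf n (Exi a) =
     Exi (Conj (Less (V 0) (V (Suc n))) (subf (lift_var (Suc n)) (starf (Suc n) a)))"

lemma code_Conj [simp]: "code (Conj a b) = nconj (code a) (code b)"
  by (simp add: Conj_def nconj_def)

lemma nconj_inj [simp]: "nconj a b = nconj c d \<longleftrightarrow> a = c \<and> b = d"
  by (simp add: nconj_def)

lemma arithmetical_Conj [simp]: "arithmetical (Conj a b) \<longleftrightarrow> arithmetical a \<and> arithmetical b"
  by (simp add: Conj_def)

lemma arithmetical_subf [simp]: "arithmetical (subf s \<phi>) \<longleftrightarrow> arithmetical \<phi>"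
  by (induction \<phi> arbitrary: s) auto

lemma arithmetical_starf [simp]: "arithmetical (starf n \<phi>) \<longleftrightarrow> arithmetical \<phi>"
  by (induction \<phi> arbitrary: n) auto

lemma StarS_code: "arithmetical \<phi> \<Longrightarrow> (code \<phi>, n, g) \<in> StarS \<longleftrightarrow> g = code (starf n \<phi>)"
proof (induction \<phi> arbitrary: n g)
qed (subst StarS_iff; auto simp: star_rule_def LiftFmS_code)+

text \<open>The shape that \<open>starf\<close> produces: every bound is one of the variables
  \<open>z\<^sub>i\<close>. It lies outside the quantifier as \<open>V m\<close> and is therefore
  seen inside as \<open>V (Suc m)\<close>.\<close>

inductive bounded_fm :: "'p fm \<Rightarrow> bool" where
  "bounded_fm (Eq a b)"
| "bounded_fm (Less a b)"
| "bounded_fm a \<Longrightarrow> bounded_fm (Neg a)"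
| "bounded_fm a \<Longrightarrow> bounded_fm b \<Longrightarrow> bounded_fm (Disj a b)"
| "bounded_fm a \<Longrightarrow> bounded_fm (Exi (Conj (Less (V 0) (V (Suc m))) a))"

lemma subf_Conj [simp]: "subf s (Conj a b) = Conj (subf s a) (subf s b)"
  by (simp add: Conj_def)

lemma bounded_fm_lift: "bounded_fm a \<Longrightarrow> bounded_fm (subf (lift_var c) a)"
proof (induction arbitrary: c rule: bounded_fm.induct)
  case (5 a m)
  have "lift_var (Suc c) 0 = V 0" "lift_var (Suc c) (Suc m) = V (Suc (if m < c then m else Suc m))"
    by (simp_all add: lift_var_def)
  then show ?case using 5 by (simp add: under_lift_var bounded_fm.intros)
qed (auto intro: bounded_fm.intros)

lemma bounded_fm_starf: "arithmetical \<phi> \<Longrightarrow> bounded_fm (starf n \<phi>)"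
  by (induction \<phi> arbitrary: n) (auto intro: bounded_fm.intros bounded_fm_lift)

lemma LiftTmS_var: "(s, 0, npair 1 (Suc m)) \<in> LiftTmS \<longleftrightarrow> s = npair 1 m"
  by (subst LiftTmS_iff) (auto simp: lifttm_rule_def)

text \<open>Both truth values have to be followed, since negation and the false case of a bounded
  quantifier use the value 0; the induction shows existence and uniqueness of the value together. In
  the last case the bound seen in the body is the lifting of \<open>V m\<close> only, so its value
  is \<open>as ! m\<close>.\<close>

lemma Sat0S_code:
  assumes "bounded_fm \<phi>" "fm_below (length as) \<phi>"
  shows "(code \<phi>, lcode as, c) \<in> Sat0S \<longleftrightarrow> c = of_bool (sat (nat_model P) (lenv as) \<phi>)"
  using assms
proof (induction arbitrary: as c rule: bounded_fm.induct)
  case (1 a b)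
  then show ?case
    by (subst Sat0S_iff) (auto simp: sat0_rule_def ValS_codet[where P = P])
next
  case (2 a b)
  then show ?case
    by (subst Sat0S_iff) (auto simp: sat0_rule_def ValS_codet[where P = P])
next
  case (3 a)
  have "fm_below (length as) a" using 3 by simp
  note IH = 3(2)[OF this]
  show ?case
    by (subst Sat0S_iff) (auto simp: sat0_rule_def IH)
next
  case (4 a b)
  have "fm_below (length as) a" "fm_below (length as) b" using 4 by simp_all
  note IH = 4(3)[OF this(1)] 4(4)[OF this(2)]
  show ?case
    by (subst Sat0S_iff) (auto simp: sat0_rule_def IH)
next
  case (5 a m)
  have "fm_below (length (x # as)) a" for x using 5 by simp
  note IH = 5(2)[OF this]
  have m: "m < length as" using 5 by simp
  have val: "(npair 1 m, lcode as, p) \<in> ValS \<longleftrightarrow> p = as ! m" for p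
    using ValS_codet[of "V m" as p P] m by (auto simp: sseq_def)
  have IH': "(code a, Suc (npair x (lcode as)), c) \<in> Sat0S \<longleftrightarrow> c = of_bool (sat (nat_model P) (x ## lenv as) a)" for x c
    using IH[of x c] by (simp add: lenv_Cons)
  have "(code (Exi (Conj (Less (V 0) (V (Suc m))) a)), lcode as, c) \<in> Sat0S \<longleftrightarrow>
     (c = 1 \<and> (\<exists>r<as ! m. sat (nat_model P) (r ## lenv as) a) \<or>
      c = 0 \<and> (\<forall>r<as ! m. \<not> sat (nat_model P) (r ## lenv as) a))"
    by (subst Sat0S_iff) (auto simp: sat0_rule_def IH' LiftTmS_var[simplified] val[simplified])
  also have "\<dots> \<longleftrightarrow> c = of_bool (\<exists>r<as ! m. sat (nat_model P) (r ## lenv as) a)"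
    by auto
  finally have *: "(code (Exi (Conj (Less (V 0) (V (Suc m))) a)), lcode as, c) \<in> Sat0S \<longleftrightarrow>
     c = of_bool (\<exists>r<as ! m. sat (nat_model P) (r ## lenv as) a)" .
  have "sseq 0 as m = as ! m" using m by (simp add: sseq_def)
  then have "sat (nat_model P) (lenv as) (Exi (Conj (Less (V 0) (V (Suc m))) a)) \<longleftrightarrow>
      (\<exists>r<as ! m. sat (nat_model P) (r ## lenv as) a)" by simp
  with * show ?case by simp
qed

lemma trm_below_mono: "trm_below m t \<Longrightarrow> m \<le> n \<Longrightarrow> trm_below n t"
  by (induction t) auto

lemma fm_below_mono: "fm_below m a \<Longrightarrow> m \<le> n \<Longrightarrow> fm_below n a"
proof (induction a arbitrary: m n)
  case (Exi a)
  show ?case using Exi.IH[of "Suc m" "Suc n"] Exi.prems by simp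
next
  case (Disj a b)
  show ?case using Disj.IH(1)[of m n] Disj.IH(2)[of m n] Disj.prems by simp
qed (auto intro: trm_below_mono)

lemma ex_fm_below: "\<exists>n. fm_below n a"
proof (induction a)
  have t: "\<exists>n. \<forall>m\<ge>n. trm_below m t" for t
  proof (induction t)
    case (V i)
    show ?case by (intro exI[of _ "Suc i"]) auto
  next
    case (Add s t)
    then obtain m n where "\<forall>k\<ge>m. trm_below k s" "\<forall>k\<ge>n. trm_below k t" by blast
    then show ?case by (intro exI[of _ "m + n"]) auto
  next
    case (Mul s t)
    then obtain m n where "\<forall>k\<ge>m. trm_below k s" "\<forall>k\<ge>n. trm_below k t" by blast
    then show ?case by (intro exI[of _ "m + n"]) auto
  qed auto
  {
    case (Eq s t)
    obtain m n where "\<forall>k\<ge>m. trm_below k s" "\<forall>k\<ge>n. trm_below k t" using t by blast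
    then show ?case by (intro exI[of _ "m + n"]) auto
  next
    case (Less s t)
    obtain m n where "\<forall>k\<ge>m. trm_below k s" "\<forall>k\<ge>n. trm_below k t" using t by blast
    then show ?case by (intro exI[of _ "m + n"]) auto
  next
    case (Pr p s)
    then show ?case using t by auto
  next
    case (Disj a b)
    then obtain m n where "fm_below m a" "fm_below n b" by blast
    then show ?case using fm_below_mono[of m a "m + n"] fm_below_mono[of n b "m + n"]
      by (intro exI[of _ "m + n"]) auto
  next
    case (Exi a)
    then obtain m where "fm_below m a" by blast
    then show ?case using fm_below_mono[of m a "Suc m"] by (intro exI[of _ m]) auto
  }
qed auto

lemma trm_below_lift_var: "c \<le> m \<Longrightarrow> trm_below (Suc m) (subt (lift_var c) t) \<longleftrightarrow> trm_below m t"
  by (induction t) (auto simp: lift_var_def)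

lemma fm_below_lift: "c \<le> m \<Longrightarrow> fm_below (Suc m) (subf (lift_var c) a) \<longleftrightarrow> fm_below m a"
proof (induction a arbitrary: c m)
  case (Exi a)
  then show ?case by (simp add: under_lift_var)
qed (auto simp: trm_below_lift_var)

text \<open>Makes an existential statement about data below \<open>i\<close> equivalent to the same
  statement with the quantifier bounded by any later element \<open>j\<close>. The parameters form a
  whole assignment with values below \<open>i\<close>.\<close>

definition fast_growing :: "nat set \<Rightarrow> bool" where
  "fast_growing A \<longleftrightarrow> (\<forall>i\<in>A. \<forall>j\<in>A. i < j \<longrightarrow>
     (\<forall>(\<phi> :: isym fm) e y. arithmetical \<phi> \<and> code \<phi> < i \<and> (\<forall>v. e v < i) \<and>
       sat (nat_model (\<lambda>_ _. False)) (y ## e) \<phi> \<longrightarrow> (\<exists>y<j. sat (nat_model (\<lambda>_ _. False)) (y ## e) \<phi>)))"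

text \<open>The predicate is interpreted as empty, which is immaterial as \<open>nsat\<close> is
  applied to arithmetical formulae.\<close>

abbreviation nsat :: "(nat \<Rightarrow> nat) \<Rightarrow> isym fm \<Rightarrow> bool" where
  "nsat \<equiv> sat (nat_model (\<lambda>_ _. False))"

text \<open>Induction on the formula with \<open>i\<close> general. At a quantifier the first
  remaining element \<open>j\<close> bounds the variable; it then replaces \<open>i\<close> for the
  body, whose parameters, the new value included, lie below \<open>j\<close>. Fast growth supplies
  the step from a witness to one below \<open>j\<close>. The last condition guarantees that
  \<open>js\<close> is long enough.\<close>

lemma starf_correct:
  assumes A: "fast_growing A"
  shows "arithmetical \<phi> \<Longrightarrow> i \<in> A \<Longrightarrow> code \<phi> < i \<Longrightarrow> \<forall>x\<in>set as. x < i \<Longrightarrow> fm_below (length as) \<phi> \<Longrightarrow>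
    sorted_wrt (<) (i # js) \<Longrightarrow> set js \<subseteq> A \<Longrightarrow> fm_below (length as + length js) (starf (length as) \<phi>) \<Longrightarrow>
    nsat (lenv (as @ js)) (starf (length as) \<phi>) \<longleftrightarrow> nsat (lenv as) \<phi>"
proof (induction \<phi> arbitrary: i as js)
  case (Eq s t)
  show ?case unfolding starf.simps
    by (rule sat_cong[of "length as"]) (use Eq.prems in \<open>auto simp: sseq_def nth_append\<close>)
next
  case (Less s t)
  show ?case unfolding starf.simps
    by (rule sat_cong[of "length as"]) (use Less.prems in \<open>auto simp: sseq_def nth_append\<close>)
next
  case (Neg a)
  have "code a < npair 8 (code a)" by simp
  then have "code a < i" using Neg.prems(3) by (simp only: code.simps)
  then show ?case using Neg.IH[of i as js] Neg.prems by simp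
next
  case (Disj a b)
  have "code a < npair 9 (npair (code a) (code b))" "code b < npair 9 (npair (code a) (code b))"
    by simp_all
  then have "code a < i" "code b < i" using Disj.prems(3) by (simp_all only: code.simps)
  then show ?case using Disj.IH(1)[of i as js] Disj.IH(2)[of i as js] Disj.prems by simp
next
  case (Exi a)
  let ?n = "length as"
  let ?a = "starf (Suc ?n) a"
  \<comment> \<open>The transform contains its first bound as the variable \<open>?n\<close>, so
    \<open>js\<close> cannot be empty.\<close>
  have "?n < ?n + length js" using Exi.prems(8) by simp
  then obtain j ks where js: "js = j # ks" by (cases js) auto
  have j: "i < j" "j \<in> A" using Exi.prems js by auto
  have "fm_below (Suc (?n + length js)) (subf (lift_var (Suc ?n)) ?a)" using Exi.prems(8) by simp
  then have below: "fm_below (Suc ?n + length ks) ?a"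
    using fm_below_lift[of "Suc ?n" "?n + length js" ?a] js by simp
  have "code a < npair 10 (code a)" by simp
  then have ca: "code a < i" using Exi.prems(3) by (simp only: code.simps)
  \<comment> \<open>Position \<open>Suc ?n\<close> of the assignment holds \<open>j\<close>. The
    lifting jumps over it, so the body reads \<open>y # as\<close> followed by the remaining bounds
    \<open>ks\<close>.\<close>
  have env: "(\<lambda>v. tv (nat_model (\<lambda>_ _. False)) (y ## lenv (as @ js)) (lift_var (Suc ?n) v)) = lenv ((y # as) @ ks)" for y
  proof
    fix v
    show "tv (nat_model (\<lambda>_ _. False)) (y ## lenv (as @ js)) (lift_var (Suc ?n) v) = lenv ((y # as) @ ks) v"
      by (cases v) (auto simp: lift_var_def sseq_def js nth_append nth_Cons' Suc_diff_le)
  qed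
  have "nsat (lenv (as @ js)) (starf ?n (Exi a)) \<longleftrightarrow> (\<exists>y<j. nsat (lenv ((y # as) @ ks)) ?a)"
    by (simp add: sat_subf env del: append_Cons) (auto simp: sseq_def js)
  also have "\<dots> \<longleftrightarrow> (\<exists>y<j. nsat (lenv (y # as)) a)"
  proof -
    have "nsat (lenv ((y # as) @ ks)) ?a \<longleftrightarrow> nsat (lenv (y # as)) a" if "y < j" for y
    proof -
      have "\<forall>x\<in>set (y # as). x < j" using that Exi.prems(4) j(1) by auto
      then show ?thesis using Exi.IH[of j "y # as" ks] Exi.prems j js ca below by simp
    qed
    then show ?thesis by blast
  qed
  also have "\<dots> \<longleftrightarrow> (\<exists>y. nsat (lenv (y # as)) a)"
  proof -
    \<comment> \<open>The default value 0 is covered too, since \<open>code a < i\<close> makes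
      \<open>i\<close> positive.\<close>
    have "\<forall>v. lenv as v < i" using Exi.prems(4) ca by (auto simp: sseq_def)
    then show ?thesis using A Exi.prems(1,2) ca j unfolding fast_growing_def lenv_Cons arithmetical.simps
      by blast
  qed
  also have "\<dots> \<longleftrightarrow> nsat (lenv as) (Exi a)" by (simp add: lenv_Cons)
  finally show ?case .
qed auto

section \<open>Truth of the sentence \<open>alpha\<close>\<close>

abbreviation imodel :: "nat set \<Rightarrow> (nat, isym) struct" where
  "imodel A \<equiv> nat_model (\<lambda>_ x. x \<in> A)"

definition next_elem :: "nat set \<Rightarrow> nat \<Rightarrow> nat \<Rightarrow> bool" where
  "next_elem A j i \<longleftrightarrow> i \<in> A \<and> j < i \<and> (\<forall>x. x \<in> A \<and> j < x \<longrightarrow> \<not> x < i)"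

lemma sat_nextI [simp]:
  "sat (imodel A) e (nextI j i) \<longleftrightarrow> next_elem A (tv (imodel A) e j) (tv (imodel A) e i)"
  by (simp add: nextI_def next_elem_def)

definition chain_rule :: "nat set \<Rightarrow> (nat \<times> nat) set \<Rightarrow> nat \<times> nat \<Rightarrow> bool" where
  "chain_rule A W = (\<lambda>(j, l). \<exists>i r.
     l = 0 \<or> l = Suc (npair i r) \<and> next_elem A j i \<and> (i, r) \<in> W)"

definition "ChainS A = Deriv (chain_rule A)"

lemma ChainS_iff: "(j, l) \<in> ChainS A \<longleftrightarrow> chain_rule A (ChainS A) (j, l)"
  unfolding ChainS_def by (rule Deriv_unfold) (auto simp: chain_rule_def split_def intro!: finitary_intros)

lemma sat_chain [simp]:
  "sat (imodel A) e (chain j l) \<longleftrightarrow> (tv (imodel A) e j, tv (imodel A) e l) \<in> ChainS A"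
proof -
  have "sat (imodel A) (y ## w ## e) ChainR \<longleftrightarrow>
      (\<exists>k. y = pack2 k \<and> chain_rule A {k. pack2 k \<in> elems w} k)" for y w e
    unfolding ChainR_def chain_rule_def by (simp add: Let_def funpow_simps)
  from sat_derivable[OF this inj_pack(1)] show ?thesis by (simp add: chain_def ChainS_def)
qed

lemma ChainS_sorted:
  "(j, lcode is) \<in> ChainS A \<Longrightarrow> sorted_wrt (<) (j # is) \<and> set is \<subseteq> A"
proof (induction "is" arbitrary: j)
  case (Cons i r)
  then have i: "next_elem A j i" "(i, lcode r) \<in> ChainS A"
    unfolding ChainS_iff[of j "lcode (i # r)"] chain_rule_def by auto
  then show ?case using Cons.IH[of i] by (auto simp: next_elem_def)
qed simp

lemma ex_next_elem:
  assumes "infinite A" shows "\<exists>i. next_elem A j i"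
proof -
  have "\<exists>i. i \<in> A \<and> j < i" using assms unfolding infinite_nat_iff_unbounded by blast
  then have *: "(LEAST i. i \<in> A \<and> j < i) \<in> A \<and> j < (LEAST i. i \<in> A \<and> j < i)" by (rule LeastI_ex)
  have "\<not> x < (LEAST i. i \<in> A \<and> j < i)" if "x \<in> A \<and> j < x" for x
    using that not_less_Least[of x "\<lambda>i. i \<in> A \<and> j < i"] by blast
  then have "next_elem A j (LEAST i. i \<in> A \<and> j < i)" using * unfolding next_elem_def by simp
  then show ?thesis ..
qed

lemma ex_chain:
  assumes "infinite A" shows "\<exists>is. length is = k \<and> (j, lcode is) \<in> ChainS A"
proof (induction k arbitrary: j)
  case 0
  show ?case by (intro exI[of _ "[]"]) (simp add: ChainS_iff[of j 0] chain_rule_def)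
next
  case (Suc k)
  obtain i where i: "next_elem A j i" using ex_next_elem[OF assms] by blast
  obtain r where "length r = k" "(i, lcode r) \<in> ChainS A" using Suc.IH by blast
  then show ?case using i
    by (intro exI[of _ "i # r"]) (simp add: ChainS_iff[of j "Suc _"] chain_rule_def)
qed

definition exceeds :: "nat set \<Rightarrow> nat \<Rightarrow> nat \<Rightarrow> nat \<Rightarrow> bool" where
  "exceeds A f a j \<longleftrightarrow> j \<in> A \<and> f < j \<and> (\<forall>i x. (a, i, x) \<in> LookupS \<longrightarrow> x < j)"

lemma sat_exceedsI [simp]:
  "sat (imodel A) e (exceedsI f a j) \<longleftrightarrow>
     exceeds A (tv (imodel A) e f) (tv (imodel A) e a) (tv (imodel A) e j)"
  by (simp add: exceedsI_def exceeds_def funpow_simps)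

definition SigmaS :: "nat set \<Rightarrow> nat \<Rightarrow> nat \<Rightarrow> bool" where
  "SigmaS A f a \<longleftrightarrow> (\<exists>n j g k l e. (a, n) \<in> LenS \<and> (f, n) \<in> FmS \<and>
     exceeds A f a j \<and> (\<forall>x. exceeds A f a x \<longrightarrow> \<not> x < j) \<and>
     (f, n, g) \<in> StarS \<and> (g, n + k) \<in> FmS \<and> (l, k) \<in> LenS \<and> (j, l) \<in> ChainS A \<and>
     (a, l, e) \<in> AppendS \<and> (g, e, 1) \<in> Sat0S)"

lemma sat_sigma [simp]:
  "sat (imodel A) e (sigma f a) \<longleftrightarrow> SigmaS A (tv (imodel A) e f) (tv (imodel A) e a)"
  unfolding sigma_def sat_inst sigmaF_def SigmaS_def
  by (simp add: Let_def funpow_simps)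

lemma codet_inj: "codet s = codet t \<Longrightarrow> s = t"
  by (induction s arbitrary: t; case_tac t; simp)

lemma code_inj:
  "arithmetical \<phi> \<Longrightarrow> arithmetical \<psi> \<Longrightarrow> code \<phi> = code \<psi> \<Longrightarrow> \<phi> = \<psi>"
  by (induction \<phi> arbitrary: \<psi>; case_tac \<psi>; simp add: codet_inj)

lemma FmS_code_iff:
  assumes "arithmetical (\<phi> :: isym fm)"
  shows "(code \<phi>, n) \<in> FmS \<longleftrightarrow> fm_below n \<phi>"
  using FmS_code[of "code \<phi>" n, where ?'p = isym] code_inj assms by metis

text \<open>By \<open>correct\<close> the evaluation gives the same result for every admissible
  choice of \<open>j\<close> and of the chain above it, so the existential form of
  \<open>sigma\<close> causes no ambiguity. That a choice exists follows from \<open>A\<close> being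
  infinite.\<close>

lemma SigmaS_code:
  assumes A: "infinite A" "fast_growing A"
    and \<phi>: "arithmetical (\<phi> :: isym fm)" "fm_below (length as) \<phi>"
  shows "SigmaS A (code \<phi>) (lcode as) \<longleftrightarrow> nsat (lenv as) \<phi>"
proof -
  have correct: "(code (starf (length as) \<phi>), lcode (as @ js), 1) \<in> Sat0S \<longleftrightarrow> nsat (lenv as) \<phi>"
    if j: "exceeds A (code \<phi>) (lcode as) j" and js: "(j, lcode js) \<in> ChainS A"
      and below: "fm_below (length as + length js) (starf (length as) \<phi>)" for j js
  proof -
    have "\<forall>x\<in>set as. x < j" using j by (auto simp: exceeds_def LookupS_lcode in_set_conv_nth)
    then have "nsat (lenv (as @ js)) (starf (length as) \<phi>) \<longleftrightarrow> nsat (lenv as) \<phi>"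
      using starf_correct[OF A(2) \<phi>(1), of j as js] ChainS_sorted[OF js] j \<phi> below
      by (auto simp: exceeds_def)
    moreover have "fm_below (length (as @ js)) (starf (length as) \<phi>)" using below by simp
    note Sat0S_code[OF bounded_fm_starf[OF \<phi>(1)] this, of 1 "\<lambda>_ _. False"]
    ultimately show ?thesis by simp
  qed
  show ?thesis
  proof
    assume "SigmaS A (code \<phi>) (lcode as)"
    then obtain n j g k l e where *: "(lcode as, n) \<in> LenS" "exceeds A (code \<phi>) (lcode as) j"
      "(code \<phi>, n, g) \<in> StarS" "(g, n + k) \<in> FmS" "(l, k) \<in> LenS" "(j, l) \<in> ChainS A"
      "(lcode as, l, e) \<in> AppendS" "(g, e, 1) \<in> Sat0S"
      unfolding SigmaS_def by blast
    then obtain js where js: "l = lcode js" "length js = k" by (auto simp: LenS_lcode)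
    have n: "n = length as" using *(1) by (auto simp: LenS_lcode)
    have g: "g = code (starf (length as) \<phi>)" using *(3) n \<phi> by (simp add: StarS_code)
    have e: "e = lcode (as @ js)" using *(7) js by (simp add: AppendS_lcode)
    have "fm_below (length as + length js) (starf (length as) \<phi>)"
      using *(4) n g js \<phi> by (simp add: FmS_code_iff)
    then show "nsat (lenv as) \<phi>" using correct[of j js] * js g e by simp
  next
    assume sat: "nsat (lenv as) \<phi>"
    obtain m where m: "m \<in> A" "code \<phi> + sum_list as < m"
      using A(1) unfolding infinite_nat_iff_unbounded by blast
    have "x < m" if "x \<in> set as" for x using member_le_sum_list[OF that] m by simp
    then have "exceeds A (code \<phi>) (lcode as) m" using m by (auto simp: exceeds_def LookupS_lcode)
    then obtain j where j: "exceeds A (code \<phi>) (lcode as) j"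
      "\<forall>x. exceeds A (code \<phi>) (lcode as) x \<longrightarrow> \<not> x < j"
      using exists_least_iff[of "exceeds A (code \<phi>) (lcode as)"] by blast
    \<comment> \<open>The chain may be longer than the number of new variables; \<open>sigma\<close>
      only requires the variables of the transform to lie below
      \<open>length as + k\<close>.\<close>
    obtain k where "fm_below k (starf (length as) \<phi>)" using ex_fm_below by blast
    then have k: "fm_below (length as + k) (starf (length as) \<phi>)" by (rule fm_below_mono) simp
    obtain js where js: "length js = k" "(j, lcode js) \<in> ChainS A" using ex_chain[OF A(1)] by blast
    have "(code (starf (length as) \<phi>), lcode (as @ js), 1) \<in> Sat0S"
      using correct[OF j(1) js(2)] k js(1) sat by simp
    moreover have "(lcode as, length as) \<in> LenS" "(lcode js, k) \<in> LenS"
      using js(1) by (auto simp: LenS_lcode)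
    moreover have "(code \<phi>, length as) \<in> FmS"
      "(code (starf (length as) \<phi>), length as + k) \<in> FmS"
      using \<phi> k by (simp_all add: FmS_code_iff)
    moreover have "(code \<phi>, length as, code (starf (length as) \<phi>)) \<in> StarS"
      using \<phi> by (simp add: StarS_code)
    moreover have "(lcode as, lcode js, lcode (as @ js)) \<in> AppendS" by (simp add: AppendS_lcode)
    ultimately show "SigmaS A (code \<phi>) (lcode as)"
      unfolding SigmaS_def using j js(2) by blast
  qed
qed

text \<open>In \<nat> the formulae and lists quantified in \<open>alpha\<close> are genuine ones,
  and by \<open>SigmaS_code\<close> the clauses become the recursion for satisfaction
  itself.\<close>

lemma alpha_true:
  assumes A: "infinite A" "fast_growing A"
  shows "imodel A \<Turnstile> alpha"
proof -
  note code = SigmaS_code[OF A]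
  have 1: "SigmaS A (npair 6 (npair s t)) a \<longleftrightarrow> (\<exists>p q. (s, a, p) \<in> ValS \<and> (t, a, q) \<in> ValS \<and> p = q)"
    if h: "(a, n) \<in> LenS" "(s, n) \<in> TmS" "(t, n) \<in> TmS" for s t a n
  proof -
    obtain as where a: "a = lcode as" "length as = n" using h by (auto simp: LenS_lcode)
    obtain s' t' where s: "s = codet s'" "trm_below n s'" "t = codet t'" "trm_below n t'"
      using h by (auto simp: TmS_codet)
    show ?thesis using code[of "Eq s' t'" as] a s by (auto simp: ValS_codet[where P = "\<lambda>(_ :: isym) _. False"])
  qed
  have 2: "SigmaS A (npair 7 (npair s t)) a \<longleftrightarrow> (\<exists>p q. (s, a, p) \<in> ValS \<and> (t, a, q) \<in> ValS \<and> p < q)"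
    if h: "(a, n) \<in> LenS" "(s, n) \<in> TmS" "(t, n) \<in> TmS" for s t a n
  proof -
    obtain as where a: "a = lcode as" "length as = n" using h by (auto simp: LenS_lcode)
    obtain s' t' where s: "s = codet s'" "trm_below n s'" "t = codet t'" "trm_below n t'"
      using h by (auto simp: TmS_codet)
    show ?thesis using code[of "Less s' t'" as] a s by (auto simp: ValS_codet[where P = "\<lambda>(_ :: isym) _. False"])
  qed
  have 3: "SigmaS A (npair 8 f) a \<longleftrightarrow> \<not> SigmaS A f a"
    if h: "(a, n) \<in> LenS" "(f, n) \<in> FmS" for f a n
  proof -
    obtain as where a: "a = lcode as" "length as = n" using h by (auto simp: LenS_lcode)
    obtain \<phi> :: "isym fm" where f: "f = code \<phi>" "arithmetical \<phi>" "fm_below n \<phi>"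
      using h FmS_code[where ?'p = isym] by blast
    show ?thesis using code[of "Neg \<phi>" as] code[of \<phi> as] a f by simp
  qed
  have 4: "SigmaS A (npair 9 (npair f g)) a \<longleftrightarrow> SigmaS A f a \<or> SigmaS A g a"
    if h: "(a, n) \<in> LenS" "(f, n) \<in> FmS" "(g, n) \<in> FmS" for f g a n
  proof -
    obtain as where a: "a = lcode as" "length as = n" using h by (auto simp: LenS_lcode)
    obtain \<phi> \<psi> :: "isym fm" where f: "f = code \<phi>" "arithmetical \<phi>" "fm_below n \<phi>"
        "g = code \<psi>" "arithmetical \<psi>" "fm_below n \<psi>"
      using h FmS_code[where ?'p = isym] by blast
    show ?thesis using code[of "Disj \<phi> \<psi>" as] code[of \<phi> as] code[of \<psi> as] a f by simp
  qed
  have 5: "SigmaS A (npair 10 f) a \<longleftrightarrow> (\<exists>x. SigmaS A f (Suc (npair x a)))"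
    if h: "(a, n) \<in> LenS" "(f, Suc n) \<in> FmS" for f a n
  proof -
    obtain as where a: "a = lcode as" "length as = n" using h by (auto simp: LenS_lcode)
    obtain \<phi> :: "isym fm" where f: "f = code \<phi>" "arithmetical \<phi>" "fm_below (Suc n) \<phi>"
      using h FmS_code[where ?'p = isym] by blast
    have "SigmaS A f (Suc (npair x a)) \<longleftrightarrow> nsat (x ## lenv as) \<phi>" for x
      using code[of \<phi> "x # as"] a f by (simp add: lenv_Cons)
    then show ?thesis using code[of "Exi \<phi>" as] a f by simp
  qed
  show ?thesis
    unfolding models_def alpha_def Let_def funpow_simps using 1 2 3 4 5 by auto (intro exI conjI; assumption)
qed

section \<open>Indiscernibles in the standard model\<close>

lemma sat_arithmetical:
  "arithmetical \<phi> \<Longrightarrow> sat (nat_model P) e \<phi> \<longleftrightarrow> sat (nat_model Q) e \<phi>"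
proof (induction \<phi> arbitrary: e)
  have t: "tv (nat_model P) e t = tv (nat_model Q) e t" for e t by (induction t) auto
  {
    case (Eq s t)
    then show ?case by (simp add: t)
  next
    case (Less s t)
    then show ?case by (simp add: t)
  }
qed auto

lemma PA_true:
  assumes "a \<in> PA" shows "nat_model P \<Turnstile> a"
proof (cases "a \<in> basic_axioms")
  case True
  then show ?thesis by (auto simp: models_def basic_axioms_def)
next
  case False
  then obtain n \<phi> where a: "a = Alls n (induction_for \<phi>)" using assms by (auto simp: PA_def)
  have "sat (nat_model P) e (induction_for \<phi>)" for e
  proof -
    have "(\<lambda>i. tv (nat_model P) (x ## e) (case i of 0 \<Rightarrow> Succ (V 0) | Suc j \<Rightarrow> V (Suc j))) = Suc x ## e" for x
      by (rule ext) (simp split: nat.split)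
    then have "sat (nat_model P) e (induction_for \<phi>) \<longleftrightarrow> (sat (nat_model P) (0 ## e) \<phi> \<longrightarrow>
      (\<forall>x. sat (nat_model P) (x ## e) \<phi> \<longrightarrow> sat (nat_model P) (Suc x ## e) \<phi>) \<longrightarrow>
      (\<forall>x. sat (nat_model P) (x ## e) \<phi>))"
      by (simp add: induction_for_def sat_sub0 sat_subf)
    then show ?thesis using nat_induct[of "\<lambda>x. sat (nat_model P) (x ## e) \<phi>"] by blast
  qed
  then show ?thesis unfolding a models_Alls by (simp add: models_def)
qed

section \<open>Homogeneous sets\<close>

definition homogeneous :: "nat set \<Rightarrow> nat \<Rightarrow> isym fm \<Rightarrow> bool" where
  "homogeneous A n \<phi> \<longleftrightarrow> (\<forall>xs ys. length xs = n \<and> length ys = n \<and> set xs \<subseteq> A \<and> set ys \<subseteq> A \<and>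
     sorted_wrt (<) xs \<and> sorted_wrt (<) ys \<longrightarrow> (nsat (lenv xs) \<phi> \<longleftrightarrow> nsat (lenv ys) \<phi>))"

lemma homogeneous_subset: "homogeneous A n \<phi> \<Longrightarrow> B \<subseteq> A \<Longrightarrow> homogeneous B n \<phi>"
  unfolding homogeneous_def using subset_trans by metis

lemma fast_growing_subset: "fast_growing A \<Longrightarrow> B \<subseteq> A \<Longrightarrow> fast_growing B"
  unfolding fast_growing_def by (meson subsetD)

lemma unbounded_I_true: "infinite A \<Longrightarrow> imodel A \<Turnstile> unbounded_I"
  unfolding infinite_nat_iff_unbounded by (simp add: models_def unbounded_I_def)

lemma indiscernible_true:
  assumes hom: "homogeneous A n \<phi>" and \<phi>: "arithmetical \<phi>" "fm_below n \<phi>"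
  shows "imodel A \<Turnstile> indiscernible n \<phi>"
  unfolding indiscernible_def Let_def models_Alls
proof -
  let ?xs = "map (\<lambda>i. V (n + i)) [0..<n]" and ?ys = "map V [0..<n]"
  have asc: "sat (imodel A) e (ascending ts) \<longleftrightarrow> sorted_wrt (<) (map (tv (imodel A) e) ts)" for e ts
    unfolding ascending_def sorted_wrt_iff_nth_Suc_transp[OF transp_on_less] by auto
  have inst: "sat (imodel A) e (\<phi> \<bullet> ts) \<longleftrightarrow> nsat (lenv (map (tv (imodel A) e) ts)) \<phi>"
    if "length ts = n" for e ts
    unfolding sat_inst_satl[OF \<phi>(2) that] satl_def nat_model_simps by (rule sat_arithmetical[OF \<phi>(1)])
  show "imodel A \<Turnstile> Imp (conjs (map I ?xs @ map I ?ys @ [ascending ?xs, ascending ?ys,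
      Less (num (code \<phi>)) (hd ?xs), Less (num (code \<phi>)) (hd ?ys)])) (Iff (\<phi> \<bullet> ?xs) (\<phi> \<bullet> ?ys))"
    unfolding models_def sat_defs
  proof (intro allI impI)
    fix e
    assume *: "sat (imodel A) e (conjs (map I ?xs @ map I ?ys @ [ascending ?xs, ascending ?ys,
      Less (num (code \<phi>)) (hd ?xs), Less (num (code \<phi>)) (hd ?ys)]))"
    let ?x = "map (tv (imodel A) e) ?xs" and ?y = "map (tv (imodel A) e) ?ys"
    have "sorted_wrt (<) ?x" "sorted_wrt (<) ?y" using * by (auto simp: asc)
    moreover have "sat (imodel A) e (I (?xs ! k))" "sat (imodel A) e (I (?ys ! k))" if "k < n" for k
      using * that unfolding sat_conjs by (auto simp del: sat.simps)
    then have "set ?x \<subseteq> A" "set ?y \<subseteq> A" by auto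
    ultimately have "nsat (lenv ?x) \<phi> \<longleftrightarrow> nsat (lenv ?y) \<phi>"
      using hom unfolding homogeneous_def by simp
    then show "sat (imodel A) e (\<phi> \<bullet> ?xs) \<longleftrightarrow> sat (imodel A) e (\<phi> \<bullet> ?ys)"
      by (simp only: inst length_map length_upt minus_nat.diff_0)
  qed
qed

text \<open>Ramsey's theorem is applied once for each formula, inside the infinite set found so far;
  passing to a subset preserves what was achieved before.\<close>

lemma ex_homogeneous:
  assumes "finite H"
  shows "\<exists>A. infinite A \<and> (\<forall>(n, \<phi>)\<in>H. homogeneous A n \<phi>)"
  using assms
proof (induction rule: finite_induct)
  case empty
  then show ?case by (intro exI[of _ UNIV]) simp
next
  case (insert h H)
  then obtain A where A: "infinite A" "\<forall>(n, \<phi>)\<in>H. homogeneous A n \<phi>" by blast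
  obtain n \<phi> where h: "h = (n, \<phi>)" by (cases h)
  \<comment> \<open>A finite set is coloured by the truth value of the formula at its increasing
    enumeration, which gives two colours on the sets of size \<open>n\<close>.\<close>
  define f where "f X = (of_bool (nsat (lenv (sorted_list_of_set X)) \<phi>) :: nat)" for X
  have "\<exists>Y t. Y \<subseteq> A \<and> infinite Y \<and> t < 2 \<and> (\<forall>X. X \<subseteq> Y \<and> finite X \<and> card X = n \<longrightarrow> f X = t)"
    by (rule Ramsey) (use A in \<open>auto simp: f_def\<close>)
  then obtain Y t where Y: "Y \<subseteq> A" "infinite Y" "\<forall>X. X \<subseteq> Y \<and> finite X \<and> card X = n \<longrightarrow> f X = t"
    by blast
  have f: "f (set xs) = of_bool (nsat (lenv xs) \<phi>)" if "sorted_wrt (<) xs" for xs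
  proof -
    have "sorted_list_of_set (set xs) = xs"
      using that by (simp add: sorted_list_of_set.idem_if_sorted_distinct strict_sorted_iff)
    then show ?thesis by (simp add: f_def)
  qed
  have t: "of_bool (nsat (lenv xs) \<phi>) = t" if "length xs = n" "set xs \<subseteq> Y" "sorted_wrt (<) xs" for xs
  proof -
    have "card (set xs) = n" using that by (simp add: distinct_card strict_sorted_iff)
    then show ?thesis using Y(3) that f[of xs] by auto
  qed
  have "homogeneous Y n \<phi>"
    unfolding homogeneous_def
  proof (intro allI impI)
    fix xs ys assume "length xs = n \<and> length ys = n \<and> set xs \<subseteq> Y \<and> set ys \<subseteq> Y \<and>
      sorted_wrt (<) xs \<and> sorted_wrt (<) ys"
    then have "(of_bool (nsat (lenv xs) \<phi>) :: nat) = of_bool (nsat (lenv ys) \<phi>)"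
      using t[of xs] t[of ys] by simp
    then show "nsat (lenv xs) \<phi> \<longleftrightarrow> nsat (lenv ys) \<phi>" by (simp only: of_bool_eq_iff)
  qed
  moreover have "homogeneous Y m \<psi>" if "(m, \<psi>) \<in> H" for m \<psi>
    using A(2) that homogeneous_subset[OF _ Y(1)] by blast
  ultimately show ?case using Y(2) h by (intro exI[of _ Y]) auto
qed

section \<open>Bounds for witnesses\<close>

lemma trm_below_codet: "trm_below (codet t) t"
proof (induction t)
  case (V i)
  then show ?case using npair_greater[of 1 i] by simp
next
  case (Succ t)
  then show ?case using trm_below_mono[OF Succ, of "npair 3 (codet t)"] by (simp add: less_imp_le)
next
  case (Add s t)
  then show ?case
    using trm_below_mono[of "codet s" s "codet (Add s t)"] trm_below_mono[of "codet t" t "codet (Add s t)"]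
    by (simp add: less_imp_le)
next
  case (Mul s t)
  then show ?case
    using trm_below_mono[of "codet s" s "codet (Mul s t)"] trm_below_mono[of "codet t" t "codet (Mul s t)"]
    by (simp add: less_imp_le)
qed simp

text \<open>Pairing never decreases its arguments, so a code exceeds the indices of the variables.
  Hence a bound on the code limits the part of an assignment that matters.\<close>

lemma fm_below_code: "arithmetical \<phi> \<Longrightarrow> fm_below (code \<phi>) \<phi>"
proof (induction \<phi>)
  case (Eq s t)
  then show ?case
    using trm_below_mono[OF trm_below_codet, of s "code (Eq s t)"]
      trm_below_mono[OF trm_below_codet, of t "code (Eq s t)"]
    by (simp add: less_imp_le)
next
  case (Less s t)
  then show ?case
    using trm_below_mono[OF trm_below_codet, of s "code (Less s t)"]
      trm_below_mono[OF trm_below_codet, of t "code (Less s t)"]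
    by (simp add: less_imp_le)
next
  case (Neg a)
  then show ?case using fm_below_mono[of "code a" a "npair 8 (code a)"] by (simp add: less_imp_le)
next
  case (Disj a b)
  then show ?case
    using fm_below_mono[of "code a" a "npair 9 (npair (code a) (code b))"]
      fm_below_mono[of "code b" b "npair 9 (npair (code a) (code b))"]
    by (simp add: less_imp_le)
next
  case (Exi a)
  then show ?case using fm_below_mono[of "code a" a "Suc (npair 10 (code a))"]
    by (simp add: less_imp_le le_SucI)
qed simp

text \<open>Finitely many formulae have a code below \<open>i\<close>, and each depends on fewer
  than \<open>i\<close> values of the assignment, all below \<open>i\<close>. This leaves finitely
  many least witnesses to be bounded.\<close>

lemma witness_bound:
  "\<exists>b. \<forall>(\<phi> :: isym fm) e y. arithmetical \<phi> \<and> code \<phi> < i \<and> (\<forall>v. e v < i) \<and> nsat (y ## e) \<phi> \<longrightarrow>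
     (\<exists>y<b. nsat (y ## e) \<phi>)"
proof -
  define F where "F = {\<phi> :: isym fm. arithmetical \<phi> \<and> code \<phi> < i}"
  define L where "L = {as. set as \<subseteq> {..<i} \<and> length as = i}"
  define w where "w = (\<lambda>(\<phi>, as). LEAST y. nsat (y ## lenv as) \<phi>)"
  have "inj_on code F" unfolding F_def inj_on_def using code_inj by blast
  moreover have "code ` F \<subseteq> {..<i}" by (auto simp: F_def)
  ultimately have "finite F" using finite_imageD finite_subset by blast
  moreover have "finite L" unfolding L_def by (rule finite_lists_length_eq) simp
  ultimately have "finite (w ` (F \<times> L))" by simp
  then obtain b where b: "\<And>\<phi> as. \<phi> \<in> F \<Longrightarrow> as \<in> L \<Longrightarrow> w (\<phi>, as) < b"
    unfolding finite_nat_set_iff_bounded by blast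
  have "\<exists>y<b. nsat (y ## e) \<phi>"
    if \<phi>: "arithmetical \<phi>" "code \<phi> < i" and e: "\<forall>v. e v < i" and y: "nsat (y ## e) \<phi>"
    for \<phi> :: "isym fm" and e y
  proof -
    \<comment> \<open>A list of length \<open>i\<close> suffices, as the free variables of the
      formula lie below its code.\<close>
    let ?as = "map e [0..<i]"
    have eq: "nsat (z ## e) \<phi> \<longleftrightarrow> nsat (z ## lenv ?as) \<phi>" for z
    proof (rule sat_cong[OF fm_below_code[OF \<phi>(1)]])
      show "(z ## e) v = (z ## lenv ?as) v" if "v < code \<phi>" for v
        using that \<phi>(2) by (cases v) (auto simp: sseq_def)
    qed
    have "nsat (w (\<phi>, ?as) ## lenv ?as) \<phi>"
      unfolding w_def prod.case by (rule LeastI[of _ y]) (use y eq in blast)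
    moreover have "w (\<phi>, ?as) < b" using \<phi> e by (intro b) (auto simp: F_def L_def)
    ultimately show ?thesis using eq by blast
  qed
  then show ?thesis by blast
qed

text \<open>Thinning out: each element is chosen beyond the witness bound of its predecessor. The
  sequence increases, so later elements exceed that bound as well.\<close>

lemma ex_fast_growing:
  assumes "infinite A" shows "\<exists>B\<subseteq>A. infinite B \<and> fast_growing B"
proof -
  obtain g where g: "\<And>i (\<phi> :: isym fm) e y. arithmetical \<phi> \<Longrightarrow> code \<phi> < i \<Longrightarrow> \<forall>v. e v < i \<Longrightarrow>
      nsat (y ## e) \<phi> \<Longrightarrow> \<exists>y<g i. nsat (y ## e) \<phi>"
    using witness_bound by metis
  \<comment> \<open>Adding \<open>x\<close> and \<open>g x\<close> secures growth and the witness
    bound in one inequality.\<close>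
  have next': "\<exists>y. y \<in> A \<and> x + g x < y" for x
    using assms unfolding infinite_nat_iff_unbounded by blast
  have "\<exists>s. \<forall>n. s n \<in> A \<and> s n + g (s n) < s (Suc n)"
  proof (rule dependent_nat_choice)
    show "\<exists>x. x \<in> A" using next' by blast
    show "\<exists>y. y \<in> A \<and> x + g x < y" for x using next' .
  qed
  then obtain s where s: "\<And>n. s n \<in> A" "\<And>n. s n + g (s n) < s (Suc n)" by blast
  have mono: "strict_mono s"
    unfolding strict_mono_Suc_iff using s(2) by (meson add_lessD1)
  have "fast_growing (range s)"
    unfolding fast_growing_def
  proof (intro ballI allI impI)
    fix i j e y and \<phi> :: "isym fm"
    assume ij: "i \<in> range s" "j \<in> range s" "i < j"
      and \<phi>: "arithmetical \<phi> \<and> code \<phi> < i \<and> (\<forall>v. e v < i) \<and> nsat (y ## e) \<phi>"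
    then obtain m n where mn: "i = s m" "j = s n" by blast
    then have "Suc m \<le> n" using ij(3) mono by (metis Suc_leI strict_mono_less)
    then have "s (Suc m) \<le> s n" using mono by (simp add: strict_mono_less_eq)
    then have "g i \<le> j" using s(2)[of m] mn by simp
    then show "\<exists>y<j. nsat (y ## e) \<phi>" using g[of \<phi> i e y] \<phi> by (meson less_le_trans)
  qed
  moreover have "infinite (range s)" using mono by (simp add: range_inj_infinite strict_mono_imp_inj_on)
  ultimately show ?thesis using s(1) by (intro exI[of _ "range s"]) auto
qed

text \<open>Everything required of \<open>A\<close> is inherited by infinite subsets, so removing a
  single element gives the second model.\<close>

lemma two_models:
  assumes "finite G" "G \<subseteq> PAI0 \<union> {alpha}"
  shows "\<exists>A B. A \<noteq> B \<and> (\<forall>a\<in>G. imodel A \<Turnstile> a) \<and> (\<forall>a\<in>G. imodel B \<Turnstile> a)"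
proof -
  let ?P = "\<lambda>(n, \<phi> :: isym fm). 1 \<le> n \<and> arithmetical \<phi> \<and> fm_below n \<phi>"
  have "\<forall>a\<in>G. \<exists>h. a \<in> PA \<union> {unbounded_I, alpha} \<or> ?P h \<and> a = indiscernible (fst h) (snd h)"
    using assms(2) unfolding PAI0_def by fastforce
  from bchoice[OF this] obtain h where h: "\<forall>a\<in>G. a \<in> PA \<union> {unbounded_I, alpha} \<or>
      ?P (h a) \<and> a = indiscernible (fst (h a)) (snd (h a))" ..
  \<comment> \<open>For sentences that are no instance of indiscernibility \<open>h\<close> is
    arbitrary. The extra pairs do no harm, since Ramsey's theorem applies to any formula.\<close>
  have "finite (h ` G)" using assms(1) by simp
  from ex_homogeneous[OF this] obtain A0 where A0: "infinite A0" "\<forall>(n, \<phi>)\<in>h ` G. homogeneous A0 n \<phi>"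
    by blast
  obtain A where A: "A \<subseteq> A0" "infinite A" "fast_growing A" using ex_fast_growing[OF A0(1)] by blast
  have ok: "imodel B \<Turnstile> a" if B: "B \<subseteq> A" "infinite B" and a: "a \<in> G" for B a
    using h[rule_format, OF a]
  proof
    assume "a \<in> PA \<union> {unbounded_I, alpha}"
    then show ?thesis
      using PA_true unbounded_I_true[OF B(2)] alpha_true[OF B(2) fast_growing_subset[OF A(3) B(1)]]
      by blast
  next
    assume *: "?P (h a) \<and> a = indiscernible (fst (h a)) (snd (h a))"
    have "homogeneous A0 (fst (h a)) (snd (h a))" using A0(2) a by (auto simp: split_def)
    then have "homogeneous B (fst (h a)) (snd (h a))" using homogeneous_subset A(1) B(1) by (meson subset_trans)
    then show ?thesis using indiscernible_true[of B "fst (h a)" "snd (h a)"] * by (auto simp: split_def)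
  qed
  obtain x where "x \<in> A" using A(2) by (metis ex_in_conv finite.emptyI)
  then have "A \<noteq> A - {x}" by blast
  moreover have "imodel A \<Turnstile> a" if "a \<in> G" for a by (rule ok[OF subset_refl A(2) that])
  moreover have "imodel (A - {x}) \<Turnstile> a" if "a \<in> G" for a
    by (rule ok[OF _ _ that]) (use A(2) in auto)
  ultimately show ?thesis by (intro exI[of _ A] exI[of _ "A - {x}"]) simp
qed

section \<open>Rigidity\<close>

lemma fm_below_conjs [simp]: "fm_below n (conjs as) \<longleftrightarrow> (\<forall>a\<in>set as. fm_below n a)"
  unfolding conjs_def by (induction as) auto

context
  fixes K :: "('q, 'p) translation"
  assumes dom_below: "fm_below 1 (domain K)" and rel_below: "\<And>s. fm_below (arity s) (rel K s)"
begin

lemma fm_below_ExD: "fm_below n (ExD K a) \<longleftrightarrow> fm_below (Suc n) a"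
  using fm_below_inst[OF dom_below, of "[V 0]" "Suc n"] by (simp add: ExD_def)

lemma fm_below_rel: "length ts = arity s \<Longrightarrow> \<forall>t\<in>set ts. trm_below n t \<Longrightarrow> fm_below n (rel K s \<bullet> ts)"
  using fm_below_inst[OF rel_below, of s ts n] by simp

lemma fm_below_graph: "trm_below m t \<Longrightarrow> m + k \<le> n \<Longrightarrow> y < n \<Longrightarrow> fm_below n (graph K k t y)"
proof (induction t arbitrary: k n y)
  case (Succ t)
  then show ?case by (simp add: fm_below_ExD fm_below_rel)
next
  case (Add s t)
  then show ?case by (simp add: fm_below_ExD fm_below_rel)
next
  case (Mul s t)
  then show ?case by (simp add: fm_below_ExD fm_below_rel)
qed (auto simp: fm_below_rel)

lemma fm_below_translate: "fm_below n a \<Longrightarrow> fm_below n (translate K a)"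
  by (induction a arbitrary: n)
    (auto simp: fm_below_ExD fm_below_rel intro: fm_below_graph)

end

text \<open>A copy along an injection of the domain. It moves the classes of an interpretation,
  which are sets of numbers, to the numbers themselves, so that the copy has the full domain that
  \<open>pa_model\<close> expects.\<close>

definition transport :: "('a \<Rightarrow> 'b) \<Rightarrow> ('a, 'p) struct \<Rightarrow> ('b, 'p) struct" where
  "transport g M = (let i = inv_into (dom M) g in
     \<lparr>dom = g ` dom M, zr = g (zr M), sc = (\<lambda>x. g (sc M (i x))),
      ad = (\<lambda>x y. g (ad M (i x) (i y))), mu = (\<lambda>x y. g (mu M (i x) (i y))),
      ls = (\<lambda>x y. ls M (i x) (i y)), pd = (\<lambda>p x. pd M p (i x))\<rparr>)"

lemma satl_isomorphic:
  assumes "isomorphic_by h M N" "set xs \<subseteq> dom M"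
  shows "satl M xs a \<longleftrightarrow> satl N (map h xs) a"
proof -
  have "zr M \<in> dom M" "h (zr M) = zr N" using assms(1) by (simp_all add: isomorphic_by_def)
  then have r: "range (sseq (zr M) xs) \<subseteq> dom M" and
    e: "(\<lambda>i. h (sseq (zr M) xs i)) = sseq (zr N) (map h xs)"
    using assms(2) by (auto simp: sseq_def)
  show ?thesis unfolding satl_def sat_isomorphic[OF assms(1) r] e ..
qed

context interpreted_model
begin

lemma isomorphic_transport: "inj_on g (dom N) \<Longrightarrow> isomorphic_by g N (transport g N)"
  unfolding isomorphic_by_def transport_def Let_def
  by (auto simp: closed_N bij_betw_def)

lemma satl_translate:
  assumes a: "fm_below n a" and xs: "length xs = n" "set xs \<subseteq> D"
  shows "satl A xs (translate K a) \<longleftrightarrow> satl N (map cl xs) a"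
proof -
  \<comment> \<open>The default of \<open>satl\<close> is the zero of \<open>A\<close>, which may
    lie outside \<open>D\<close>, whereas \<open>sat_translate\<close> needs an assignment into
    \<open>D\<close>. Another default changes nothing, as only \<open>n\<close> variables are
    free.\<close>
  obtain u where u: "u \<in> D" using D_nonempty by blast
  have "satl A xs (translate K a) \<longleftrightarrow> sat A (sseq u xs) (translate K a)"
    unfolding satl_def using xs
    by (intro sat_cong[OF fm_below_translate[OF dom_below rel_below a]]) (simp add: sseq_def)
  also have "\<dots> \<longleftrightarrow> sat N (\<lambda>i. cl (sseq u xs i)) a"
    by (rule sat_translate) (use u xs in \<open>auto simp: sseq_def\<close>)
  also have "\<dots> \<longleftrightarrow> satl N (map cl xs) a"
    unfolding satl_def using xs by (intro sat_cong[OF a]) (simp add: sseq_def)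
  finally show ?thesis .
qed

text \<open>The successor is injective and misses zero, which is impossible on a finite
  domain.\<close>

lemma infinite_N:
  assumes "\<And>a. a \<in> basic_axioms \<Longrightarrow> N \<Turnstile> a"
  shows "infinite (dom N)"
proof
  assume fin: "finite (dom N)"
  have "N \<Turnstile> Neg (Eq (Succ (V 0)) Zero)" "N \<Turnstile> Imp (Eq (Succ (V 0)) (Succ (V 1))) (Eq (V 0) (V 1))"
    using assms unfolding basic_axioms_def by (metis insertI1 insertI2 models_All)+
  note ax = this[unfolded models_def, rule_format]
  have 1: "sc N x \<noteq> zr N" if "x \<in> dom N" for x using ax(1)[of "\<lambda>_. x"] that by auto
  have 2: "x = y" if "x \<in> dom N" "y \<in> dom N" "sc N x = sc N y" for x y
  proof -
    have "range (x ## (\<lambda>_. y)) \<subseteq> dom N" using that unfolding range_scons_subset by auto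
    from ax(2)[OF this] that(3) show ?thesis by simp
  qed
  have "sc N ` dom N \<subseteq> dom N" using closed_N by blast
  moreover have "inj_on (sc N) (dom N)" using 2 by (rule inj_onI)
  ultimately have "sc N ` dom N = dom N" using fin by (simp add: endo_inj_surj)
  then obtain x where "x \<in> dom N" "zr N = sc N x" using closed_N(1) by blast
  then show False using 1[of x] by simp
qed

end

section \<open>Structures arising from a retraction\<close>

definition CT_fragment :: "('p, tsym) translation \<Rightarrow> tsym fm set" where
  "CT_fragment J = basic_axioms \<union> (\<lambda>a. Alls 9 (induction_for a)) `
     insert (ascentF (domain J) (rel J LessS)) arith_inductions \<union> {Tarski_truth}"

definition iso_sentences :: "'p fm \<Rightarrow> ('q, 'p) translation \<Rightarrow> ('q, 'p) translation \<Rightarrow> 'p fm set" where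
  "iso_sentences F J K = {Alls 2 (Imp F (Conj (domain J \<bullet> [V 0]) (domain K \<bullet> [V 1]))),
     AllD J (ExD K (F \<bullet> [V 1, V 0])), AllD K (ExD J (F \<bullet> [V 0, V 1]))} \<union>
     range (\<lambda>s. let n = arity s; xs = map (\<lambda>i. V (n + i)) [0..<n]; ys = map V [0..<n] in
        Alls (2 * n) (Imp (conjs (map (\<lambda>i. F \<bullet> [xs ! i, ys ! i]) [0..<n]))
            (Iff (rel J s \<bullet> xs) (rel K s \<bullet> ys))))"

text \<open>What remains of a retraction when provability is replaced by truth of finitely many
  sentences in \<open>imodel A\<close>.\<close>

locale retract_model = interpreted_model K "imodel A"
  for K :: "(tsym, isym) translation" and A :: "nat set" +
  fixes J :: "(isym, tsym) translation" and F :: "isym fm"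
  assumes J_dom_below: "fm_below 1 (domain J)" and J_rel_below: "\<And>s. fm_below (arity s) (rel J s)"
    and F_below: "fm_below 2 F"
    and CT: "\<And>a. a \<in> CT_fragment J \<Longrightarrow> imodel A \<Turnstile> translate K a"
    and iso: "\<And>a. a \<in> iso_sentences F id_trans (comp_trans J K) \<Longrightarrow> imodel A \<Turnstile> a"
begin

text \<open>May relate a number to several elements of \<open>D\<close>; it is a function only
  modulo the equality of \<open>comp_trans J K\<close>.\<close>

definition "Fr x y \<longleftrightarrow> satl (imodel A) [x, y] F"

lemma sat_F [simp]: "sat (imodel A) e (F \<bullet> [s, t]) \<longleftrightarrow> Fr (tv (imodel A) e s) (tv (imodel A) e t)"
  using sat_inst_satl[OF F_below, of "[s, t]"] by (simp add: Fr_def)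

text \<open>Formulae of \<open>comp_trans J K\<close> evaluated in \<open>imodel A\<close> are those
  of \<open>J\<close> evaluated in the quotient \<open>N\<close>; from here on the composition is
  read as \<open>J\<close> inside \<open>N\<close>.\<close>

lemma sat_comp_dom [simp]:
  "sat (imodel A) e (domain (comp_trans J K) \<bullet> [t]) \<longleftrightarrow>
     tv (imodel A) e t \<in> D \<and> satl N [cl (tv (imodel A) e t)] (domain J)"
proof -
  have b: "fm_below 1 (domain (comp_trans J K))"
    using dom_below fm_below_translate[OF dom_below rel_below J_dom_below] by (simp add: comp_trans_def)
  have "satl (imodel A) [x] (domain (comp_trans J K)) \<longleftrightarrow> x \<in> D \<and> satl N [cl x] (domain J)" for x
  proof -
    have "satl (imodel A) [x] (domain (comp_trans J K)) \<longleftrightarrow>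
        x \<in> D \<and> satl (imodel A) [x] (translate K (domain J))"
      by (simp add: comp_trans_def satl_def tdom_def)
    then show ?thesis using satl_translate[OF J_dom_below, of "[x]"] by auto
  qed
  moreover have "sat (imodel A) e (domain (comp_trans J K) \<bullet> [t]) \<longleftrightarrow>
      satl (imodel A) (map (tv (imodel A) e) [t]) (domain (comp_trans J K))"
    by (rule sat_inst_satl[OF b]) simp
  ultimately show ?thesis by simp
qed

lemma sat_comp_rel:
  assumes "length ts = arity s" "\<forall>t\<in>set ts. tv (imodel A) e t \<in> D"
  shows "sat (imodel A) e (rel (comp_trans J K) s \<bullet> ts) \<longleftrightarrow>
     satl N (map (\<lambda>t. cl (tv (imodel A) e t)) ts) (rel J s)"
proof -
  have b: "fm_below (arity s) (rel (comp_trans J K) s)"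
    using fm_below_translate[OF dom_below rel_below J_rel_below] by (simp add: comp_trans_def)
  show ?thesis
    unfolding sat_inst_satl[OF b assms(1)]
    using satl_translate[OF J_rel_below[of s], of "map (tv (imodel A) e) ts"] assms
    by (simp add: comp_trans_def image_subset_iff o_def)
qed

lemma sat_id_dom [simp]: "sat (imodel A) e (domain id_trans \<bullet> [t])"
  by (simp add: id_trans_def sat_inst)

lemma sat_id_rel:
  "sat (imodel A) e (rel id_trans ZeroS \<bullet> [s]) \<longleftrightarrow> tv (imodel A) e s = 0"
  "sat (imodel A) e (rel id_trans SuccS \<bullet> [s, t]) \<longleftrightarrow> Suc (tv (imodel A) e s) = tv (imodel A) e t"
  "sat (imodel A) e (rel id_trans LessS \<bullet> [s, t]) \<longleftrightarrow> tv (imodel A) e s < tv (imodel A) e t"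
  "sat (imodel A) e (rel id_trans (PrS q) \<bullet> [s]) \<longleftrightarrow> tv (imodel A) e s \<in> A"
  by (auto simp add: id_trans_def sat_inst)

lemma Fr_D: "Fr x y \<Longrightarrow> y \<in> D \<and> satl N [cl y] (domain J)"
proof -
  assume F: "Fr x y"
  have "imodel A \<Turnstile> Imp F (Conj (domain id_trans \<bullet> [V 0]) (domain (comp_trans J K) \<bullet> [V 1]))"
    using iso by (metis (no_types, lifting) UnI1 insertI1 iso_sentences_def models_Alls)
  then have "sat (imodel A) (x ## y ## (\<lambda>_. 0)) (Imp F (Conj (domain id_trans \<bullet> [V 0])
      (domain (comp_trans J K) \<bullet> [V 1])))"
    unfolding models_A by blast
  moreover have "sat (imodel A) (x ## y ## (\<lambda>_. 0)) F \<longleftrightarrow> satl (imodel A) [x, y] F"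
    by (rule satl_cong[OF F_below]) (auto simp: less_2_cases_iff)
  ultimately show ?thesis using F by (simp add: Fr_def)
qed

lemma Fr_total: "\<exists>y. Fr x y"
proof -
  have "imodel A \<Turnstile> AllD id_trans (ExD (comp_trans J K) (F \<bullet> [V 1, V 0]))"
    using iso by (simp add: iso_sentences_def)
  then have "sat (imodel A) (\<lambda>_. 0) (AllD id_trans (ExD (comp_trans J K) (F \<bullet> [V 1, V 0])))"
    unfolding models_A by blast
  then show ?thesis by (auto simp: AllD_def ExD_def)
qed

lemma Fr_onto: "y \<in> D \<Longrightarrow> satl N [cl y] (domain J) \<Longrightarrow> \<exists>x. Fr x y"
proof -
  assume y: "y \<in> D" "satl N [cl y] (domain J)"
  have "imodel A \<Turnstile> AllD (comp_trans J K) (ExD id_trans (F \<bullet> [V 0, V 1]))"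
    using iso by (simp add: iso_sentences_def)
  then have "sat (imodel A) (\<lambda>_. 0) (AllD (comp_trans J K) (ExD id_trans (F \<bullet> [V 0, V 1])))"
    unfolding models_A by blast
  then show ?thesis using y by (auto simp: AllD_def ExD_def)
qed

lemma iso_rel:
  "imodel A \<Turnstile> (let n = arity s; xs = map (\<lambda>i. V (n + i)) [0..<n]; ys = map V [0..<n] in
     Imp (conjs (map (\<lambda>i. F \<bullet> [xs ! i, ys ! i]) [0..<n]))
       (Iff (rel id_trans s \<bullet> xs) (rel (comp_trans J K) s \<bullet> ys)))"
proof -
  have "(let n = arity s; xs = map (\<lambda>i. V (n + i)) [0..<n]; ys = map V [0..<n] in
        Alls (2 * n) (Imp (conjs (map (\<lambda>i. F \<bullet> [xs ! i, ys ! i]) [0..<n]))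
            (Iff (rel id_trans s \<bullet> xs) (rel (comp_trans J K) s \<bullet> ys)))) \<in> iso_sentences F id_trans (comp_trans J K)"
    unfolding iso_sentences_def by blast
  from iso[OF this] show ?thesis by (simp add: Let_def)
qed

text \<open>Among the preserved relations, zero and successor will pin down the correspondence, the
  order yields standardness, and the predicate recovers \<open>A\<close>.\<close>

lemma Fr_zero: "Fr x y \<Longrightarrow> x = 0 \<longleftrightarrow> satl N [cl y] (rel J ZeroS)"
proof -
  assume F: "Fr x y"
  show ?thesis
    using iso_rel[of ZeroS, unfolded models_A, rule_format, of "y ## x ## (\<lambda>_. 0)"] F Fr_D[OF F]
    by (auto simp: Let_def upt_simps sat_comp_rel sat_id_rel)
qed

lemma Fr_pred: "Fr x y \<Longrightarrow> x \<in> A \<longleftrightarrow> satl N [cl y] (rel J (PrS IndisP))"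
proof -
  assume F: "Fr x y"
  show ?thesis
    using iso_rel[of "PrS IndisP", unfolded models_A, rule_format, of "y ## x ## (\<lambda>_. 0)"] F Fr_D[OF F]
    by (auto simp: Let_def upt_simps sat_comp_rel sat_id_rel)
qed

lemma Fr_Suc: "Fr x y \<Longrightarrow> Fr x' y' \<Longrightarrow> Suc x = x' \<longleftrightarrow> satl N [cl y, cl y'] (rel J SuccS)"
proof -
  assume F: "Fr x y" "Fr x' y'"
  show ?thesis
    using iso_rel[of SuccS, unfolded models_A, rule_format, of "y ## y' ## x ## x' ## (\<lambda>_. 0)"]
      F Fr_D[OF F(1)] Fr_D[OF F(2)]
    by (auto simp: Let_def upt_simps sat_comp_rel sat_id_rel)
qed

lemma Fr_less: "Fr x y \<Longrightarrow> Fr x' y' \<Longrightarrow> x < x' \<longleftrightarrow> satl N [cl y, cl y'] (rel J LessS)"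
proof -
  assume F: "Fr x y" "Fr x' y'"
  show ?thesis
    using iso_rel[of LessS, unfolded models_A, rule_format, of "y ## y' ## x ## x' ## (\<lambda>_. 0)"]
      F Fr_D[OF F(1)] Fr_D[OF F(2)]
    by (auto simp: Let_def upt_simps sat_comp_rel sat_id_rel)
qed

lemma N_CT: "a \<in> CT_fragment J \<Longrightarrow> N \<Turnstile> a"
  using CT models_translate by blast

text \<open>Through \<open>Fr\<close> the order that \<open>J\<close> defines in \<open>N\<close> is
  the order of \<nat>: it has no maximal element, and the numbers corresponding to its elements
  serve as ranks. Thus \<open>well_founded_model\<close> applies to a copy of
  \<open>N\<close>.\<close>

lemma N_isomorphic_nat: "\<exists>h P. isomorphic_by h N (nat_model P)"
proof -
  \<comment> \<open>Makes the countable domain bijective with \<nat>, so that the copy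
    \<open>M\<close> has full domain.\<close>
  have "infinite (dom N)" by (rule infinite_N) (simp add: N_CT CT_fragment_def)
  moreover have "countable (dom N)" by (simp add: dom_N)
  ultimately have bij: "bij_betw (to_nat_on (dom N)) (dom N) UNIV" by (rule to_nat_on_infinite[rotated])
  define g where "g = to_nat_on (dom N)"
  define M where "M = transport g N"
  have inj: "inj_on g (dom N)" and ran: "g ` dom N = UNIV"
    using bij by (auto simp: g_def bij_betw_def)
  have gM: "isomorphic_by g N M" unfolding M_def by (rule isomorphic_transport[OF inj])
  have M_CT: "M \<Turnstile> a" if "a \<in> CT_fragment J" for a
    using N_CT[OF that] models_isomorphic[OF gM] by blast
  have rep: "\<exists>u\<in>D. z = g (cl u)" for z
  proof -
    have "z \<in> g ` cl ` D" using ran unfolding dom_N by simp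
    then show ?thesis by blast
  qed
  have sat_M: "satl M (map (\<lambda>u. g (cl u)) us) a \<longleftrightarrow> satl N (map cl us) a" if "set us \<subseteq> D" for us a
    using satl_isomorphic[OF gM, of "map cl us" a] that by (auto simp: dom_N o_def)
  have inj': "g (cl u) = g (cl v) \<longleftrightarrow> cl u = cl v" if "u \<in> D" "v \<in> D" for u v
    using inj that by (auto simp: dom_N inj_on_def)
  define rk where "rk z = (SOME x. \<exists>y. Fr x y \<and> z = g (cl y))" for z
  have rk: "\<exists>y. Fr (rk z) y \<and> z = g (cl y)" if "satl M [z] (domain J)" for z
  proof -
    obtain u where u: "u \<in> D" "z = g (cl u)" using rep by blast
    then have "satl N [cl u] (domain J)" using that sat_M[of "[u]"] by simp
    then have "\<exists>x y. Fr x y \<and> z = g (cl y)" using Fr_onto u by blast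
    then show ?thesis unfolding rk_def by (rule someI_ex)
  qed
  have "well_founded_model M (domain J) (rel J LessS) rk"
  proof unfold_locales
    show "dom M = UNIV" unfolding M_def transport_def Let_def using ran by simp
    show "M \<Turnstile> a" if "a \<in> basic_axioms" for a using that by (intro M_CT) (simp add: CT_fragment_def)
    show "M \<Turnstile> induction_for a" if "a \<in> arith_inductions" for a
    proof -
      have "M \<Turnstile> Alls 9 (induction_for a)" using that by (intro M_CT) (simp add: CT_fragment_def)
      then show ?thesis by simp
    qed
    have "M \<Turnstile> Alls 9 (induction_for (ascentF (domain J) (rel J LessS)))"
      by (intro M_CT) (simp add: CT_fragment_def)
    then show "M \<Turnstile> induction_for (ascentF (domain J) (rel J LessS))" by simp
    show "fm_below 1 (domain J)" by (rule J_dom_below)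
    show "fm_below 2 (rel J LessS)" using J_rel_below[of LessS] by simp
    show "rk x < rk y" if x: "satl M [x] (domain J)" "satl M [y] (domain J)" "satl M [x, y] (rel J LessS)" for x y
    proof -
      obtain u v where u: "Fr (rk x) u" "x = g (cl u)" and v: "Fr (rk y) v" "y = g (cl v)"
        using rk x by blast
      then have "satl N [cl u, cl v] (rel J LessS)"
        using x(3) sat_M[of "[u, v]"] Fr_D by auto
      then show ?thesis using Fr_less u v by blast
    qed
    show "\<exists>y. satl M [y] (domain J) \<and> satl M [x, y] (rel J LessS)" if x: "satl M [x] (domain J)" for x
    proof -
      obtain u where u: "Fr (rk x) u" "x = g (cl u)" using rk[OF x] by blast
      \<comment> \<open>The image of the next number is a larger element.\<close>
      obtain v where v: "Fr (Suc (rk x)) v" using Fr_total by blast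
      then have "satl N [cl u, cl v] (rel J LessS)" using Fr_less[OF u(1) v] by simp
      then show ?thesis using u v Fr_D[OF u(1)] Fr_D[OF v] sat_M[of "[u, v]"] sat_M[of "[v]"]
        by (intro exI[of _ "g (cl v)"]) simp
    qed
    show "\<exists>x. satl M [x] (domain J)"
    proof -
      obtain v where v: "Fr 0 v" using Fr_total by blast
      then show ?thesis using Fr_D[OF v] sat_M[of "[v]"] by (intro exI[of _ "g (cl v)"]) simp
    qed
  qed
  then obtain h P where "isomorphic_by h M (nat_model P)"
    using well_founded_model.isomorphic_nat by blast
  then show ?thesis using isomorphic_by_trans[OF gM] by blast
qed

text \<open>Pushing \<open>Fr\<close> through the isomorphism with a standard model eliminates
  \<open>K\<close> and the quotient: the resulting statement mentions only \<open>A\<close>, the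
  formulae of \<open>J\<close> and a truth predicate. In this form two sets can be compared.\<close>

lemma ex_graph:
  "\<exists>P G. nat_model P \<Turnstile> Tarski_truth \<and> (\<forall>x. \<exists>z. G x z) \<and>
     (\<forall>x z. G x z \<longrightarrow> satl (nat_model P) [z] (domain J)) \<and>
     (\<forall>z. satl (nat_model P) [z] (domain J) \<longrightarrow> (\<exists>x. G x z)) \<and>
     (\<forall>x z. G x z \<longrightarrow> (x = 0 \<longleftrightarrow> satl (nat_model P) [z] (rel J ZeroS))) \<and>
     (\<forall>x z x' z'. G x z \<longrightarrow> G x' z' \<longrightarrow> (Suc x = x' \<longleftrightarrow> satl (nat_model P) [z, z'] (rel J SuccS))) \<and>
     (\<forall>x z. G x z \<longrightarrow> (x \<in> A \<longleftrightarrow> satl (nat_model P) [z] (rel J (PrS IndisP))))"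
proof -
  obtain h P where iso: "isomorphic_by h N (nat_model P)" using N_isomorphic_nat by blast
  have ran: "h ` dom N = UNIV" using iso by (simp add: isomorphic_by_def bij_betw_def)
  have s1: "satl (nat_model P) [h (cl u)] a \<longleftrightarrow> satl N [cl u] a" if "u \<in> D" for u a
    using satl_isomorphic[OF iso, of "[cl u]" a] that by (simp add: dom_N)
  have s2: "satl (nat_model P) [h (cl u), h (cl v)] a \<longleftrightarrow> satl N [cl u, cl v] a"
    if "u \<in> D" "v \<in> D" for u v a
    using satl_isomorphic[OF iso, of "[cl u, cl v]" a] that by (simp add: dom_N)
  define G where "G x z \<longleftrightarrow> (\<exists>y. Fr x y \<and> z = h (cl y))" for x z
  have "nat_model P \<Turnstile> Tarski_truth"
    using N_CT[of Tarski_truth] models_isomorphic[OF iso] by (simp add: CT_fragment_def)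
  moreover have "\<exists>z. G x z" for x using Fr_total unfolding G_def by blast
  moreover have "satl (nat_model P) [z] (domain J)" if G: "G x z" for x z
    using G Fr_D s1 unfolding G_def by blast
  moreover have "\<exists>x. G x z" if z: "satl (nat_model P) [z] (domain J)" for z
  proof -
    have "z \<in> h ` cl ` D" using ran unfolding dom_N by simp
    then obtain u where u: "u \<in> D" "z = h (cl u)" by blast
    then show ?thesis using z s1 Fr_onto unfolding G_def by blast
  qed
  moreover have "x = 0 \<longleftrightarrow> satl (nat_model P) [z] (rel J ZeroS)" if G: "G x z" for x z
    using G Fr_zero Fr_D s1 unfolding G_def by blast
  moreover have "Suc x = x' \<longleftrightarrow> satl (nat_model P) [z, z'] (rel J SuccS)"
    if G: "G x z" "G x' z'" for x z x' z'
  proof -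
    obtain y y' where y: "Fr x y" "z = h (cl y)" "Fr x' y'" "z' = h (cl y')"
      using G unfolding G_def by blast
    then show ?thesis using Fr_Suc[OF y(1,3)] s2[of y y'] Fr_D[OF y(1)] Fr_D[OF y(3)] by simp
  qed
  moreover have "x \<in> A \<longleftrightarrow> satl (nat_model P) [z] (rel J (PrS IndisP))" if G: "G x z" for x z
    using G Fr_pred Fr_D s1 unfolding G_def by blast
  ultimately show ?thesis by (intro exI[of _ P] exI[of _ G]) simp
qed

end

section \<open>Rigidity of the standard model\<close>

lemma retract_models_eq:
  assumes "retract_model K A J F" "retract_model K B J F" shows "A = B"
proof -
  obtain P G where P: "nat_model P \<Turnstile> Tarski_truth" and
    G: "\<forall>x. \<exists>z. G x z" "\<forall>x z. G x z \<longrightarrow> satl (nat_model P) [z] (domain J)"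
     "\<forall>z. satl (nat_model P) [z] (domain J) \<longrightarrow> (\<exists>x. G x z)"
     "\<forall>x z. G x z \<longrightarrow> (x = 0 \<longleftrightarrow> satl (nat_model P) [z] (rel J ZeroS))"
     "\<forall>x z x' z'. G x z \<longrightarrow> G x' z' \<longrightarrow> (Suc x = x' \<longleftrightarrow> satl (nat_model P) [z, z'] (rel J SuccS))"
     "\<forall>x z. G x z \<longrightarrow> (x \<in> A \<longleftrightarrow> satl (nat_model P) [z] (rel J (PrS IndisP)))"
    using retract_model.ex_graph[OF assms(1)] by blast
  obtain Q H where Q: "nat_model Q \<Turnstile> Tarski_truth" and
    H: "\<forall>x. \<exists>z. H x z" "\<forall>x z. H x z \<longrightarrow> satl (nat_model Q) [z] (domain J)"
     "\<forall>z. satl (nat_model Q) [z] (domain J) \<longrightarrow> (\<exists>x. H x z)"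
     "\<forall>x z. H x z \<longrightarrow> (x = 0 \<longleftrightarrow> satl (nat_model Q) [z] (rel J ZeroS))"
     "\<forall>x z x' z'. H x z \<longrightarrow> H x' z' \<longrightarrow> (Suc x = x' \<longleftrightarrow> satl (nat_model Q) [z, z'] (rel J SuccS))"
     "\<forall>x z. H x z \<longrightarrow> (x \<in> B \<longleftrightarrow> satl (nat_model Q) [z] (rel J (PrS IndisP)))"
    using retract_model.ex_graph[OF assms(2)] by blast
  have "Q = P" by (rule truth_unique[OF Q P])
  \<comment> \<open>One common image per number is enough. An image \<open>z\<close> under
    \<open>G\<close> lies in the domain of \<open>J\<close>, so \<open>H\<close> relates some number
    to it, and preservation of zero or successor identifies that number as \<open>x\<close>.\<close>
  have "\<exists>z. G x z \<and> H x z" for x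
  proof (induction x)
    case 0
    obtain z where z: "G 0 z" using G(1) by blast
    then have "satl (nat_model P) [z] (domain J)" "satl (nat_model P) [z] (rel J ZeroS)"
      using G(2,4) by blast+
    moreover then obtain x where "H x z" using H(3) unfolding \<open>Q = P\<close> by blast
    ultimately have "x = 0" using H(4) unfolding \<open>Q = P\<close> by blast
    then show ?case using z \<open>H x z\<close> by blast
  next
    case (Suc x)
    then obtain z where z: "G x z" "H x z" by blast
    obtain z' where z': "G (Suc x) z'" using G(1) by blast
    then have "satl (nat_model P) [z'] (domain J)" "satl (nat_model P) [z, z'] (rel J SuccS)"
      using G(2,5) z by blast+
    moreover then obtain x' where "H x' z'" using H(3) unfolding \<open>Q = P\<close> by blast
    ultimately have "Suc x = x'" using H(5) z(2) unfolding \<open>Q = P\<close> by blast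
    then show ?case using z' \<open>H x' z'\<close> by blast
  qed
  then have "x \<in> A \<longleftrightarrow> x \<in> B" for x using G(6) H(6) by (metis \<open>Q = P\<close>)
  then show ?thesis by blast
qed

text \<open>Keeps the congruence sentences and the preservation clauses of an isomorphism finite in
  number.\<close>

lemma finite_UNIV_sym:
  assumes "finite (UNIV :: 'q set)" shows "finite (UNIV :: 'q sym set)"
proof -
  have "s \<in> {EqS, LessS, ZeroS, SuccS, AddS, MulS} \<union> range PrS" for s :: "'q sym"
    by (cases s) auto
  then have "UNIV \<subseteq> {EqS, LessS, ZeroS, SuccS, AddS, MulS} \<union> range (PrS :: 'q \<Rightarrow> 'q sym)" by blast
  then show ?thesis by (rule finite_subset) (simp add: assms)
qed

lemma finite_UNIV_tsym: "finite (UNIV :: tsym set)" and finite_UNIV_isym: "finite (UNIV :: isym set)"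
proof -
  have "t \<in> {TruthP}" "i \<in> {IndisP}" for t i by (cases t; simp) (cases i; simp)
  then show "finite (UNIV :: tsym set)" "finite (UNIV :: isym set)"
    by (metis finite.simps finite_subset subsetI)+
qed

text \<open>Nine outer quantifiers are a common choice for all instances: \<open>PA\<close> admits
  this closure when the induction formula has its free variables below ten, and even
  \<open>insertF\<close> has just seven.\<close>

lemma CT_fragment_subset:
  assumes "fm_below 1 (domain J)" "fm_below 2 (rel J LessS)"
  shows "CT_fragment J \<subseteq> CT"
proof -
  have "fm_below (Suc 9) (ascentF (domain J) (rel J LessS))"
    using fm_below_inst[OF assms(1)] fm_below_inst[OF assms(2)]
    by (simp add: ascentF_def funpow_simps pr_def)
  moreover have "fm_below (Suc 9) a" if "a \<in> (arith_inductions :: tsym fm set)" for a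
    using that unfolding arith_inductions_def by auto
  ultimately show ?thesis unfolding CT_fragment_def CT_def PA_def by blast
qed

theorem theorem5p10:
  shows "\<not> retract_of (PAI0 \<union> {alpha}) CT"
proof
  assume "retract_of (PAI0 \<union> {alpha}) CT"
  then obtain J :: "(isym, tsym) translation" and K :: "(tsym, isym) translation" and F where
    J: "interpretation_of J (PAI0 \<union> {alpha}) CT" and
    K: "interpretation_of K CT (PAI0 \<union> {alpha})" and
    F: "defines_iso (PAI0 \<union> {alpha}) F id_trans (comp_trans J K)"
    unfolding retract_of_def by blast
  let ?U = "PAI0 \<union> {alpha}"
  have J_below: "fm_below 1 (domain J)" "\<And>s. fm_below (arity s) (rel J s)"
    using J by (auto simp: interpretation_of_def)
  \<comment> \<open>Collects every sentence whose truth \<open>retract_model\<close> asks for. It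
    does not depend on the set interpreting \<open>I\<close>, so one finite set of axioms will serve
    both models.\<close>
  define S where "S = {Exi (domain K), AllD K (rel K EqS \<bullet> [V 0, V 0])} \<union> range (congruence K) \<union>
    total K ` {ZeroS, SuccS, AddS, MulS} \<union> functional K ` {ZeroS, SuccS, AddS, MulS} \<union>
    translate K ` CT_fragment J \<union> iso_sentences F id_trans (comp_trans J K)"
  have "finite S"
    using finite_UNIV_sym[OF finite_UNIV_tsym] finite_UNIV_sym[OF finite_UNIV_isym]
    unfolding S_def CT_fragment_def iso_sentences_def basic_axioms_def arith_inductions_def
    by simp
  moreover have "?U \<turnstile> a" if "a \<in> S" for a
  proof -
    have "?U \<turnstile> translate K b" if "b \<in> CT_fragment J" for b
      using K CT_fragment_subset[OF J_below(1), of] J_below(2)[of LessS] that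
      unfolding interpretation_of_def by auto
    moreover have "?U \<turnstile> b" if "b \<in> iso_sentences F id_trans (comp_trans J K)" for b
      using F that unfolding defines_iso_def iso_sentences_def Let_def by blast
    ultimately show ?thesis using K that unfolding S_def interpretation_of_def by blast
  qed
  \<comment> \<open>\<open>H\<close> suffices for all structures on \<nat> at once, so it is fixed
    before \<open>A\<close> and \<open>B\<close> are constructed from it.\<close>
  ultimately obtain H where H: "H \<subseteq> ?U" "finite H"
    "\<And>M :: (nat, isym) struct. dom M = UNIV \<Longrightarrow> \<forall>h\<in>H. M \<Turnstile> h \<Longrightarrow> \<forall>a\<in>S. M \<Turnstile> a"
    using proves_finite_sound_set[of S ?U, where ?'a = nat] by blast
  obtain A B where AB: "A \<noteq> B" "\<forall>a\<in>H. imodel A \<Turnstile> a" "\<forall>a\<in>H. imodel B \<Turnstile> a"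
    using two_models[OF H(2,1)] by blast
  have "retract_model K C J F" if C: "\<forall>a\<in>H. imodel C \<Turnstile> a" for C
  proof -
    have S: "imodel C \<Turnstile> a" if "a \<in> S" for a using H(3)[OF _ C] that by simp
    show ?thesis
    proof unfold_locales
      show "fm_below 1 (domain K)" "fm_below (arity s) (rel K s)" for s
        using K by (auto simp: interpretation_of_def)
      show "fm_below 2 F" using F by (auto simp: defines_iso_def)
    qed (use J_below in \<open>auto intro!: S simp: S_def\<close>)
  qed
  then show False using retract_models_eq AB by blast
qed

end
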